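(* Let $\mathbb F$ be an algebraically closed field of characteristic zero. Suppose that the nilpotent element $e\in\mathfrak g=\mathfrak{gl}_{m+n}(\mathbb F)$ is defined by the partition $(n,1^m)$ with $n\ge2$, $m\ge0$ (one Jordan block of size $n$ and $m$ blocks of size $1$). Then the null-cone $\mathcal N(e)\subset\mathfrak g_e^*$ has $m+1$ irreducible components.
   Context: $\mathfrak g_e$ is the centraliser of $e$ in $\mathfrak g$, $G_e$ the stabiliser of $e$ in $G=GL_{m+n}(\mathbb F)$. The null-cone $\mathcal N(e)$ is the fibre through $0$ of the quotient morphism $\mathfrak g_e^*\to\mathrm{Spec}\,\mathcal S(\mathfrak g_e)^{G_e}$, i.e. the set of common zeros in $\mathfrak g_e^*$ of all homogeneous elements of positive degree of $\mathcal S(\mathfrak g_e)^{G_e}=\mathcal S(\mathfrak g_e)^{\mathfrak g_e}$, where $\mathcal S(\mathfrak g_e)=\mathbb F[\mathfrak g_e^*]$ is the symmetric algebra. *)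

theory Defs
  imports
    "Jordan_Normal_Form.Jordan_Normal_Form"
    "HOL-Analysis.Abstract_Topology"
begin

definition lie_centraliser :: "'a::field mat \<Rightarrow> 'a mat set" where
  "lie_centraliser e =
     {x \<in> carrier_mat (dim_row e) (dim_row e). e * x - x * e = 0\<^sub>m (dim_row e) (dim_row e)}"

definition general_linear_group :: "'a::field itself \<Rightarrow> nat \<Rightarrow> 'a mat monoid" where
  "general_linear_group ty N = units_of (ring_mat ty N ())"

definition group_stabiliser :: "'a::field mat \<Rightarrow> 'a mat set" where
  "group_stabiliser e =
     (let G = general_linear_group TYPE('a) (dim_row e)
      in {g \<in> carrier G. g * e * inv\<^bsub>G\<^esub> g = e})"

text \<open>Linear forms on the centraliser are made unique as HOL functions by being
  \<^const>\<open>undefined\<close> outside of it.\<close>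

definition centraliser_dual :: "'a::field mat \<Rightarrow> ('a mat \<Rightarrow> 'a) set" where
  "centraliser_dual e =
     {\<xi> \<in> extensional (lie_centraliser e).
        (\<forall>x\<in>lie_centraliser e. \<forall>y\<in>lie_centraliser e. \<xi> (x + y) = \<xi> x + \<xi> y) \<and>
        (\<forall>c. \<forall>x\<in>lie_centraliser e. \<xi> (c \<cdot>\<^sub>m x) = c * \<xi> x)}"

definition coadjoint :: "'a::field mat \<Rightarrow> 'a mat \<Rightarrow> ('a mat \<Rightarrow> 'a) \<Rightarrow> ('a mat \<Rightarrow> 'a)" where
  "coadjoint e g \<xi> =
     (let G = general_linear_group TYPE('a) (dim_row e)
      in restrict (\<lambda>x. \<xi> (inv\<^bsub>G\<^esub> g * x * g)) (lie_centraliser e))"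

text \<open>Over an infinite field the symmetric algebra of a finite-dimensional space is the algebra
  of polynomial functions on the dual space. An element \<open>x\<close> of the centraliser is the function
  \<open>\<xi> \<mapsto> \<xi> x\<close>. All functions below are only relevant on \<^const>\<open>centraliser_dual\<close>; their values
  elsewhere are never used.\<close>

inductive_set sym_algebra :: "'a::field mat \<Rightarrow> (('a mat \<Rightarrow> 'a) \<Rightarrow> 'a) set"
  for e :: "'a mat" where
  const: "(\<lambda>_. c) \<in> sym_algebra e"
| eval: "x \<in> lie_centraliser e \<Longrightarrow> (\<lambda>\<xi>. \<xi> x) \<in> sym_algebra e"
| add: "f \<in> sym_algebra e \<Longrightarrow> h \<in> sym_algebra e \<Longrightarrow> (\<lambda>\<xi>. f \<xi> + h \<xi>) \<in> sym_algebra e"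
| mult: "f \<in> sym_algebra e \<Longrightarrow> h \<in> sym_algebra e \<Longrightarrow> (\<lambda>\<xi>. f \<xi> * h \<xi>) \<in> sym_algebra e"

text \<open>\<open>homogeneous e d f\<close>: \<open>f\<close> lies in the span of the products of \<open>d\<close> elements of the
  centraliser.\<close>

inductive homogeneous :: "'a::field mat \<Rightarrow> nat \<Rightarrow> (('a mat \<Rightarrow> 'a) \<Rightarrow> 'a) \<Rightarrow> bool"
  for e :: "'a mat" where
  const: "homogeneous e 0 (\<lambda>_. c)"
| mult: "x \<in> lie_centraliser e \<Longrightarrow> homogeneous e d f \<Longrightarrow> homogeneous e (Suc d) (\<lambda>\<xi>. \<xi> x * f \<xi>)"
| add: "homogeneous e d f \<Longrightarrow> homogeneous e d h \<Longrightarrow> homogeneous e d (\<lambda>\<xi>. f \<xi> + h \<xi>)"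

definition sym_invariants :: "'a::field mat \<Rightarrow> (('a mat \<Rightarrow> 'a) \<Rightarrow> 'a) set" where
  "sym_invariants e =
     {f \<in> sym_algebra e. \<forall>g\<in>group_stabiliser e. \<forall>\<xi>\<in>centraliser_dual e. f (coadjoint e g \<xi>) = f \<xi>}"

definition null_cone :: "'a::field mat \<Rightarrow> ('a mat \<Rightarrow> 'a) set" where
  "null_cone e =
     {\<xi> \<in> centraliser_dual e. \<forall>d>0. \<forall>f\<in>sym_invariants e. homogeneous e d f \<longrightarrow> f \<xi> = 0}"

definition zero_locus ::
  "'a::field mat \<Rightarrow> (('a mat \<Rightarrow> 'a) \<Rightarrow> 'a) set \<Rightarrow> ('a mat \<Rightarrow> 'a) set" where
  "zero_locus e P = {\<xi> \<in> centraliser_dual e. \<forall>f\<in>P. f \<xi> = 0}"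

definition zariski_topology :: "'a::field mat \<Rightarrow> ('a mat \<Rightarrow> 'a) topology" where
  "zariski_topology e =
     topology (\<lambda>U. \<exists>P \<subseteq> sym_algebra e. U = centraliser_dual e - zero_locus e P)"

definition irreducible_in :: "'b topology \<Rightarrow> 'b set \<Rightarrow> bool" where
  "irreducible_in X C \<longleftrightarrow> C \<subseteq> topspace X \<and> C \<noteq> {} \<and>
     (\<forall>A B. closedin X A \<longrightarrow> closedin X B \<longrightarrow> C \<subseteq> A \<union> B \<longrightarrow> C \<subseteq> A \<or> C \<subseteq> B)"

definition irreducible_components :: "'b topology \<Rightarrow> 'b set set" where
  "irreducible_components X =
     {C. irreducible_in X C \<and> (\<forall>D. irreducible_in X D \<longrightarrow> C \<subseteq> D \<longrightarrow> D = C)}"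

lemma homogeneous_imp_sym_algebra: "homogeneous e d f \<Longrightarrow> f \<in> sym_algebra e"
  by (induction rule: homogeneous.induct)
    (simp_all add: sym_algebra.const sym_algebra.eval sym_algebra.add sym_algebra.mult)

lemma istopology_zariski:
  "istopology (\<lambda>U. \<exists>P \<subseteq> sym_algebra e. U = centraliser_dual e - zero_locus e P)"
  unfolding istopology_def
proof (intro conjI allI impI)
  fix S T
  assume "\<exists>P\<subseteq>sym_algebra e. S = centraliser_dual e - zero_locus e P"
    and "\<exists>P\<subseteq>sym_algebra e. T = centraliser_dual e - zero_locus e P"
  then obtain P Q where PQ: "P \<subseteq> sym_algebra e" "Q \<subseteq> sym_algebra e"
    and ST: "S = centraliser_dual e - zero_locus e P" "T = centraliser_dual e - zero_locus e Q"
    by blast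
  let ?R = "{(\<lambda>\<xi>. f \<xi> * h \<xi>) | f h. f \<in> P \<and> h \<in> Q}"
  have "?R \<subseteq> sym_algebra e"
  proof
    fix k assume "k \<in> ?R"
    then obtain f h where "k = (\<lambda>\<xi>. f \<xi> * h \<xi>)" "f \<in> P" "h \<in> Q"
      by blast
    then show "k \<in> sym_algebra e"
      using PQ sym_algebra.mult[of f e h] by blast
  qed
  moreover have "S \<inter> T = centraliser_dual e - zero_locus e ?R"
  proof -
    have eq: "(\<forall>k\<in>?R. k \<xi> = 0) \<longleftrightarrow> (\<forall>f\<in>P. f \<xi> = 0) \<or> (\<forall>h\<in>Q. h \<xi> = 0)" (is "?A = ?B") for \<xi>
    proof
      assume A: ?A
      have "f \<xi> = 0 \<or> h \<xi> = 0" if "f \<in> P" "h \<in> Q" for f h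
      proof -
        have "(\<lambda>\<xi>. f \<xi> * h \<xi>) \<in> ?R" using that by blast
        from bspec[OF A this] show ?thesis by simp
      qed
      then show ?B by metis
    next
      assume ?B
      then show ?A by (elim disjE) auto
    qed
    have "zero_locus e ?R = zero_locus e P \<union> zero_locus e Q"
      unfolding zero_locus_def eq by blast
    then show ?thesis
      by (simp only: ST Diff_Un)
  qed
  ultimately show "\<exists>P\<subseteq>sym_algebra e. S \<inter> T = centraliser_dual e - zero_locus e P"
    by blast
next
  fix \<K>
  assume "\<forall>K\<in>\<K>. \<exists>P\<subseteq>sym_algebra e. K = centraliser_dual e - zero_locus e P"
  then obtain P where P: "\<And>K. K \<in> \<K> \<Longrightarrow> P K \<subseteq> sym_algebra e"
      "\<And>K. K \<in> \<K> \<Longrightarrow> K = centraliser_dual e - zero_locus e (P K)"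
    by metis
  have "\<Union>\<K> = (\<Union>K\<in>\<K>. centraliser_dual e - zero_locus e (P K))"
    using SUP_cong[OF refl P(2), of \<K> "\<lambda>K. K"] by (simp only: image_ident)
  also have "\<dots> = centraliser_dual e - zero_locus e (\<Union>K\<in>\<K>. P K)"
    unfolding zero_locus_def by blast
  finally show "\<exists>P\<subseteq>sym_algebra e. \<Union>\<K> = centraliser_dual e - zero_locus e P"
    using P(1) by (intro exI[of _ "\<Union>K\<in>\<K>. P K"] conjI UN_least)
qed

lemma openin_zariski:
  "openin (zariski_topology e) U \<longleftrightarrow>
     (\<exists>P \<subseteq> sym_algebra e. U = centraliser_dual e - zero_locus e P)"
  unfolding zariski_topology_def topology_inverse'[OF istopology_zariski] ..

lemma topspace_zariski [simp]: "topspace (zariski_topology e) = centraliser_dual e"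
proof
  show "topspace (zariski_topology e) \<subseteq> centraliser_dual e"
    unfolding topspace_def openin_zariski by blast
  have "zero_locus e {\<lambda>_. 1} = {}"
    by (auto simp: zero_locus_def)
  then have "openin (zariski_topology e) (centraliser_dual e)"
    unfolding openin_zariski
    by (intro exI[of _ "{\<lambda>_. 1}"]) (simp add: sym_algebra.const)
  then show "centraliser_dual e \<subseteq> topspace (zariski_topology e)"
    by (rule openin_subset)
qed

lemma closedin_zariski:
  "closedin (zariski_topology e) C \<longleftrightarrow> (\<exists>P \<subseteq> sym_algebra e. C = zero_locus e P)"
proof -
  have sub: "zero_locus e P \<subseteq> centraliser_dual e" for P
    by (auto simp: zero_locus_def)
  have "C \<subseteq> centraliser_dual e \<and> centraliser_dual e - C = centraliser_dual e - zero_locus e P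
      \<longleftrightarrow> C = zero_locus e P" for P
    using sub[of P] by blast
  then show ?thesis
    unfolding closedin_def openin_zariski topspace_zariski by blast
qed

lemma group_stabiliser_iff:
  fixes e :: "'a::field mat"
  assumes "e \<in> carrier_mat N N"
  shows "g \<in> group_stabiliser e \<longleftrightarrow>
    (\<exists>h. g \<in> carrier_mat N N \<and> h \<in> carrier_mat N N \<and> g * h = 1\<^sub>m N \<and> h * g = 1\<^sub>m N \<and>
         inv\<^bsub>general_linear_group TYPE('a) N\<^esub> g = h \<and> g * e * h = e)"
proof -
  let ?M = "ring_mat TYPE('a) N ()" and ?G = "general_linear_group TYPE('a) N"
  interpret R: ring ?M by (rule ring_mat)
  interpret G: group ?G
    unfolding general_linear_group_def by (rule R.units_group)
  have M: "carrier ?M = carrier_mat N N" "\<one>\<^bsub>?M\<^esub> = 1\<^sub>m N" "\<And>x y. x \<otimes>\<^bsub>?M\<^esub> y = x * y"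
    by (auto simp: ring_mat_def)
  have carr: "carrier ?G = Units ?M"
    by (simp add: general_linear_group_def units_of_carrier)
  have inv_eq: "inv\<^bsub>?G\<^esub> x = inv\<^bsub>?M\<^esub> x" if "x \<in> Units ?M" for x
    unfolding general_linear_group_def using that by (rule R.units_of_inv)
  have dim: "dim_row e = N" using assms by simp
  show ?thesis (is "?L \<longleftrightarrow> ?R")
  proof
    assume ?L
    then have g: "g \<in> Units ?M" and e: "g * e * inv\<^bsub>?G\<^esub> g = e"
      by (auto simp: group_stabiliser_def dim carr)
    show ?R
      using R.Units_closed[OF g] R.Units_inv_closed[OF g] R.Units_r_inv[OF g] R.Units_l_inv[OF g] e
      by (simp add: M inv_eq[OF g])
  next
    assume ?R
    then have "g \<in> Units ?M" "g * e * inv\<^bsub>?G\<^esub> g = e"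
      by (auto simp: Units_def M)
    then show ?L
      by (simp add: group_stabiliser_def dim carr)
  qed
qed

end

theory Submission
  imports Defs
begin

text \<open>Let \<open>d = m + 1\<close>. Evaluating a linear form on \<open>Hom(V / eV, ker e)\<close>, which sits inside the
  centraliser, gives a \<open>d \<times> d\<close> matrix \<open>M\<close>, and the remaining coordinates are the values on the
  powers of \<open>e\<close>, which are central. The stabiliser acts by \<open>M \<mapsto> X M Y\<close> with \<open>det X det Y = 1\<close>, fixing
  the matrix \<open>J = diag (0, 1, \<dots>, 1)\<close> of the trace form, so the coefficients of \<open>det (s M - J)\<close> in \<open>s\<close>
  are homogeneous invariants. On the null-cone this pencil is therefore singular, that is
  \<open>(M\<^sup>k)\<^sub>0\<^sub>0 = 0\<close> for all \<open>k > 0\<close>; equivalently, some \<open>M\<close>-stable subspace of dimension \<open>r \<le> m\<close>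
  contains \<open>M e\<^sub>0\<close> and is killed by the coordinate \<open>e\<^sub>0\<^sup>T\<close>.
  Conversely, an invariant \<open>f\<close> takes the same value at such an \<open>M\<close> and at its block diagonal part,
  by letting a one-parameter torus degenerate. The unipotent part of the stabiliser adds rank one
  matrices to \<open>M\<close>, and combining both facts moves the block diagonal part to \<open>0\<close> without changing \<open>f\<close>.
  For fixed \<open>r\<close> these matrices form an irreducible set, being parametrised by an open subset
  of a linear space, and for different \<open>r\<close> the closures are separated by minors of Krylov matrices.\<close>

subsection \<open>Polynomial functions of one parameter\<close>

text \<open>For S in the d x d matrices the trace of \<open>K * S * L\<close> is the trace of
  \<open>S * J\<close>, which is why J is the matrix of an invariant linear form. Its corank is one
  because, for n \<ge> 2, the kernel line of the long Jordan block lies in the image of e. Hence det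
  (s M - J) is det (s M - 1) plus the (0, 0) cofactor of s M - 1. Its vanishing says that the (0, 0)
  entry of the inverse of 1 - s M is 1, and the expansion in s gives the condition on the powers of
  M.

  The ring of invariants is never determined. The pencil and the powers of e only bound the
  null-cone from above; the opposite inclusion has to treat an arbitrary invariant. The torus alone
  is not enough there: it fixes the two diagonal blocks, which are arbitrary square matrices, in
  particular not nilpotent in general.

  The pieces for different r overlap (all of them contain 0), so components are compared only
  through closed sets that contain one piece and not another.\<close>

definition polyfun :: "('a::comm_ring_1 \<Rightarrow> 'a) \<Rightarrow> bool" where
  "polyfun f \<longleftrightarrow> (\<exists>p. \<forall>t. f t = poly p t)"

lemma polyfun_const [simp, intro]: "polyfun (\<lambda>_. c)"
  unfolding polyfun_def by (rule exI[of _ "[:c:]"]) simp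

lemma polyfun_ident [simp, intro]: "polyfun (\<lambda>t. t)"
  unfolding polyfun_def by (rule exI[of _ "[:0, 1:]"]) simp

lemma polyfun_add [intro]:
  assumes "polyfun f" "polyfun g" shows "polyfun (\<lambda>t. f t + g t)"
proof -
  obtain p q where "\<And>t. f t = poly p t" "\<And>t. g t = poly q t"
    using assms unfolding polyfun_def by blast
  then show ?thesis unfolding polyfun_def by (intro exI[of _ "p + q"]) simp
qed

lemma polyfun_mult [intro]:
  assumes "polyfun f" "polyfun g" shows "polyfun (\<lambda>t. f t * g t)"
proof -
  obtain p q where "\<And>t. f t = poly p t" "\<And>t. g t = poly q t"
    using assms unfolding polyfun_def by blast
  then show ?thesis unfolding polyfun_def by (intro exI[of _ "p * q"]) simp
qed

lemma polyfun_diff [intro]: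
  assumes "polyfun f" "polyfun g" shows "polyfun (\<lambda>t. f t - g t)"
  using polyfun_add[OF assms(1) polyfun_mult[OF polyfun_const[of "-1"] assms(2)]] by simp

lemma polyfun_sum [intro]:
  "(\<And>i. i \<in> S \<Longrightarrow> polyfun (f i)) \<Longrightarrow> polyfun (\<lambda>t. \<Sum>i\<in>S. f i t)"
  by (induction S rule: infinite_finite_induct) auto

lemma polyfun_prod [intro]:
  "(\<And>i. i \<in> S \<Longrightarrow> polyfun (f i)) \<Longrightarrow> polyfun (\<lambda>t. \<Prod>i\<in>S. f i t)"
  by (induction S rule: infinite_finite_induct) auto

lemma polyfun_power [intro]: "polyfun f \<Longrightarrow> polyfun (\<lambda>t. f t ^ k)"
  by (induction k) auto

lemma polyfun_if:
  "polyfun f \<Longrightarrow> polyfun g \<Longrightarrow> polyfun (\<lambda>t. if b then f t else g t)"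
  by (cases b) simp_all

text \<open>Two nonempty open subsets of the affine line over an infinite field meet. The
  irreducibility of the pieces of the null-cone is reduced to this one-dimensional case.\<close>

lemma polyfun_mult_nonzero:
  fixes f g :: "'a::field_char_0 \<Rightarrow> 'a"
  assumes "polyfun f" "polyfun g" "f a \<noteq> 0" "g b \<noteq> 0"
  shows "\<exists>t. f t * g t \<noteq> 0"
proof -
  obtain p q where pq: "\<And>t. f t = poly p t" "\<And>t. g t = poly q t"
    using assms unfolding polyfun_def by blast
  then have "p * q \<noteq> 0" using assms by auto
  then have "poly (p * q) \<noteq> poly 0"
    using poly_eq_poly_eq_iff by blast
  then show ?thesis unfolding pq poly_mult[symmetric] by (metis poly_0 ext)
qed

text \<open>The density form of the same fact: an identity valid off the zeros of \<open>g\<close>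
  extends to them. It serves to cancel a factor s and to pass to the limit s = 0.\<close>

lemma polyfun_eq_zero:
  fixes f :: "'a::field_char_0 \<Rightarrow> 'a"
  assumes "polyfun f" "polyfun g" "g a \<noteq> 0" "\<And>t. g t \<noteq> 0 \<Longrightarrow> f t = 0"
  shows "f t = 0"
proof (rule ccontr)
  assume "f t \<noteq> 0"
  from polyfun_mult_nonzero[OF assms(1,2) this assms(3)] show False
    using assms(4) by auto
qed

section \<open>Matrices whose entries are polynomials in one parameter\<close>

definition polymat :: "nat \<Rightarrow> nat \<Rightarrow> ('a::comm_ring_1 \<Rightarrow> 'a mat) \<Rightarrow> bool" where
  "polymat nr nc A \<longleftrightarrow> (\<forall>t. A t \<in> carrier_mat nr nc) \<and>
     (\<forall>i<nr. \<forall>j<nc. polyfun (\<lambda>t. A t $$ (i, j)))"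

lemma polymatD:
  "polymat nr nc A \<Longrightarrow> A t \<in> carrier_mat nr nc"
  "polymat nr nc A \<Longrightarrow> i < nr \<Longrightarrow> j < nc \<Longrightarrow> polyfun (\<lambda>t. A t $$ (i, j))"
  by (auto simp: polymat_def)

lemma polymat_const: "A \<in> carrier_mat nr nc \<Longrightarrow> polymat nr nc (\<lambda>_. A)"
  by (auto simp: polymat_def)

lemma index_mult_mat_sum:
  "A \<in> carrier_mat nr n \<Longrightarrow> B \<in> carrier_mat n nc \<Longrightarrow> i < nr \<Longrightarrow> j < nc \<Longrightarrow>
   (A * B) $$ (i, j) = (\<Sum>k<n. A $$ (i, k) * B $$ (k, j))"
  by (auto simp: scalar_prod_def atLeast0LessThan intro!: sum.cong)

lemma polymat_mult:
  assumes A: "polymat nr n A" and B: "polymat n nc B"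
  shows "polymat nr nc (\<lambda>t. A t * B t)"
  unfolding polymat_def
proof (intro conjI allI impI)
  show "A t * B t \<in> carrier_mat nr nc" for t
    using polymatD(1)[OF A] polymatD(1)[OF B] by (rule mult_carrier_mat)
  fix i j assume ij: "i < nr" "j < nc"
  have "polyfun (\<lambda>t. \<Sum>k<n. A t $$ (i, k) * B t $$ (k, j))"
    using polymatD(2)[OF A] polymatD(2)[OF B] ij by (intro polyfun_sum polyfun_mult) auto
  then show "polyfun (\<lambda>t. (A t * B t) $$ (i, j))"
    using index_mult_mat_sum[OF polymatD(1)[OF A] polymatD(1)[OF B] ij] by simp
qed

lemma polymat_add:
  assumes A: "polymat nr nc A" and B: "polymat nr nc B"
  shows "polymat nr nc (\<lambda>t. A t + B t)"
  unfolding polymat_def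
proof (intro conjI allI impI)
  show "A t + B t \<in> carrier_mat nr nc" for t
    using polymatD(1)[OF A] polymatD(1)[OF B] by auto
  fix i j assume ij: "i < nr" "j < nc"
  have "(A t + B t) $$ (i, j) = A t $$ (i, j) + B t $$ (i, j)" for t
    using polymatD(1)[OF A, of t] polymatD(1)[OF B, of t] ij by auto
  then show "polyfun (\<lambda>t. (A t + B t) $$ (i, j))"
    using polymatD(2)[OF A ij] polymatD(2)[OF B ij] by auto
qed

lemma polymat_smult:
  assumes c: "polyfun c" and A: "polymat nr nc A"
  shows "polymat nr nc (\<lambda>t. c t \<cdot>\<^sub>m A t)"
  unfolding polymat_def
proof (intro conjI allI impI)
  show "c t \<cdot>\<^sub>m A t \<in> carrier_mat nr nc" for t
    using polymatD(1)[OF A] by auto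
  fix i j assume ij: "i < nr" "j < nc"
  have "(c t \<cdot>\<^sub>m A t) $$ (i, j) = c t * A t $$ (i, j)" for t
    using polymatD(1)[OF A, of t] ij by auto
  then show "polyfun (\<lambda>t. (c t \<cdot>\<^sub>m A t) $$ (i, j))"
    using polymatD(2)[OF A ij] c by auto
qed

lemma polyfun_det:
  assumes A: "polymat n n A"
  shows "polyfun (\<lambda>t. det (A t))"
proof -
  have "polyfun (\<lambda>t. \<Sum>p\<in>{p. p permutes {0..<n}}. signof p * (\<Prod>i = 0..<n. A t $$ (i, p i)))"
    using polymatD(2)[OF A] by (intro polyfun_sum polyfun_mult polyfun_prod) auto
  then show ?thesis using det_def'[OF polymatD(1)[OF A]] by simp
qed

lemma polymat_adj:
  assumes A: "polymat n n A"
  shows "polymat n n (\<lambda>t. adj_mat (A t))"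
  unfolding polymat_def
proof (intro conjI allI impI)
  show "adj_mat (A t) \<in> carrier_mat n n" for t
    using adj_mat(1)[OF polymatD(1)[OF A]] .
  fix i j assume ij: "i < n" "j < n"
  have del: "polymat (n - 1) (n - 1) (\<lambda>t. mat_delete (A t) j i)"
    unfolding polymat_def
  proof (intro conjI allI impI)
    show "mat_delete (A t) j i \<in> carrier_mat (n - 1) (n - 1)" for t
      using mat_delete_carrier[OF polymatD(1)[OF A]] .
    fix k l assume kl: "k < n - 1" "l < n - 1"
    have "mat_delete (A t) j i $$ (k, l) =
        A t $$ (if k < j then k else Suc k, if l < i then l else Suc l)" for t
      using kl polymatD(1)[OF A, of t] unfolding mat_delete_def by auto
    then show "polyfun (\<lambda>t. mat_delete (A t) j i $$ (k, l))"
      using kl polymatD(2)[OF A] by simp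
  qed
  have "adj_mat (A t) $$ (i, j) = (-1) ^ (j + i) * det (mat_delete (A t) j i)" for t
    using ij polymatD(1)[OF A, of t] unfolding adj_mat_def cofactor_def by auto
  then show "polyfun (\<lambda>t. adj_mat (A t) $$ (i, j))"
    using polyfun_mult[OF polyfun_const polyfun_det[OF del]] by simp
qed

subsection \<open>Singular pencils and flags\<close>

lemma pow_mat_Suc_left:
  assumes "A \<in> carrier_mat n n" shows "A ^\<^sub>m Suc k = A * A ^\<^sub>m k"
proof (induction k)
  case (Suc k)
  have "A ^\<^sub>m Suc (Suc k) = (A * A ^\<^sub>m k) * A" using Suc by simp
  also have "\<dots> = A * (A ^\<^sub>m k * A)"
    using assms by (intro assoc_mult_mat[of _ n n _ n _ n]) auto
  finally show ?case by simp
qed (use assms in auto)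

section \<open>The pencil s M - J and the powers of M\<close>

definition trace_form :: "nat \<Rightarrow> 'a::{zero,one} mat" where
  "trace_form d = mat d d (\<lambda>(i, j). if i = j \<and> i \<noteq> 0 then 1 else 0)"

lemma trace_form_carrier [simp]: "trace_form d \<in> carrier_mat d d"
  by (simp add: trace_form_def)

lemma trace_form_dim [simp]: "dim_row (trace_form d) = d" "dim_col (trace_form d) = d"
  by (simp_all add: trace_form_def)

lemma trace_form_index [simp]:
  "i < d \<Longrightarrow> j < d \<Longrightarrow> trace_form d $$ (i, j) = (if i = j \<and> i \<noteq> 0 then 1 else 0)"
  by (simp add: trace_form_def)

text \<open>The expansion of the resolvent of \<open>M\<close>, with denominators cleared: the
  adjugate of \<open>N s\<close> replaces its inverse, so that every step is an identity between
  polynomials in s and can be evaluated at s = 0.\<close>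

lemma singular_pencil_pow_zero:
  fixes M :: "'a::field_char_0 mat"
  assumes M: "M \<in> carrier_mat d d" and d: "0 < d"
    and sing: "\<And>s. det (s \<cdot>\<^sub>m M - trace_form d) = 0"
  shows "(M ^\<^sub>m Suc k) $$ (0, 0) = 0"
proof -
  define N where "N = (\<lambda>s. s \<cdot>\<^sub>m M - 1\<^sub>m d)"
  define R where "R = (\<lambda>s. adj_mat (N s))"
  have N: "N s \<in> carrier_mat d d" for s
    using M by (simp add: N_def minus_carrier_mat)
  have R: "R s \<in> carrier_mat d d" for s
    using adj_mat(1)[OF N] by (simp add: R_def)
  have "polymat d d (\<lambda>s. s \<cdot>\<^sub>m M + - 1\<^sub>m d)"
    using M by (intro polymat_add polymat_smult polymat_const) auto
  moreover have "s \<cdot>\<^sub>m M + - 1\<^sub>m d = N s" for s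
    using M by (intro eq_matI) (auto simp: N_def)
  ultimately have PN: "polymat d d N" by simp
  have R00: "R s $$ (0, 0) = - det (N s)" for s
  proof -
    let ?P = "s \<cdot>\<^sub>m M - trace_form d"
    have P: "?P \<in> carrier_mat d d" by (intro minus_carrier_mat) simp
    have ent: "?P $$ (0, j) = N s $$ (0, j) + (if j = 0 then 1 else 0)" if "j < d" for j
      using M that d by (auto simp: N_def)
    have cof: "cofactor ?P 0 j = cofactor (N s) 0 j" for j
    proof -
      have "mat_delete ?P 0 j = mat_delete (N s) 0 j"
        using M by (intro eq_matI) (auto simp: N_def mat_delete_def)
      then show ?thesis by (simp add: cofactor_def)
    qed
    have "0 = det ?P" using sing by simp
    also have "\<dots> = (\<Sum>j<d. ?P $$ (0, j) * cofactor ?P 0 j)"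
      by (rule laplace_expansion_row[OF P d])
    also have "\<dots> = (\<Sum>j<d. N s $$ (0, j) * cofactor (N s) 0 j + (if j = 0 then cofactor (N s) 0 j else 0))"
      using ent by (intro sum.cong) (auto simp: cof algebra_simps)
    also have "\<dots> = det (N s) + cofactor (N s) 0 0"
      using d laplace_expansion_row[OF N[of s] d] by (simp add: sum.distrib)
    finally have "cofactor (N s) 0 0 = - det (N s)" by (simp add: eq_neg_iff_add_eq_0 add.commute)
    moreover have "R s $$ (0, 0) = cofactor (N s) 0 0"
      using N[of s] d by (simp add: R_def adj_mat_def)
    ultimately show ?thesis by simp
  qed
  \<comment> \<open>The numerator of the (0, 0) entry of the inverse of \<open>N s\<close> times the
    k-th power of \<open>M\<close>; the denominator is det (N s).\<close>
  define p where "p = (\<lambda>k s. (R s * M ^\<^sub>m k) $$ (0, 0))"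
  have Pp: "polyfun (p k)" for k
    unfolding p_def R_def
    using M d by (intro polymatD(2)[of d d] polymat_mult[of d d] polymat_adj PN polymat_const) auto
  \<comment> \<open>The (0, 0) entry of adj (N) N M^k = det (N) M^k, with N M^k written as s M^(k+1)
    - M^k.\<close>
  have rec: "s * p (Suc k) s - p k s = det (N s) * (M ^\<^sub>m k) $$ (0, 0)" for k s
  proof -
    have Mk: "M ^\<^sub>m k \<in> carrier_mat d d" "M ^\<^sub>m Suc k \<in> carrier_mat d d"
      using M by auto
    have "N s * M ^\<^sub>m k = s \<cdot>\<^sub>m M * M ^\<^sub>m k - 1\<^sub>m d * M ^\<^sub>m k"
      unfolding N_def using M by (intro minus_mult_distrib_mat[of _ d d]) auto
    also have "s \<cdot>\<^sub>m M * M ^\<^sub>m k = s \<cdot>\<^sub>m M ^\<^sub>m Suc k"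
      using M Mk by (simp only: mult_smult_assoc_mat[OF M Mk(1)] pow_mat_Suc_left[OF M])
    also have "1\<^sub>m d * M ^\<^sub>m k = M ^\<^sub>m k" using Mk(1) by (rule left_mult_one_mat)
    finally have NM: "N s * M ^\<^sub>m k = s \<cdot>\<^sub>m M ^\<^sub>m Suc k - M ^\<^sub>m k" .
    have "R s * (N s * M ^\<^sub>m k) = (R s * N s) * M ^\<^sub>m k"
      by (rule assoc_mult_mat[OF R N Mk(1), symmetric])
    also have "\<dots> = det (N s) \<cdot>\<^sub>m M ^\<^sub>m k"
      using adj_mat(3)[OF N[of s]] left_mult_one_mat[OF Mk(1)] Mk(1)
      by (simp add: R_def mult_smult_assoc_mat[of _ d d] del: left_mult_one_mat')
    finally have "det (N s) \<cdot>\<^sub>m M ^\<^sub>m k = R s * (s \<cdot>\<^sub>m M ^\<^sub>m Suc k) - R s * M ^\<^sub>m k"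
      unfolding NM using R[of s] Mk by (subst mult_minus_distrib_mat[symmetric, of _ d d]) auto
    also have "R s * (s \<cdot>\<^sub>m M ^\<^sub>m Suc k) = s \<cdot>\<^sub>m (R s * M ^\<^sub>m Suc k)"
      by (rule mult_smult_distrib[OF R Mk(2)])
    finally have "(det (N s) \<cdot>\<^sub>m M ^\<^sub>m k) $$ (0, 0) = (s \<cdot>\<^sub>m (R s * M ^\<^sub>m Suc k) - R s * M ^\<^sub>m k) $$ (0, 0)"
      by simp
    also have "\<dots> = s * p (Suc k) s - p k s"
      unfolding p_def using R[of s] Mk M d by (simp del: pow_mat.simps index_mult_mat(1))
    also have "(det (N s) \<cdot>\<^sub>m M ^\<^sub>m k) $$ (0, 0) = det (N s) * (M ^\<^sub>m k) $$ (0, 0)"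
      using M d by simp
    finally show ?thesis by simp
  qed
  have det0: "det (N 0) \<noteq> 0"
  proof -
    have "N 0 = (-1) \<cdot>\<^sub>m 1\<^sub>m d" using M by (intro eq_matI) (auto simp: N_def)
    then have "det (N 0) = (-1) ^ d" by simp
    then show ?thesis by simp
  qed
  have zero: "p (Suc k) s = 0" if "\<And>s. s * p (Suc k) s = 0" for k s
    using polyfun_eq_zero[OF Pp polyfun_ident, of 1 "Suc k" s] that by auto
  \<comment> \<open>The recursion at index k gives s * p (k+1) s = 0, hence \<open>p (k+1)\<close> =
    0; at index k + 1 and s = 0 it then gives the entry of the power. It starts because p 0 = - det
    N cancels the contribution of the (0, 0) entry 1 of M^0.\<close>
  have "(\<forall>s. p (Suc k) s = 0) \<and> (M ^\<^sub>m Suc k) $$ (0, 0) = 0" for k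
  proof (induction k)
    case 0
    have p0: "p 0 s = - det (N s)" for s
      using R00[of s] R[of s] M d by (simp add: p_def)
    have p1: "p (Suc 0) s = 0" for s
      by (rule zero) (use rec[of _ 0] p0 d M in simp)
    have "det (N 0) * (M ^\<^sub>m Suc 0) $$ (0, 0) = 0"
      using rec[of 0 "Suc 0"] p1[of 0] by simp
    then show ?case using det0 p1 by simp
  next
    case (Suc k)
    have p1: "p (Suc (Suc k)) s = 0" for s
      by (rule zero) (use rec[of _ "Suc k"] Suc in simp)
    have "det (N 0) * (M ^\<^sub>m Suc (Suc k)) $$ (0, 0) = 0"
      using rec[of 0 "Suc (Suc k)"] p1[of 0] by simp
    then show ?case using det0 p1 by simp
  qed
  then show ?thesis by blast
qed

text \<open>Block diagonal matrices with blocks 1 and an arbitrary one of size d - 1. Invertibility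
  is kept separate, so that the set is an affine space and contains the line through any two of its
  elements.\<close>

definition bordered :: "nat \<Rightarrow> 'a::{zero,one} mat set" where
  "bordered d = {g \<in> carrier_mat d d.
     \<forall>i<d. g $$ (i, 0) = (if i = 0 then 1 else 0) \<and> g $$ (0, i) = (if i = 0 then 1 else 0)}"

text \<open>Equivalently for r < d: M maps the span of the unit vectors 0, ..., r into the span of
  the unit vectors 1, ..., r. The latter is the stable subspace of dimension r in standard
  position.\<close>

definition flag_mats :: "nat \<Rightarrow> nat \<Rightarrow> 'a::zero mat set" where
  "flag_mats d r = {M \<in> carrier_mat d d.
     \<forall>i<d. \<forall>j<d. (i = 0 \<or> r < i) \<and> j \<le> r \<longrightarrow> M $$ (i, j) = 0}"

lemma borderedD:
  assumes "g \<in> bordered d"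
  shows "g \<in> carrier_mat d d"
    "i < d \<Longrightarrow> g $$ (i, 0) = (if i = 0 then 1 else 0)"
    "i < d \<Longrightarrow> g $$ (0, i) = (if i = 0 then 1 else 0)"
  using assms by (auto simp: bordered_def)

lemma bordered_mult_row0:
  fixes g :: "'a::comm_ring_1 mat"
  assumes g: "g \<in> bordered d" and A: "A \<in> carrier_mat d n" and "0 < d" "j < n"
  shows "(g * A) $$ (0, j) = A $$ (0, j)"
proof -
  have "(g * A) $$ (0, j) = (\<Sum>k<d. g $$ (0, k) * A $$ (k, j))"
    using borderedD(1)[OF g] A assms(3,4) by (rule index_mult_mat_sum)
  also have "\<dots> = (\<Sum>k<d. if k = 0 then A $$ (k, j) else 0)"
    using borderedD(3)[OF g] by (intro sum.cong) auto
  finally show ?thesis using \<open>0 < d\<close> by simp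
qed

lemma mult_bordered_col0:
  fixes g :: "'a::comm_ring_1 mat"
  assumes g: "g \<in> bordered d" and A: "A \<in> carrier_mat n d" and "0 < d" "i < n"
  shows "(A * g) $$ (i, 0) = A $$ (i, 0)"
proof -
  have "(A * g) $$ (i, 0) = (\<Sum>k<d. A $$ (i, k) * g $$ (k, 0))"
    using A borderedD(1)[OF g] assms(4,3) by (rule index_mult_mat_sum)
  also have "\<dots> = (\<Sum>k<d. if k = 0 then A $$ (i, k) else 0)"
    using borderedD(2)[OF g] by (intro sum.cong) auto
  finally show ?thesis using \<open>0 < d\<close> by simp
qed

lemma bordered_inverse:
  fixes g h :: "'a::comm_ring_1 mat"
  assumes g: "g \<in> bordered d" and h: "h \<in> carrier_mat d d" and "0 < d"
    and gh: "g * h = 1\<^sub>m d" and hg: "h * g = 1\<^sub>m d"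
  shows "h \<in> bordered d"
  unfolding bordered_def
proof (intro CollectI conjI h allI impI)
  fix i assume i: "i < d"
  show "h $$ (i, 0) = (if i = 0 then 1 else 0)"
    using mult_bordered_col0[OF g h \<open>0 < d\<close> i] hg i \<open>0 < d\<close> by simp
  show "h $$ (0, i) = (if i = 0 then 1 else 0)"
    using bordered_mult_row0[OF g h \<open>0 < d\<close> i] gh i \<open>0 < d\<close> by simp
qed

lemma det_nonzero_inverse:
  fixes g :: "'a::field mat"
  assumes g: "g \<in> carrier_mat d d" and "det g \<noteq> 0"
  obtains h where "h \<in> carrier_mat d d" "g * h = 1\<^sub>m d" "h * g = 1\<^sub>m d"
    "adj_mat g = det g \<cdot>\<^sub>m h"
proof
  let ?h = "inverse (det g) \<cdot>\<^sub>m adj_mat g"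
  note adj = adj_mat[OF g]
  show "?h \<in> carrier_mat d d" using adj by simp
  show "g * ?h = 1\<^sub>m d"
    using adj assms(2) by (simp add: mult_smult_distrib[OF g adj(1)]) (intro eq_matI, auto)
  show "?h * g = 1\<^sub>m d"
    using adj assms(2) by (simp add: mult_smult_assoc_mat[OF adj(1) g]) (intro eq_matI, auto)
  show "adj_mat g = det g \<cdot>\<^sub>m ?h"
    using assms(2) by (intro eq_matI) auto
qed

text \<open>A maximal \<open>r\<close> such that the columns \<open>1, \<dots>, r\<close> of some invertible bordered \<open>g\<close> span a
  subspace on which all functionals \<open>e\<^sub>0\<^sup>T M\<^sup>k\<close> vanish: by maximality that subspace is stable under
  \<open>M\<close> and contains \<open>M e\<^sub>0\<close>.\<close>

lemma ex_flag_form: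
  fixes M :: "'a::field mat"
  assumes M: "M \<in> carrier_mat d d" and d: "0 < d"
    and zero: "\<And>k. (M ^\<^sub>m Suc k) $$ (0, 0) = 0"
  shows "\<exists>r<d. \<exists>g h. g \<in> bordered d \<and> h \<in> bordered d \<and> g * h = 1\<^sub>m d \<and> h * g = 1\<^sub>m d \<and>
    h * M * g \<in> flag_mats d r"
proof -
  define C where "C = (\<lambda>g r. g \<in> bordered d \<and> det g \<noteq> 0 \<and> r < d \<and>
    (\<forall>j. 1 \<le> j \<and> j \<le> r \<longrightarrow> (\<forall>k. (M ^\<^sub>m k * g) $$ (0, j) = 0)))"
  have "C (1\<^sub>m d) 0" using d by (auto simp: C_def bordered_def)
  then have ex: "\<exists>r. \<exists>g. C g r" by blast
  have bd: "\<forall>r. (\<exists>g. C g r) \<longrightarrow> r \<le> d" by (auto simp: C_def)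
  define r where "r = (GREATEST r. \<exists>g. C g r)"
  have "\<exists>g. C g r"
    unfolding r_def by (rule GreatestI_ex_nat[OF ex]) (use bd in blast)
  then obtain g where g: "C g r" ..
  have max: "q \<le> r" if "C g' q" for g' q
    unfolding r_def by (rule Greatest_le_nat[where b = d]) (use that bd in blast)+
  have gb: "g \<in> bordered d" and gdet: "det g \<noteq> 0" and r: "r < d"
    and gC: "\<And>j k. 1 \<le> j \<Longrightarrow> j \<le> r \<Longrightarrow> (M ^\<^sub>m k * g) $$ (0, j) = 0"
    using g by (auto simp: C_def)
  note gc = borderedD(1)[OF gb]
  obtain h where h: "h \<in> carrier_mat d d" "g * h = 1\<^sub>m d" "h * g = 1\<^sub>m d"
    using det_nonzero_inverse[OF gc gdet] by metis
  note hb = bordered_inverse[OF gb h(1) d h(2,3)]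
  \<comment> \<open>Column 0 of \<open>g\<close> is the unit vector, so j = 0 is the hypothesis on
    the powers. The exponent has to be positive: for exponent 0 and j = 0 the entry is 1.\<close>
  have gC': "(M ^\<^sub>m Suc k * g) $$ (0, j) = 0" if "j \<le> r" for j k
  proof (cases "j = 0")
    case True
    have "(M ^\<^sub>m Suc k * g) $$ (0, 0) = (M ^\<^sub>m Suc k) $$ (0, 0)"
      by (rule mult_bordered_col0[OF gb _ d d]) (use M in auto)
    then show ?thesis using zero True by simp
  next
    case False
    then show ?thesis using gC[of j "Suc k"] that by simp
  qed
  have Mg: "M * g \<in> carrier_mat d d" using M gc by simp
  have hMg: "h * (M * g) \<in> carrier_mat d d" using Mg h by simp
  have "h * (M * g) \<in> flag_mats d r"
    unfolding flag_mats_def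
  proof (intro CollectI conjI hMg allI impI)
    fix i j assume ij: "i < d" "j < d" "(i = 0 \<or> r < i) \<and> j \<le> r"
    show "(h * (M * g)) $$ (i, j) = 0"
    proof (cases "i = 0")
      case True
      then show ?thesis
        using bordered_mult_row0[OF hb Mg d ij(2)] gC'[of j 0] ij M by simp
    next
      case False
      then have ri: "r < i" using ij by simp
      show ?thesis
      proof (rule ccontr)
        assume nz: "(h * (M * g)) $$ (i, j) \<noteq> 0"
        define q where "q = Suc r"
        have q: "q < d" "0 < q" "q \<le> i" using ri ij by (auto simp: q_def)
        define w' where "w' = col (h * (M * g)) j"
        \<comment> \<open>In the basis of the columns of \<open>g\<close>, the vector
          \<open>col (M * g) j\<close> has a nonzero coordinate at i > r. The transposition of i and
          q = r + 1 moves that basis vector next to the first r ones without disturbing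
          them.\<close>
        define s where "s = (\<lambda>b. if b = q then i else if b = i then q else b)"
        define w1 where "w1 = vec d (\<lambda>b. w' $ s b)"
        define g1 where "g1 = mat d d (\<lambda>(a, b). g $$ (a, s b))"
        have s: "s b < d" if "b < d" for b using that q ij by (auto simp: s_def)
        have w'c: "w' \<in> carrier_vec d" using hMg ij by (auto simp: w'_def)
        have g1: "g1 \<in> carrier_mat d d" "w1 \<in> carrier_vec d" by (auto simp: g1_def w1_def)
        have detg1: "det g1 \<noteq> 0"
        proof (cases "q = i")
          case True
          then have "g1 = g" using gc by (intro eq_matI) (auto simp: g1_def s_def)
          then show ?thesis using gdet by simp
        next
          case False
          then have "g1 = swapcols q i g" using gc by (intro eq_matI) (auto simp: g1_def s_def)
          then show ?thesis using det_swapcols[OF q(1) ij(1) False gc] gdet by simp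
        qed
        have bij: "bij_betw s {..<d} {..<d}"
          by (rule bij_betwI[where g = s]) (use q ij in \<open>auto simp: s_def\<close>)
        have "g1 *\<^sub>v w1 = g *\<^sub>v w'"
        proof (intro eq_vecI)
          fix a assume a: "a < dim_vec (g *\<^sub>v w')"
          then have a: "a < d" using gc by simp
          have "(g1 *\<^sub>v w1) $ a = (\<Sum>b<d. g $$ (a, s b) * w' $ s b)"
            using a by (auto simp: scalar_prod_def g1_def w1_def atLeast0LessThan intro!: sum.cong)
          also have "\<dots> = (\<Sum>b<d. g $$ (a, b) * w' $ b)"
            by (rule sum.reindex_bij_betw[OF bij])
          also have "\<dots> = (g *\<^sub>v w') $ a"
            using a gc w'c by (auto simp: scalar_prod_def atLeast0LessThan intro!: sum.cong)
          finally show "(g1 *\<^sub>v w1) $ a = (g *\<^sub>v w') $ a" .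
        qed (use gc in \<open>auto simp: g1_def\<close>)
        also have "g *\<^sub>v w' = col (g * (h * (M * g))) j"
          unfolding w'_def using gc hMg ij by (intro col_mult2[symmetric]) auto
        also have "g * (h * (M * g)) = M * g"
          using assoc_mult_mat[OF gc h(1) Mg, symmetric] left_mult_one_mat[OF Mg] h(2) by simp
        finally have gw: "g1 *\<^sub>v w1 = col (M * g) j" .
        define g2 where "g2 = replace_col g1 (col (M * g) j) q"
        have g2c: "g2 \<in> carrier_mat d d" using g1 by (simp add: g2_def replace_col_def)
        \<comment> \<open>By Cramer's rule, exchanging column q for the vector with coordinates
          \<open>w1\<close> multiplies the determinant by its q-th coordinate, the entry assumed
          nonzero.\<close>
        have "det g2 = w1 $ q * det g1"
          unfolding g2_def gw[symmetric] by (rule cramer_lemma_mat[OF g1 q(1)])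
        moreover have "w1 $ q = (h * (M * g)) $$ (i, j)"
          using q ij index_col[of i "h * (M * g)" j] carrier_matD[OF hMg]
          by (simp add: w1_def w'_def s_def del: index_col index_mult_mat(1))
        ultimately have detg2: "det g2 \<noteq> 0" using nz detg1 by simp
        have g2_lt: "col g2 b = col g b" if "1 \<le> b" "b \<le> r" for b
          using that r gc q g1
          by (intro eq_vecI) (auto simp: g2_def replace_col_def g1_def s_def q_def)
        have g2_q: "col g2 q = col (M * g) j"
          using q g1 Mg by (intro eq_vecI) (auto simp: g2_def replace_col_def)
        have g2b: "g2 \<in> bordered d"
          unfolding bordered_def
        proof (intro CollectI conjI g2c allI impI)
          fix a assume a: "a < d"
          show "g2 $$ (a, 0) = (if a = 0 then 1 else 0)"
            using a q d borderedD(2)[OF gb a] False by (auto simp: g2_def replace_col_def g1_def s_def)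
          have "(M * g) $$ (0, j) = 0"
            using gC'[of j 0] ij M by simp
          then have "col (M * g) j $ 0 = 0"
            using index_col[of 0 "M * g" j] carrier_matD[OF Mg] ij(2) d by simp
          then show "g2 $$ (0, a) = (if a = 0 then 1 else 0)"
            using a q d borderedD(3)[OF gb s[OF a]] False
            by (auto simp: g2_def replace_col_def g1_def s_def simp del: index_mult_mat(1) index_col split: if_splits)
        qed
        have colmul: "(M ^\<^sub>m k * A) $$ (0, b) = row (M ^\<^sub>m k) 0 \<bullet> col A b"
          if "A \<in> carrier_mat d d" "b < d" for A b k
          using that d M by simp
        \<comment> \<open>The new column is M applied to column j \<le> r, so the k-th functional on
          it is the (k+1)-st functional on column j, which is zero by \<open>gC'\<close>. Thus r
          could be enlarged.\<close>
        have "C g2 q"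
          unfolding C_def
        proof (intro conjI g2b detg2 q(1) allI impI)
          fix b k assume b: "1 \<le> b \<and> b \<le> q"
          show "(M ^\<^sub>m k * g2) $$ (0, b) = 0"
          proof (cases "b = q")
            case True
            have "(M ^\<^sub>m k * g2) $$ (0, b) = (M ^\<^sub>m k * (M * g)) $$ (0, j)"
              using colmul[OF g2c, of b k] colmul[OF Mg ij(2), of k] q True g2_q by simp
            also have "M ^\<^sub>m k * (M * g) = M ^\<^sub>m Suc k * g"
              using assoc_mult_mat[of "M ^\<^sub>m k" d d M d g d] M gc by simp
            finally show ?thesis using gC' ij by simp
          next
            case False
            then have "b \<le> r" using b by (simp add: q_def)
            then show ?thesis
              using colmul[OF g2c, of b k] colmul[OF gc, of b k] b r g2_lt[of b] gC[of b k] by simp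
          qed
        qed
        from max[OF this] show False by (simp add: q_def)
      qed
    qed
  qed
  moreover have "h * (M * g) = h * M * g"
    by (rule assoc_mult_mat[OF h(1) M gc, symmetric])
  ultimately show ?thesis using r gb hb h by metis
qed

subsection \<open>Irreducible components of a finite union\<close>

lemma irreducible_closure_of:
  assumes "irreducible_in X Y"
  shows "irreducible_in X (X closure_of Y)"
proof -
  have Y: "Y \<subseteq> topspace X" "Y \<noteq> {}" "Y \<subseteq> X closure_of Y"
    using assms closure_of_subset[of Y X] by (auto simp: irreducible_in_def)
  show ?thesis
    unfolding irreducible_in_def
  proof (intro conjI allI impI closure_of_subset_topspace)
    show "X closure_of Y \<noteq> {}" using Y by blast
    fix A B assume AB: "closedin X A" "closedin X B" "X closure_of Y \<subseteq> A \<union> B"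
    then have "Y \<subseteq> A \<or> Y \<subseteq> B" using assms Y unfolding irreducible_in_def by blast
    then show "X closure_of Y \<subseteq> A \<or> X closure_of Y \<subseteq> B"
      using AB closure_of_minimal by metis
  qed
qed

lemma irreducible_subset_finite_Union:
  assumes "irreducible_in X D" "finite I" "\<And>i. i \<in> I \<Longrightarrow> closedin X (C i)" "D \<subseteq> (\<Union>i\<in>I. C i)"
  shows "\<exists>i\<in>I. D \<subseteq> C i"
  using assms(2-4)
proof (induction I rule: finite_induct)
  case empty
  then show ?case using assms(1) by (auto simp: irreducible_in_def)
next
  case (insert j I)
  have "closedin X (\<Union>i\<in>I. C i)" using insert by (intro closedin_Union) auto
  moreover have "D \<subseteq> C j \<union> (\<Union>i\<in>I. C i)" using insert.prems by auto
  ultimately have "D \<subseteq> C j \<or> D \<subseteq> (\<Union>i\<in>I. C i)"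
    using assms(1) insert.prems(1)[of j] unfolding irreducible_in_def by blast
  then show ?case using insert by auto
qed

text \<open>The closures of the \<open>Y i\<close> are closed, irreducible and cover the space, so
  every irreducible set lies in one of them; \<open>sep\<close> makes them pairwise incomparable,
  hence all maximal and distinct. The \<open>Y i\<close> need be neither closed nor
  disjoint.\<close>

lemma card_irreducible_components:
  assumes I: "finite I" and cover: "topspace X = (\<Union>i\<in>I. Y i)"
    and irr: "\<And>i. i \<in> I \<Longrightarrow> irreducible_in X (Y i)"
    and sep: "\<And>i j. i \<in> I \<Longrightarrow> j \<in> I \<Longrightarrow> i \<noteq> j \<Longrightarrow> \<exists>A. closedin X A \<and> Y j \<subseteq> A \<and> \<not> Y i \<subseteq> A"
  shows "card (irreducible_components X) = card I"
proof -
  define C where "C = (\<lambda>i. X closure_of Y i)"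
  have Y: "Y i \<subseteq> C i" if "i \<in> I" for i
    unfolding C_def using irr[OF that] by (intro closure_of_subset) (auto simp: irreducible_in_def)
  have C: "irreducible_in X (C i)" "closedin X (C i)" if "i \<in> I" for i
    unfolding C_def by (rule irreducible_closure_of[OF irr[OF that]], rule closedin_closure_of)
  have incl: "i = j" if ij: "i \<in> I" "j \<in> I" "C i \<subseteq> C j" for i j
  proof (rule ccontr)
    assume "i \<noteq> j"
    then obtain A where A: "closedin X A" "Y j \<subseteq> A" "\<not> Y i \<subseteq> A" using sep[OF ij(1,2)] by auto
    have "C j \<subseteq> A" unfolding C_def using A by (intro closure_of_minimal)
    with A(3) Y[OF ij(1)] ij(3) show False by (meson subset_trans)
  qed
  have below: "\<exists>i\<in>I. D \<subseteq> C i" if "irreducible_in X D" for D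
  proof (rule irreducible_subset_finite_Union[OF that I C(2)])
    have "D \<subseteq> topspace X" using that by (simp add: irreducible_in_def)
    also have "\<dots> \<subseteq> (\<Union>i\<in>I. C i)" unfolding cover using Y by (rule UN_mono[OF subset_refl])
    finally show "D \<subseteq> (\<Union>i\<in>I. C i)" .
  qed
  have "irreducible_components X = C ` I"
  proof (intro equalityI subsetI)
    fix D assume "D \<in> irreducible_components X"
    then have D: "irreducible_in X D" "\<And>E. irreducible_in X E \<Longrightarrow> D \<subseteq> E \<Longrightarrow> E = D"
      by (auto simp: irreducible_components_def)
    obtain i where i: "i \<in> I" "D \<subseteq> C i" using below[OF D(1)] by auto
    then have "C i = D" using D(2)[OF C(1)[OF i(1)]] by simp
    then show "D \<in> C ` I" using i by auto
  next
    fix D assume "D \<in> C ` I"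
    then obtain i where i: "i \<in> I" "D = C i" by auto
    have "E = C i" if E: "irreducible_in X E" "C i \<subseteq> E" for E
    proof -
      obtain j where j: "j \<in> I" "E \<subseteq> C j" using below[OF E(1)] by auto
      then have "i = j" using incl[OF i(1)] E(2) by (meson subset_trans)
      then show ?thesis using j E by auto
    qed
    then show "D \<in> irreducible_components X"
      using i C(1) by (simp add: irreducible_components_def)
  qed
  moreover have "inj_on C I" using incl by (auto intro: inj_onI)
  ultimately show ?thesis by (simp add: card_image)
qed

subsection \<open>Minors separating the flag types\<close>

lemma det_low_rank:
  fixes K :: "nat \<Rightarrow> nat \<Rightarrow> 'a::comm_ring_1"
  assumes K: "\<And>i j. i \<le> s \<Longrightarrow> j \<le> s \<Longrightarrow> K i j = (\<Sum>l<s. a i l * b l j)"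
  shows "det (mat (Suc s) (Suc s) (\<lambda>(i, j). K i j)) = 0"
proof -
  \<comment> \<open>The rank factorisation through dimension s is padded to square factors, so that
    the determinant is multiplicative; \<open>?A\<close> then has the zero column s.\<close>
  let ?A = "mat (Suc s) (Suc s) (\<lambda>(i, l). if l < s then a i l else 0)"
  let ?B = "mat (Suc s) (Suc s) (\<lambda>(l, j). b l j)"
  have "mat (Suc s) (Suc s) (\<lambda>(i, j). K i j) = ?A * ?B"
  proof (rule eq_matI)
    fix i j assume "i < dim_row (?A * ?B)" "j < dim_col (?A * ?B)"
    then have ij: "i < Suc s" "j < Suc s" by auto
    have "(?A * ?B) $$ (i, j) = (\<Sum>l<Suc s. ?A $$ (i, l) * ?B $$ (l, j))"
      by (rule index_mult_mat_sum) (use ij in auto)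
    also have "\<dots> = (\<Sum>l<s. a i l * b l j)"
      using ij by (simp add: sum.lessThan_Suc) 
    finally show "mat (Suc s) (Suc s) (\<lambda>(i, j). K i j) $$ (i, j) = (?A * ?B) $$ (i, j)"
      using ij K by simp
  qed auto
  moreover have "det ?A = (\<Sum>i<Suc s. ?A $$ (i, s) * cofactor ?A i s)"
    by (rule laplace_expansion_column) auto
  moreover have "\<dots> = 0" by (intro sum.neutral) auto
  moreover have "det (?A * ?B) = det ?A * det ?B"
    by (rule det_mult) auto
  ultimately show ?thesis by simp
qed

lemma flag_mats_mult:
  fixes A B :: "'a::comm_ring_1 mat"
  assumes A: "A \<in> flag_mats d r" and B: "B \<in> flag_mats d r"
  shows "A * B \<in> flag_mats d r"
proof -
  have c: "A \<in> carrier_mat d d" "B \<in> carrier_mat d d" using A B by (auto simp: flag_mats_def)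
  show ?thesis
    unfolding flag_mats_def
  proof (intro CollectI conjI allI impI)
    show "A * B \<in> carrier_mat d d" using c by simp
    fix i j assume ij: "i < d" "j < d" "(i = 0 \<or> r < i) \<and> j \<le> r"
    have "(A * B) $$ (i, j) = (\<Sum>k<d. A $$ (i, k) * B $$ (k, j))"
      by (rule index_mult_mat_sum[OF c ij(1,2)])
    also have "\<dots> = 0"
    proof (intro sum.neutral ballI)
      fix k assume "k \<in> {..<d}"
      then show "A $$ (i, k) * B $$ (k, j) = 0"
        using A B ij by (cases "k \<le> r") (auto simp: flag_mats_def)
    qed
    finally show "(A * B) $$ (i, j) = 0" .
  qed
qed

lemma flag_mats_pow:
  fixes A :: "'a::comm_ring_1 mat"
  assumes "A \<in> flag_mats d r" shows "A ^\<^sub>m Suc k \<in> flag_mats d r"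
proof (induction k)
  case 0
  have "1\<^sub>m (dim_row A) * A = A" by simp
  then show ?case using assms by simp
next
  case (Suc k)
  then show ?case using flag_mats_mult[OF _ assms] by simp
qed

lemma conj_pow_mat:
  fixes F g h :: "'a::comm_ring_1 mat"
  assumes "F \<in> carrier_mat d d" "g \<in> carrier_mat d d" "h \<in> carrier_mat d d"
    "g * h = 1\<^sub>m d" "h * g = 1\<^sub>m d"
  shows "(g * F * h) ^\<^sub>m k = g * F ^\<^sub>m k * h"
  by (rule similar_mat_wit_pow_id[of _ F], rule similar_mat_witI[of _ _ d]) (use assms in auto)

text \<open>A minor of the Krylov matrix with columns M e_0, M^2 e_0, ..., in rows 1 to s + 1. It
  tests whether these vectors span more than s dimensions.\<close>

definition col_minor :: "nat \<Rightarrow> 'a::comm_ring_1 mat \<Rightarrow> 'a" where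
  "col_minor s M = det (mat (Suc s) (Suc s) (\<lambda>(i, j). (M ^\<^sub>m Suc j) $$ (Suc i, 0)))"

text \<open>The dual Krylov minor, of size d - s, for the functionals e_0^T M^k with k > 0 on the
  coordinates s to d - 1. The coordinates are read backwards because the shift used as a witness
  produces them in that order.\<close>

definition row_minor :: "nat \<Rightarrow> nat \<Rightarrow> 'a::comm_ring_1 mat \<Rightarrow> 'a" where
  "row_minor d s M =
     det (mat (Suc (d - 1 - s)) (Suc (d - 1 - s)) (\<lambda>(i, j). (M ^\<^sub>m Suc j) $$ (0, d - 1 - i)))"

text \<open>Since h e_0 = e_0, the Krylov vectors of the conjugate are g F^k e_0, and F^k e_0 lies
  in the span of the unit vectors 1, ..., s. So only s columns of \<open>g\<close> occur.\<close>

lemma col_minor_zero: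
  fixes F :: "'a::comm_ring_1 mat"
  assumes F: "F \<in> flag_mats d s" and g: "g \<in> bordered d" and h: "h \<in> bordered d"
    and gh: "g * h = 1\<^sub>m d" "h * g = 1\<^sub>m d" and s: "Suc s < d"
  shows "col_minor s (g * F * h) = 0"
  unfolding col_minor_def
proof (rule det_low_rank)
  fix i j assume ij: "i \<le> s" "j \<le> s"
  have Fc: "F \<in> carrier_mat d d" using F by (auto simp: flag_mats_def)
  note gc = borderedD(1)[OF g] and hc = borderedD(1)[OF h]
  have Fp: "F ^\<^sub>m Suc j \<in> flag_mats d s" by (rule flag_mats_pow[OF F])
  then have Fpc: "F ^\<^sub>m Suc j \<in> carrier_mat d d" by (auto simp: flag_mats_def)
  have "((g * F * h) ^\<^sub>m Suc j) $$ (Suc i, 0) = (g * F ^\<^sub>m Suc j * h) $$ (Suc i, 0)"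
    by (simp only: conj_pow_mat[OF Fc gc hc gh])
  also have "\<dots> = (g * F ^\<^sub>m Suc j) $$ (Suc i, 0)"
    by (rule mult_bordered_col0[OF h mult_carrier_mat[OF gc Fpc]]) (use s ij in auto)
  also have "\<dots> = (\<Sum>l<d. g $$ (Suc i, l) * (F ^\<^sub>m Suc j) $$ (l, 0))"
    by (rule index_mult_mat_sum[OF gc Fpc]) (use s ij in auto)
  also have "\<dots> = (\<Sum>l\<in>{Suc 0..<Suc s}. g $$ (Suc i, l) * (F ^\<^sub>m Suc j) $$ (l, 0))"
    using Fp s by (intro sum.mono_neutral_right) (auto simp: flag_mats_def simp del: pow_mat.simps)
  also have "\<dots> = (\<Sum>l<s. g $$ (Suc i, Suc l) * (F ^\<^sub>m Suc j) $$ (Suc l, 0))"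
    by (subst sum.atLeast_Suc_lessThan_Suc_shift) (simp add: atLeast0LessThan)
  finally show "((g * F * h) ^\<^sub>m Suc j) $$ (Suc i, 0) =
    (\<Sum>l<s. g $$ (Suc i, Suc l) * (F ^\<^sub>m Suc j) $$ (Suc l, 0))" .
qed

text \<open>Since e_0^T g = e_0^T, the functionals are e_0^T F^k h, and e_0^T F^k vanishes on
  coordinates 0, ..., s. So only the d - 1 - s rows of \<open>h\<close> below row s occur.\<close>

lemma row_minor_zero:
  fixes F :: "'a::comm_ring_1 mat"
  assumes F: "F \<in> flag_mats d s" and g: "g \<in> bordered d" and h: "h \<in> bordered d"
    and gh: "g * h = 1\<^sub>m d" "h * g = 1\<^sub>m d" and s: "0 < s" "s < d"
  shows "row_minor d s (g * F * h) = 0"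
  unfolding row_minor_def
proof (rule det_low_rank)
  fix i j assume ij: "i \<le> d - 1 - s" "j \<le> d - 1 - s"
  have Fc: "F \<in> carrier_mat d d" using F by (auto simp: flag_mats_def)
  note gc = borderedD(1)[OF g] and hc = borderedD(1)[OF h]
  have Fp: "F ^\<^sub>m Suc j \<in> flag_mats d s" by (rule flag_mats_pow[OF F])
  then have Fpc: "F ^\<^sub>m Suc j \<in> carrier_mat d d" by (auto simp: flag_mats_def)
  have "((g * F * h) ^\<^sub>m Suc j) $$ (0, d - 1 - i) = (g * F ^\<^sub>m Suc j * h) $$ (0, d - 1 - i)"
    by (simp only: conj_pow_mat[OF Fc gc hc gh])
  also have "g * F ^\<^sub>m Suc j * h = g * (F ^\<^sub>m Suc j * h)"
    by (rule assoc_mult_mat[OF gc Fpc hc])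
  also have "\<dots> $$ (0, d - 1 - i) = (F ^\<^sub>m Suc j * h) $$ (0, d - 1 - i)"
    by (rule bordered_mult_row0[OF g mult_carrier_mat[OF Fpc hc]]) (use s in auto)
  also have "\<dots> = (\<Sum>l<d. (F ^\<^sub>m Suc j) $$ (0, l) * h $$ (l, d - 1 - i))"
    by (rule index_mult_mat_sum[OF Fpc hc]) (use s in auto)
  also have "\<dots> = (\<Sum>l\<in>{Suc s..<d}. (F ^\<^sub>m Suc j) $$ (0, l) * h $$ (l, d - 1 - i))"
    using Fp s by (intro sum.mono_neutral_right) (auto simp: flag_mats_def simp del: pow_mat.simps)
  also have "\<dots> = (\<Sum>l\<in>{0 + Suc s..<(d - 1 - s) + Suc s}. (F ^\<^sub>m Suc j) $$ (0, l) * h $$ (l, d - 1 - i))"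
    using s by (intro sum.cong) auto
  also have "\<dots> = (\<Sum>l<d - 1 - s. (F ^\<^sub>m Suc j) $$ (0, l + Suc s) * h $$ (l + Suc s, d - 1 - i))"
    by (subst sum.shift_bounds_nat_ivl) (simp add: atLeast0LessThan)
  also have "\<dots> = (\<Sum>l<d - 1 - s. h $$ (l + Suc s, d - 1 - i) * (F ^\<^sub>m Suc j) $$ (0, l + Suc s))"
    by (intro sum.cong) (auto simp: mult.commute)
  finally show "((g * F * h) ^\<^sub>m Suc j) $$ (0, d - 1 - i) =
    (\<Sum>l<d - 1 - s. h $$ (l + Suc s, d - 1 - i) * (F ^\<^sub>m Suc j) $$ (0, l + Suc s))" .
qed

lemma ex_col_minor_nonzero:
  assumes "s < r" "r < d"
  shows "\<exists>F \<in> flag_mats d r. col_minor s F \<noteq> (0::'a::comm_ring_1)"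
proof
  \<comment> \<open>The shift 0, 1, ..., r of unit vectors, ending in 0: F^k e_0 = e_k for k \<le>
    r, so the minor is that of an identity matrix.\<close>
  define F :: "'a mat" where "F = mat d d (\<lambda>(i, j). if i = Suc j \<and> i \<le> r then 1 else 0)"
  have Fc: "F \<in> carrier_mat d d" by (simp add: F_def)
  show "F \<in> flag_mats d r" by (auto simp: flag_mats_def F_def)
  have pow: "(F ^\<^sub>m k) $$ (i, 0) = (if i = k then 1 else 0)" if "k \<le> r" "i < d" for k i
    using that
  proof (induction k arbitrary: i)
    case 0
    then show ?case using Fc by auto
  next
    case (Suc k)
    have "(F ^\<^sub>m Suc k) $$ (i, 0) = (\<Sum>l<d. F $$ (i, l) * (F ^\<^sub>m k) $$ (l, 0))"
      unfolding pow_mat_Suc_left[OF Fc] using Fc Suc.prems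
      by (intro index_mult_mat_sum[of _ d d _ d]) auto
    also have "\<dots> = (\<Sum>l<d. if l = k then F $$ (i, k) else 0)"
      using Suc by (intro sum.cong) auto
    also have "\<dots> = F $$ (i, k)" using Suc.prems assms by simp
    finally show ?case using Suc.prems assms by (simp add: F_def)
  qed
  have "mat (Suc s) (Suc s) (\<lambda>(i, j). (F ^\<^sub>m Suc j) $$ (Suc i, 0)) = 1\<^sub>m (Suc s)"
    using assms by (intro eq_matI) (auto simp: pow simp del: pow_mat.simps)
  then show "col_minor s F \<noteq> 0" by (simp add: col_minor_def del: pow_mat.simps)
qed

lemma ex_row_minor_nonzero:
  assumes "r < s" "s < d"
  shows "\<exists>F \<in> flag_mats d r. row_minor d s F \<noteq> (0::'a::comm_ring_1)"
proof
  \<comment> \<open>The dual shift: on row vectors e_0 goes to e_(d-1), then the index descends by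
    one as long as it stays above r. Again the minor becomes that of an identity matrix.\<close>
  define F :: "'a mat" where
    "F = mat d d (\<lambda>(i, j). if r < j \<and> (i = Suc j \<or> i = 0 \<and> j = d - 1) then 1 else 0)"
  have Fc: "F \<in> carrier_mat d d" by (simp add: F_def)
  show "F \<in> flag_mats d r" by (auto simp: flag_mats_def F_def)
  have pow: "(F ^\<^sub>m Suc k) $$ (0, j) = (if j = d - Suc k then 1 else 0)"
    if "Suc k + r < d" "j < d" for k j
    using that
  proof (induction k arbitrary: j)
    case 0
    have "F ^\<^sub>m Suc 0 = F" using Fc by simp
    then show ?case using 0 assms by (simp add: F_def del: pow_mat.simps)
  next
    case (Suc k)
    have "(F ^\<^sub>m Suc (Suc k)) $$ (0, j) = (\<Sum>l<d. (F ^\<^sub>m Suc k) $$ (0, l) * F $$ (l, j))"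
      unfolding pow_mat.simps(2)[of F "Suc k"] using Fc Suc.prems
      by (intro index_mult_mat_sum[of _ d d _ d] pow_carrier_mat) auto
    also have "\<dots> = (\<Sum>l<d. if l = d - Suc k then F $$ (d - Suc k, j) else 0)"
      using Suc by (intro sum.cong) (auto simp del: pow_mat.simps)
    also have "\<dots> = F $$ (d - Suc k, j)" using Suc.prems assms by simp
    finally show ?case using Suc.prems assms by (auto simp: F_def simp del: pow_mat.simps)
  qed
  have "mat (Suc (d - 1 - s)) (Suc (d - 1 - s)) (\<lambda>(i, j). (F ^\<^sub>m Suc j) $$ (0, d - 1 - i)) =
      1\<^sub>m (Suc (d - 1 - s))"
    using assms by (intro eq_matI) (auto simp: pow simp del: pow_mat.simps)
  then show "row_minor d s F \<noteq> 0" by (simp add: row_minor_def del: pow_mat.simps)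
qed

subsection \<open>Vanishing of invariants on the flag matrices\<close>

text \<open>The two diagonal blocks for the splitting of the indices into 0, then 1 to r, then r + 1
  to d - 1. The block of index 0 is left out because a flag matrix has entry 0 there.\<close>

definition flag_diag :: "nat \<Rightarrow> nat \<Rightarrow> nat \<Rightarrow> bool" where
  "flag_diag r i j \<longleftrightarrow> (1 \<le> i \<and> i \<le> r \<and> 1 \<le> j \<and> j \<le> r) \<or> (r < i \<and> r < j)"

definition flag_diag_part :: "nat \<Rightarrow> nat \<Rightarrow> 'a::zero mat \<Rightarrow> 'a mat" where
  "flag_diag_part d r M = mat d d (\<lambda>(i, j). if flag_diag r i j then M $$ (i, j) else 0)"

lemma invariant_flag_diag_part:
  fixes \<phi> :: "'a::field_char_0 mat \<Rightarrow> 'a"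
  assumes poly: "\<And>M. polymat d d M \<Longrightarrow> polyfun (\<lambda>t. \<phi> (M t))"
    and conj: "\<And>M g h. M \<in> carrier_mat d d \<Longrightarrow> g \<in> bordered d \<Longrightarrow> h \<in> bordered d \<Longrightarrow>
      g * h = 1\<^sub>m d \<Longrightarrow> h * g = 1\<^sub>m d \<Longrightarrow> \<phi> (g * M * h) = \<phi> M"
    and M: "M \<in> flag_mats d r"
  shows "\<phi> M = \<phi> (flag_diag_part d r M)"
proof -
  have Mc: "M \<in> carrier_mat d d" using M by (auto simp: flag_mats_def)
  \<comment> \<open>For s \<noteq> 0 this is the conjugate of \<open>M\<close> by the diagonal
    matrix with weights 1, s, 1/s on the three index blocks. All entries outside the diagonal blocks
    that a flag matrix may have get a positive power of s, so the family extends to s = 0.\<close>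
  define N where "N = (\<lambda>s::'a. mat d d (\<lambda>(i, j). M $$ (i, j) *
    (if flag_diag r i j then 1 else if 1 \<le> i \<and> i \<le> r \<and> r < j then s ^ 2 else s)))"
  have "polymat d d N"
    unfolding polymat_def
  proof (intro conjI allI impI)
    fix i j assume ij: "i < d" "j < d"
    have "polyfun (\<lambda>s. M $$ (i, j) *
        (if flag_diag r i j then 1 else if 1 \<le> i \<and> i \<le> r \<and> r < j then s ^ 2 else s))"
      by (intro polyfun_mult polyfun_if polyfun_power polyfun_const polyfun_ident)
    then show "polyfun (\<lambda>s. N s $$ (i, j))" using ij by (simp add: N_def)
  qed (simp add: N_def)
  then have P: "polyfun (\<lambda>s. \<phi> (N s))" by (rule poly)
  have "\<phi> (N s) - \<phi> M = 0" if s: "s \<noteq> 0" for s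
  proof -
    define w where "w = (\<lambda>i. if i = 0 then 1 else if i \<le> r then s else inverse s)"
    let ?g = "mat_diag d w" and ?h = "mat_diag d (\<lambda>i. inverse (w i))"
    have w: "w i \<noteq> 0" for i using s by (auto simp: w_def)
    have gh: "?g \<in> bordered d" "?h \<in> bordered d"
      unfolding bordered_def by (auto simp: mat_diag_def w_def)
    have inv: "?g * ?h = 1\<^sub>m d" "?h * ?g = 1\<^sub>m d"
      using w by (simp_all add: mat_diag_diag)
    have "?g * M * ?h = N s"
    proof (rule eq_matI)
      fix i j assume "i < dim_row (N s)" "j < dim_col (N s)"
      then have ij: "i < d" "j < d" by (auto simp: N_def)
      have "(?g * M * ?h) $$ (i, j) = w i * M $$ (i, j) * inverse (w j)"
        using ij Mc by (subst mat_diag_mult_right[of _ d]) (auto simp: mat_diag_mult_left[OF Mc])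
      moreover have "M $$ (i, j) = 0" if "(i = 0 \<or> r < i) \<and> j \<le> r"
        using M ij that unfolding flag_mats_def by blast
      ultimately show "(?g * M * ?h) $$ (i, j) = N s $$ (i, j)"
        using ij s unfolding N_def w_def flag_diag_def
        by (auto simp: power2_eq_square)
    qed (auto simp: N_def mat_diag_def)
    then show ?thesis using conj[OF Mc gh inv] by simp
  qed
  note vanish = this
  have "\<phi> (N 0) - \<phi> M = 0"
    by (rule polyfun_eq_zero[OF polyfun_diff[OF P polyfun_const] polyfun_ident, of 1])
      (simp_all add: vanish)
  moreover have "N 0 = flag_diag_part d r M"
    by (intro eq_matI) (auto simp: N_def flag_diag_part_def)
  ultimately show ?thesis by simp
qed

text \<open>\<open>\<phi>\<close> stands for an invariant composed with \<open>form\<close>. The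
  diagonal blocks are built up from 0 one entry at a time; at each stage an auxiliary entry outside
  the blocks is inserted, used for one elementary operation, and then discarded by
  \<open>invariant_flag_diag_part\<close>.\<close>

lemma invariant_vanishes_on_flag_mats:
  fixes \<phi> :: "'a::field_char_0 mat \<Rightarrow> 'a"
  assumes poly: "\<And>M. polymat d d M \<Longrightarrow> polyfun (\<lambda>t. \<phi> (M t))"
    and conj: "\<And>M g h. M \<in> carrier_mat d d \<Longrightarrow> g \<in> bordered d \<Longrightarrow> h \<in> bordered d \<Longrightarrow>
      g * h = 1\<^sub>m d \<Longrightarrow> h * g = 1\<^sub>m d \<Longrightarrow> \<phi> (g * M * h) = \<phi> M"
    and col: "\<And>M k c. M \<in> carrier_mat d d \<Longrightarrow> 0 < k \<Longrightarrow> k < d \<Longrightarrow> \<phi> (addcol c k 0 M) = \<phi> M"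
    and row: "\<And>M k c. M \<in> carrier_mat d d \<Longrightarrow> 0 < k \<Longrightarrow> k < d \<Longrightarrow> \<phi> (addrow c k 0 M) = \<phi> M"
    and zero: "\<phi> (0\<^sub>m d d) = 0"
    and M: "M \<in> flag_mats d r"
  shows "\<phi> M = 0"
proof -
  have diag: "\<phi> A = \<phi> (flag_diag_part d r A)" if "A \<in> flag_mats d r" for A
    by (rule invariant_flag_diag_part[OF poly conj that])
  have Mc: "M \<in> carrier_mat d d" using M by (auto simp: flag_mats_def)
  define N where "N = (\<lambda>S. mat d d (\<lambda>(i, j). if (i, j) \<in> S \<and> flag_diag r i j then M $$ (i, j) else 0))"
  have N: "N S \<in> flag_mats d r" "flag_diag_part d r (N S) = N S" "N S \<in> carrier_mat d d" for S
    by (auto simp: N_def flag_mats_def flag_diag_part_def flag_diag_def)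
  have "\<phi> (N S) = 0" if "finite S" "S \<subseteq> {..<d} \<times> {..<d}" for S
    using that
  proof (induction S rule: finite_induct)
    case empty
    have "N {} = 0\<^sub>m d d" by (intro eq_matI) (auto simp: N_def)
    then show ?case using zero by simp
  next
    case (insert p S)
    obtain a b where p: "p = (a, b)" by (cases p)
    have ab: "a < d" "b < d" "(a, b) \<notin> S" using insert p by auto
    show ?case
    proof (cases "flag_diag r a b")
      case False
      then have "N (insert p S) = N S" by (intro eq_matI) (auto simp: N_def p)
      then show ?thesis using insert by simp
    next
      case fd: True
      show ?thesis
      proof (cases "a \<le> r")
        case True
        \<comment> \<open>A rank one change supported in row \<open>a \<le> r\<close> is a column operation once the unit
          vector \<open>a\<close> has been put into column \<open>0\<close>; neither changes the value of \<open>\<phi>\<close> at the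
          block diagonal part.\<close>
        with fd have k: "0 < a" "a \<le> r" "0 < b" "b \<le> r" by (auto simp: flag_diag_def)
        define X where "X = mat d d (\<lambda>(i, j). if i = a \<and> j = 0 then 1 else N S $$ (i, j))"
        have Xc: "X \<in> carrier_mat d d" by (simp add: X_def)
        have X: "X \<in> flag_mats d r" "flag_diag_part d r X = N S"
          using k by (auto simp: N_def flag_mats_def flag_diag_part_def flag_diag_def X_def)
        let ?Y = "addcol (M $$ (a, b)) b 0 X"
        have Y: "?Y \<in> flag_mats d r"
          using k by (auto simp: X_def N_def flag_mats_def flag_diag_def mat_addcol_def)
        have "flag_diag_part d r ?Y = N (insert p S)"
        proof (rule eq_matI)
          fix i j assume "i < dim_row (N (insert p S))" "j < dim_col (N (insert p S))"
          then have ij: "i < d" "j < d" by (auto simp: N_def)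
          have X0: "X $$ (i, 0) = (if i = a then 1 else 0)"
            using ij by (simp add: X_def N_def flag_diag_def)
          have Xj: "X $$ (i, j) = N S $$ (i, j)" if "flag_diag r i j"
            using ij that by (auto simp: X_def flag_diag_def)
          have Yij: "?Y $$ (i, j) = (if b = j then M $$ (a, b) * X $$ (i, 0) + X $$ (i, j) else X $$ (i, j))"
            using ij Xc by (simp add: mat_addcol_def)
          have "flag_diag_part d r ?Y $$ (i, j) = (if flag_diag r i j then ?Y $$ (i, j) else 0)"
            using ij by (simp add: flag_diag_part_def)
          then show "flag_diag_part d r ?Y $$ (i, j) = N (insert p S) $$ (i, j)"
            unfolding Yij X0 using ij Xj ab(3) fd by (auto simp: N_def p)
        qed (auto simp: N_def flag_diag_part_def)
        then have "\<phi> (N (insert p S)) = \<phi> ?Y" using diag[OF Y] by simp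
        also have "\<dots> = \<phi> X" by (rule col[OF Xc k(3) ab(2)])
        also have "\<dots> = \<phi> (N S)" using diag[OF X(1)] X(2) by simp
        finally show ?thesis using insert by simp
      next
        case False
        with fd have k: "0 < a" "r < a" "r < b" by (auto simp: flag_diag_def)
        \<comment> \<open>In the lower block the roles of rows and columns are exchanged: a flag
          matrix has no entries in column 0 below row r, but it may have one at (0, b) with b > r. A
          row operation then carries it to (a, b).\<close>
        define X where "X = mat d d (\<lambda>(i, j). if i = 0 \<and> j = b then 1 else N S $$ (i, j))"
        have Xc: "X \<in> carrier_mat d d" by (simp add: X_def)
        have X: "X \<in> flag_mats d r" "flag_diag_part d r X = N S"
          using k by (auto simp: N_def flag_mats_def flag_diag_part_def flag_diag_def X_def)
        let ?Y = "addrow (M $$ (a, b)) a 0 X"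
        have Y: "?Y \<in> flag_mats d r"
          using k by (auto simp: X_def N_def flag_mats_def flag_diag_def mat_addrow_def)
        have "flag_diag_part d r ?Y = N (insert p S)"
        proof (rule eq_matI)
          fix i j assume "i < dim_row (N (insert p S))" "j < dim_col (N (insert p S))"
          then have ij: "i < d" "j < d" by (auto simp: N_def)
          have X0: "X $$ (0, j) = (if j = b then 1 else 0)"
            using ij by (simp add: X_def N_def flag_diag_def)
          have Xj: "X $$ (i, j) = N S $$ (i, j)" if "flag_diag r i j"
            using ij that by (auto simp: X_def flag_diag_def)
          have Yij: "?Y $$ (i, j) = (if a = i then M $$ (a, b) * X $$ (0, j) + X $$ (i, j) else X $$ (i, j))"
            using ij Xc by (simp add: mat_addrow_def)
          have "flag_diag_part d r ?Y $$ (i, j) = (if flag_diag r i j then ?Y $$ (i, j) else 0)"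
            using ij by (simp add: flag_diag_part_def)
          then show "flag_diag_part d r ?Y $$ (i, j) = N (insert p S) $$ (i, j)"
            unfolding Yij X0 using ij Xj ab(3) fd by (auto simp: N_def p)
        qed (auto simp: N_def flag_diag_part_def)
        then have "\<phi> (N (insert p S)) = \<phi> ?Y" using diag[OF Y] by simp
        also have "\<dots> = \<phi> X" by (rule row[OF Xc k(1) ab(1)])
        also have "\<dots> = \<phi> (N S)" using diag[OF X(1)] X(2) by simp
        finally show ?thesis using insert by simp
      qed
    qed
  qed
  from this[of "{..<d} \<times> {..<d}"] have "\<phi> (N ({..<d} \<times> {..<d})) = 0" by simp
  moreover have "N ({..<d} \<times> {..<d}) = flag_diag_part d r M"
    by (intro eq_matI) (auto simp: N_def flag_diag_part_def)
  moreover have "\<phi> M = \<phi> (flag_diag_part d r M)" by (rule diag[OF M])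
  ultimately show ?thesis by simp
qed

subsection \<open>Coordinates on the dual of the centraliser\<close>

primrec pow_comb :: "'a::comm_ring_1 mat \<Rightarrow> (nat \<Rightarrow> 'a) \<Rightarrow> nat \<Rightarrow> 'a mat" where
  "pow_comb e a 0 = 0\<^sub>m (dim_row e) (dim_row e)"
| "pow_comb e a (Suc k) = pow_comb e a k + a k \<cdot>\<^sub>m e ^\<^sub>m k"

lemma pow_comb_carrier [simp]: "e \<in> carrier_mat N N \<Longrightarrow> pow_comb e a k \<in> carrier_mat N N"
  by (induction k) auto

text \<open>The bilinear form tr (A^T B), by which a d x d matrix represents a linear form on d x d
  matrices.\<close>

definition pairing :: "nat \<Rightarrow> 'a::comm_ring_1 mat \<Rightarrow> 'a mat \<Rightarrow> 'a" where
  "pairing d A B = (\<Sum>p\<in>{..<d} \<times> {..<d}. A $$ p * B $$ p)"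

definition elem_mat :: "nat \<Rightarrow> nat \<times> nat \<Rightarrow> 'a::{zero,one} mat" where
  "elem_mat d p = mat d d (\<lambda>q. if q = p then 1 else 0)"

lemma elem_mat_carrier [simp]: "elem_mat d p \<in> carrier_mat d d"
  by (simp add: elem_mat_def)

lemma pairing_add_right:
  "B \<in> carrier_mat d d \<Longrightarrow> C \<in> carrier_mat d d \<Longrightarrow>
   pairing d A (B + C) = pairing d A B + pairing d A C"
  unfolding pairing_def sum.distrib[symmetric]
  by (intro sum.cong) (auto simp: algebra_simps)

lemma pairing_smult_right:
  "B \<in> carrier_mat d d \<Longrightarrow> pairing d A (c \<cdot>\<^sub>m B) = c * pairing d A B"
  unfolding pairing_def sum_distrib_left
  by (intro sum.cong) (auto simp: algebra_simps)

lemma pairing_zero_right: "pairing d A (0\<^sub>m d d) = 0"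
  unfolding pairing_def by (intro sum.neutral) auto

lemma pairing_zero_left: "pairing d (0\<^sub>m d d) A = 0"
  unfolding pairing_def by (intro sum.neutral) auto

lemma pairing_elem_mat:
  assumes "i < d" "j < d" shows "pairing d A (elem_mat d (i, j)) = A $$ (i, j)"
proof -
  have "pairing d A (elem_mat d (i, j)) =
      (\<Sum>p\<in>{..<d} \<times> {..<d}. if p = (i, j) then A $$ p else 0)"
    unfolding pairing_def by (intro sum.cong) (auto simp: elem_mat_def split: if_splits)
  then show ?thesis using assms by simp
qed

text \<open>The adjoint of S \<mapsto> X S Y for this form is M \<mapsto> X^T M Y^T; tested on
  matrix units. This is the source of the transposes in the coadjoint action.\<close>

lemma pairing_mult_elem_mat:
  assumes M: "M \<in> carrier_mat d d" and X: "X \<in> carrier_mat d d" and Y: "Y \<in> carrier_mat d d"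
    and ij: "i < d" "j < d"
  shows "pairing d M (X * elem_mat d (i, j) * Y) = (X\<^sup>T * M * Y\<^sup>T) $$ (i, j)"
proof -
  have "(X * elem_mat d (i, j) * Y) $$ (p, q) = X $$ (p, i) * Y $$ (j, q)" if "p < d" "q < d" for p q
  proof -
    have *: "(X * elem_mat d (i, j)) $$ (p, b) = (if b = j then X $$ (p, i) else 0)" if "b < d" for b
    proof -
      have "(X * elem_mat d (i, j)) $$ (p, b) = (\<Sum>a<d. X $$ (p, a) * elem_mat d (i, j) $$ (a, b))"
        by (rule index_mult_mat_sum[OF X elem_mat_carrier \<open>p < d\<close> that])
      also have "\<dots> = (\<Sum>a<d. if a = i then (if b = j then X $$ (p, i) else 0) else 0)"
        using that ij by (intro sum.cong) (auto simp: elem_mat_def)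
      finally show ?thesis using ij by simp
    qed
    have "(X * elem_mat d (i, j) * Y) $$ (p, q) = (\<Sum>b<d. (X * elem_mat d (i, j)) $$ (p, b) * Y $$ (b, q))"
      by (rule index_mult_mat_sum[OF mult_carrier_mat[OF X elem_mat_carrier] Y that])
    also have "\<dots> = (\<Sum>b<d. if b = j then X $$ (p, i) * Y $$ (j, q) else 0)"
      using * by (intro sum.cong) auto
    finally show ?thesis using ij by simp
  qed
  then have "pairing d M (X * elem_mat d (i, j) * Y) =
      (\<Sum>p<d. \<Sum>q<d. M $$ (p, q) * (X $$ (p, i) * Y $$ (j, q)))"
    unfolding pairing_def sum.cartesian_product by (intro sum.cong) auto
  moreover have "(X\<^sup>T * M * Y\<^sup>T) $$ (i, j) = (\<Sum>q<d. (X\<^sup>T * M) $$ (i, q) * Y\<^sup>T $$ (q, j))"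
    by (rule index_mult_mat_sum[of _ d d _ d]) (use X M Y ij in auto)
  moreover have "\<dots> = (\<Sum>q<d. (\<Sum>p<d. X\<^sup>T $$ (i, p) * M $$ (p, q)) * Y\<^sup>T $$ (q, j))"
    using X M ij by (intro sum.cong refl arg_cong2[of _ _ _ _ "(*)"] index_mult_mat_sum[of _ d d _ d]) auto
  moreover have "\<dots> = (\<Sum>q<d. \<Sum>p<d. M $$ (p, q) * (X $$ (p, i) * Y $$ (j, q)))"
    unfolding sum_distrib_right using X Y ij by (intro sum.cong) (auto simp: algebra_simps)
  moreover have "\<dots> = (\<Sum>p<d. \<Sum>q<d. M $$ (p, q) * (X $$ (p, i) * Y $$ (j, q)))"
    by (rule sum.swap)
  ultimately show ?thesis by simp
qed

section \<open>The centraliser as an associative algebra and the coadjoint action\<close>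

lemma lie_centraliser_iff:
  fixes e :: "'a::field mat"
  assumes "e \<in> carrier_mat N N"
  shows "x \<in> lie_centraliser e \<longleftrightarrow> x \<in> carrier_mat N N \<and> e * x = x * e"
proof -
  have "e * x - x * e = 0\<^sub>m N N \<longleftrightarrow> e * x = x * e" if x: "x \<in> carrier_mat N N"
  proof
    assume 0: "e * x - x * e = 0\<^sub>m N N"
    show "e * x = x * e"
    proof (rule eq_matI)
      fix i j assume "i < dim_row (x * e)" "j < dim_col (x * e)"
      then have ij: "i < N" "j < N" using assms x by auto
      have "(e * x - x * e) $$ (i, j) = 0" unfolding 0 using ij by simp
      moreover have "(e * x - x * e) $$ (i, j) = (e * x) $$ (i, j) - (x * e) $$ (i, j)"
        using ij assms x by (intro index_minus_mat) auto
      ultimately show "(e * x) $$ (i, j) = (x * e) $$ (i, j)" by simp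
    qed (use assms x in auto)
  next
    assume "e * x = x * e"
    then show "e * x - x * e = 0\<^sub>m N N" using assms x by (intro eq_matI) auto
  qed
  moreover have "dim_row e = N" using assms by simp
  ultimately show ?thesis unfolding lie_centraliser_def by blast
qed

lemma lie_centraliser_add:
  fixes e :: "'a::field mat"
  assumes e: "e \<in> carrier_mat N N" and "x \<in> lie_centraliser e" "y \<in> lie_centraliser e"
  shows "x + y \<in> lie_centraliser e"
  using assms(2,3) mult_add_distrib_mat[OF e, of x N y] add_mult_distrib_mat[of x N N y e N] e
  by (auto simp: lie_centraliser_iff[OF e])

lemma lie_centraliser_smult:
  fixes e :: "'a::field mat"
  assumes e: "e \<in> carrier_mat N N" and "x \<in> lie_centraliser e"
  shows "c \<cdot>\<^sub>m x \<in> lie_centraliser e"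
  using assms(2) mult_smult_distrib[OF e, of x N c] mult_smult_assoc_mat[of x N N e N c] e
  by (auto simp: lie_centraliser_iff[OF e])

lemma lie_centraliser_mult:
  fixes e :: "'a::field mat"
  assumes e: "e \<in> carrier_mat N N" and "x \<in> lie_centraliser e" "y \<in> lie_centraliser e"
  shows "x * y \<in> lie_centraliser e"
proof -
  have x: "x \<in> carrier_mat N N" "e * x = x * e" and y: "y \<in> carrier_mat N N" "e * y = y * e"
    using assms by (auto simp: lie_centraliser_iff[OF e])
  have "e * (x * y) = x * e * y" using assoc_mult_mat[OF e x(1) y(1)] x by simp
  also have "\<dots> = x * (y * e)" using assoc_mult_mat[OF x(1) e y(1)] y by simp
  also have "\<dots> = x * y * e" using assoc_mult_mat[OF x(1) y(1) e] by simp
  finally show ?thesis using x y by (simp add: lie_centraliser_iff[OF e])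
qed

lemma lie_centraliser_pow:
  fixes e :: "'a::field mat"
  assumes e: "e \<in> carrier_mat N N"
  shows "e ^\<^sub>m k \<in> lie_centraliser e"
  using e pow_mat_Suc_left[OF e, of k] by (simp add: lie_centraliser_iff[OF e])

lemma lie_centraliser_zero:
  fixes e :: "'a::field mat"
  assumes e: "e \<in> carrier_mat N N" shows "0\<^sub>m N N \<in> lie_centraliser e"
  using e by (simp add: lie_centraliser_iff[OF e])

lemma lie_centraliser_pow_comb:
  fixes e :: "'a::field mat"
  assumes e: "e \<in> carrier_mat N N"
  shows "pow_comb e a k \<in> lie_centraliser e"
  using e lie_centraliser_zero[OF e]
  by (induction k) (auto intro!: lie_centraliser_add[OF e] lie_centraliser_smult[OF e] lie_centraliser_pow)

text \<open>Replaces the abstract group inverse by a matrix \<open>h\<close> which lies in the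
  centraliser as well, so that both factors of h x g can be treated by the same
  decomposition.\<close>

lemma group_stabiliserE:
  fixes e :: "'a::field mat"
  assumes e: "e \<in> carrier_mat N N" and g: "g \<in> group_stabiliser e"
  obtains h where "g \<in> lie_centraliser e" "h \<in> lie_centraliser e" "g * h = 1\<^sub>m N" "h * g = 1\<^sub>m N"
    "\<And>\<xi>. coadjoint e g \<xi> = restrict (\<lambda>x. \<xi> (h * x * g)) (lie_centraliser e)"
proof -
  obtain h where h: "g \<in> carrier_mat N N" "h \<in> carrier_mat N N" "g * h = 1\<^sub>m N" "h * g = 1\<^sub>m N"
    and inv: "inv\<^bsub>general_linear_group TYPE('a) N\<^esub> g = h" and gh: "g * e * h = e"
    using g unfolding group_stabiliser_iff[OF e] by blast
  have ge: "g * e \<in> carrier_mat N N" and he: "h * e \<in> carrier_mat N N" using h e by auto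
  have "e * g = g * e * h * g" using gh by simp
  also have "\<dots> = g * e" using assoc_mult_mat[OF ge h(2,1)] h(4) right_mult_one_mat[OF ge] by simp
  finally have eg: "e * g = g * e" .
  have "h * (g * e * h) = h * (g * (e * h))" using assoc_mult_mat[OF h(1) e h(2)] by simp
  also have "\<dots> = h * g * (e * h)"
    using assoc_mult_mat[OF h(2,1) mult_carrier_mat[OF e h(2)]] by simp
  also have "\<dots> = e * h" using h(4) e h(2) by simp
  finally have eh: "e * h = h * e" using gh by simp
  have dim: "dim_row e = N" using e by simp
  show ?thesis
  proof (rule that[OF _ _ h(3,4)])
    show "g \<in> lie_centraliser e" "h \<in> lie_centraliser e"
      using eg eh h by (auto simp: lie_centraliser_iff[OF e])
    show "coadjoint e g \<xi> = restrict (\<lambda>x. \<xi> (h * x * g)) (lie_centraliser e)" for \<xi>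
      unfolding coadjoint_def dim Let_def inv ..
  qed
qed

lemma group_stabiliserI:
  fixes e :: "'a::field mat"
  assumes e: "e \<in> carrier_mat N N" and g: "g \<in> lie_centraliser e" and h: "h \<in> carrier_mat N N"
    and gh: "g * h = 1\<^sub>m N" "h * g = 1\<^sub>m N"
  shows "g \<in> group_stabiliser e"
    "coadjoint e g \<xi> = restrict (\<lambda>x. \<xi> (h * x * g)) (lie_centraliser e)"
proof -
  let ?M = "ring_mat TYPE('a) N ()" and ?G = "general_linear_group TYPE('a) N"
  interpret R: ring ?M by (rule ring_mat)
  interpret G: group ?G
    unfolding general_linear_group_def by (rule R.units_group)
  have g': "g \<in> carrier_mat N N" "e * g = g * e" using g by (auto simp: lie_centraliser_iff[OF e])
  have "g \<in> Units ?M" "h \<in> Units ?M"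
    using g' h gh by (auto simp: Units_def ring_mat_def)
  then have "g \<in> carrier ?G" "h \<in> carrier ?G" "h \<otimes>\<^bsub>?G\<^esub> g = \<one>\<^bsub>?G\<^esub>"
    using gh by (auto simp: general_linear_group_def units_of_def ring_mat_def)
  then have inv: "inv\<^bsub>?G\<^esub> g = h" by (intro G.inv_equality)
  have "g * e * h = e * (g * h)" using assoc_mult_mat[OF e g'(1) h] g' by simp
  then have "g * e * h = e" using gh e by simp
  then show "g \<in> group_stabiliser e"
    unfolding group_stabiliser_iff[OF e] using g' h gh inv by blast
  have dim: "dim_row e = N" using e by simp
  show "coadjoint e g \<xi> = restrict (\<lambda>x. \<xi> (h * x * g)) (lie_centraliser e)"
    unfolding coadjoint_def dim Let_def inv ..
qed

lemma centraliser_dualD: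
  assumes "\<xi> \<in> centraliser_dual e"
  shows "\<xi> \<in> extensional (lie_centraliser e)"
    "x \<in> lie_centraliser e \<Longrightarrow> y \<in> lie_centraliser e \<Longrightarrow> \<xi> (x + y) = \<xi> x + \<xi> y"
    "x \<in> lie_centraliser e \<Longrightarrow> \<xi> (c \<cdot>\<^sub>m x) = c * \<xi> x"
  using assms by (auto simp: centraliser_dual_def)

lemma centraliser_dual_zero:
  assumes e: "e \<in> carrier_mat N N" and "\<xi> \<in> centraliser_dual e" shows "\<xi> (0\<^sub>m N N) = 0"
  using centraliser_dualD(3)[OF assms(2) lie_centraliser_zero[OF e], of 0] by simp

lemma centraliser_dual_pow_comb:
  assumes e: "e \<in> carrier_mat N N" and \<xi>: "\<xi> \<in> centraliser_dual e"
    and "\<And>l. l < k \<Longrightarrow> \<xi> (e ^\<^sub>m l) = 0"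
  shows "\<xi> (pow_comb e a k) = 0"
  using assms(3)
proof (induction k)
  case 0
  then show ?case using centraliser_dual_zero[OF e \<xi>] e by simp
next
  case (Suc k)
  then show ?case
    using centraliser_dualD[OF \<xi>] lie_centraliser_pow_comb[OF e] lie_centraliser_pow[OF e]
      lie_centraliser_smult[OF e] by simp
qed

lemma coadjoint_dual:
  fixes e :: "'a::field mat"
  assumes e: "e \<in> carrier_mat N N" and g: "g \<in> group_stabiliser e" and \<xi>: "\<xi> \<in> centraliser_dual e"
  shows "coadjoint e g \<xi> \<in> centraliser_dual e"
proof -
  obtain h where gh: "g \<in> lie_centraliser e" "h \<in> lie_centraliser e"
    and co: "coadjoint e g \<xi> = restrict (\<lambda>x. \<xi> (h * x * g)) (lie_centraliser e)"
    using group_stabiliserE[OF e g] by metis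
  have cc: "x \<in> carrier_mat N N" if "x \<in> lie_centraliser e" for x
    using that by (simp add: lie_centraliser_iff[OF e])
  note gc = cc[OF gh(1)] and hc = cc[OF gh(2)]
  have in_c: "h * x * g \<in> lie_centraliser e" if "x \<in> lie_centraliser e" for x
    using that gh by (intro lie_centraliser_mult[OF e])
  show ?thesis
    unfolding centraliser_dual_def co
  proof (intro CollectI conjI ballI allI restrict_extensional)
    fix x y assume xy: "x \<in> lie_centraliser e" "y \<in> lie_centraliser e"
    have "h * (x + y) * g = h * x * g + h * y * g"
      using mult_add_distrib_mat[OF hc cc[OF xy(1)] cc[OF xy(2)]]
        add_mult_distrib_mat[OF mult_carrier_mat[OF hc cc[OF xy(1)]] mult_carrier_mat[OF hc cc[OF xy(2)]] gc]
      by simp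
    then show "restrict (\<lambda>x. \<xi> (h * x * g)) (lie_centraliser e) (x + y) =
        restrict (\<lambda>x. \<xi> (h * x * g)) (lie_centraliser e) x +
        restrict (\<lambda>x. \<xi> (h * x * g)) (lie_centraliser e) y"
      using xy in_c lie_centraliser_add[OF e] centraliser_dualD(2)[OF \<xi>] by simp
  next
    fix c x assume x: "x \<in> lie_centraliser e"
    have "h * (c \<cdot>\<^sub>m x) * g = c \<cdot>\<^sub>m (h * x * g)"
      using mult_smult_distrib[OF hc cc[OF x]]
        mult_smult_assoc_mat[OF mult_carrier_mat[OF hc cc[OF x]] gc] by simp
    then show "restrict (\<lambda>x. \<xi> (h * x * g)) (lie_centraliser e) (c \<cdot>\<^sub>m x) =
        c * restrict (\<lambda>x. \<xi> (h * x * g)) (lie_centraliser e) x"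
      using x in_c lie_centraliser_smult[OF e] centraliser_dualD(3)[OF \<xi>] by simp
  qed
qed

lemma coadjoint_pow:
  fixes e :: "'a::field mat"
  assumes e: "e \<in> carrier_mat N N" and g: "g \<in> group_stabiliser e"
  shows "coadjoint e g \<xi> (e ^\<^sub>m l) = \<xi> (e ^\<^sub>m l)"
proof -
  obtain h where gh: "g \<in> lie_centraliser e" "h \<in> lie_centraliser e" "h * g = 1\<^sub>m N"
    and co: "coadjoint e g \<xi> = restrict (\<lambda>x. \<xi> (h * x * g)) (lie_centraliser e)"
    using group_stabiliserE[OF e g] by metis
  have gc: "g \<in> carrier_mat N N" "e * g = g * e" and hc: "h \<in> carrier_mat N N" "e * h = h * e"
    using gh by (auto simp: lie_centraliser_iff[OF e])
  have el: "e ^\<^sub>m l \<in> carrier_mat N N" using e by simp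
  have "e ^\<^sub>m l * g = g * e ^\<^sub>m l"
  proof (induction l)
    case 0
    show ?case using gc e by simp
  next
    case (Suc l)
    have l: "e ^\<^sub>m l \<in> carrier_mat N N" using e by simp
    have "e ^\<^sub>m Suc l * g = e ^\<^sub>m l * (g * e)"
      using assoc_mult_mat[OF l e gc(1)] gc by simp
    also have "\<dots> = g * e ^\<^sub>m l * e" using assoc_mult_mat[OF l gc(1) e] Suc by simp
    also have "\<dots> = g * e ^\<^sub>m Suc l" using assoc_mult_mat[OF gc(1) l e] by simp
    finally show ?case .
  qed
  then have "h * e ^\<^sub>m l * g = h * (g * e ^\<^sub>m l)"
    using assoc_mult_mat[OF hc(1) el gc(1)] by simp
  also have "\<dots> = e ^\<^sub>m l"
    using assoc_mult_mat[OF hc(1) gc(1) el] gh(3) left_mult_one_mat[OF el] by simp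
  finally show ?thesis using lie_centraliser_pow[OF e] by (simp add: co)
qed

subsection \<open>Adapted coordinates\<close>

text \<open>The image of \<open>S \<mapsto> K S L\<close> is \<open>Hom(V / eV, ker e)\<close>; the centraliser is spanned by it and
  by the powers \<open>e\<^sup>l\<close>, \<open>l < n - 1\<close>. The product \<open>L K\<close> is the natural map \<open>ker e \<rightarrow> V / eV\<close>, and
  \<open>T\<close> extracts \<open>S\<close>.\<close>

locale hook_coords =
  fixes e :: "'a::field_char_0 mat" and N d n :: nat and K L :: "'a mat" and T :: "'a mat \<Rightarrow> 'a mat"
  assumes e: "e \<in> carrier_mat N N" and d: "0 < d" and n: "2 \<le> n"
    and K: "K \<in> carrier_mat N d" and L: "L \<in> carrier_mat d N"
    and eK: "e * K = 0\<^sub>m N d" and Le: "L * e = 0\<^sub>m d N" and LK: "L * K = trace_form d"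
    and T_carrier: "\<And>x. x \<in> carrier_mat N N \<Longrightarrow> T x \<in> carrier_mat d d"
    and T_add: "\<And>x y. x \<in> carrier_mat N N \<Longrightarrow> y \<in> carrier_mat N N \<Longrightarrow> T (x + y) = T x + T y"
    and T_smult: "\<And>c x. x \<in> carrier_mat N N \<Longrightarrow> T (c \<cdot>\<^sub>m x) = c \<cdot>\<^sub>m T x"
    and T_KSL: "\<And>S. S \<in> carrier_mat d d \<Longrightarrow> T (K * S * L) = S"
    and T_pow: "\<And>l. l < n - 1 \<Longrightarrow> T (e ^\<^sub>m l) = 0\<^sub>m d d"
    and decomp: "\<And>x. x \<in> lie_centraliser e \<Longrightarrow> \<exists>a. x = pow_comb e a (n - 1) + K * T x * L"
begin

definition hat :: "'a mat \<Rightarrow> 'a mat" where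
  "hat S = K * S * L"

definition coord :: "('a mat \<Rightarrow> 'a) \<Rightarrow> 'a mat" where
  "coord \<xi> = mat d d (\<lambda>p. \<xi> (hat (elem_mat d p)))"

text \<open>The extension of the linear form given by M on the image of \<open>hat\<close> by zero
  on the powers e^l with l < n - 1. All points of the null-cone have this shape, because the values
  on powers of e are themselves invariants of degree one.\<close>

definition form :: "'a mat \<Rightarrow> 'a mat \<Rightarrow> 'a" where
  "form M = restrict (\<lambda>x. pairing d M (T x)) (lie_centraliser e)"

lemma coord_carrier [simp]: "coord \<xi> \<in> carrier_mat d d"
  by (simp add: coord_def)

lemma coord_dim [simp]: "dim_row (coord \<xi>) = d" "dim_col (coord \<xi>) = d"
  by (simp_all add: coord_def)

lemma centraliser_carrier: "x \<in> lie_centraliser e \<Longrightarrow> x \<in> carrier_mat N N"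
  by (simp add: lie_centraliser_iff[OF e])

lemma hat_carrier: "S \<in> carrier_mat d d \<Longrightarrow> hat S \<in> carrier_mat N N"
  using K L unfolding hat_def by auto

lemma T_hat: "S \<in> carrier_mat d d \<Longrightarrow> T (hat S) = S"
  unfolding hat_def by (rule T_KSL)

lemma hat_add:
  assumes "S \<in> carrier_mat d d" "R \<in> carrier_mat d d" shows "hat (S + R) = hat S + hat R"
  unfolding hat_def
  using mult_add_distrib_mat[OF K assms]
    add_mult_distrib_mat[OF mult_carrier_mat[OF K assms(1)] mult_carrier_mat[OF K assms(2)] L] by simp

lemma hat_smult:
  assumes "S \<in> carrier_mat d d" shows "hat (c \<cdot>\<^sub>m S) = c \<cdot>\<^sub>m hat S"
  unfolding hat_def
  using mult_smult_distrib[OF K assms] mult_smult_assoc_mat[OF mult_carrier_mat[OF K assms] L] by simp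

lemma hat_zero: "hat (0\<^sub>m d d) = 0\<^sub>m N N"
  using K L by (simp add: hat_def)

lemma e_hat:
  assumes S: "S \<in> carrier_mat d d" shows "e * hat S = 0\<^sub>m N N" "hat S * e = 0\<^sub>m N N"
proof -
  have "e * hat S = e * K * S * L"
    unfolding hat_def using assoc_mult_mat[OF e mult_carrier_mat[OF K S] L] assoc_mult_mat[OF e K S]
    by simp
  then show "e * hat S = 0\<^sub>m N N" using eK S L by simp
  have "hat S * e = K * S * (L * e)"
    unfolding hat_def by (rule assoc_mult_mat[OF mult_carrier_mat[OF K S] L e])
  then show "hat S * e = 0\<^sub>m N N" using Le S K by simp
qed

lemma hat_centraliser: "S \<in> carrier_mat d d \<Longrightarrow> hat S \<in> lie_centraliser e"
  using e_hat hat_carrier by (simp add: lie_centraliser_iff[OF e])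

lemma pairing_coord:
  assumes \<xi>: "\<xi> \<in> centraliser_dual e" and S: "S \<in> carrier_mat d d"
  shows "\<xi> (hat S) = pairing d (coord \<xi>) S"
proof -
  define R where "R = (\<lambda>P. mat d d (\<lambda>p. if p \<in> P then S $$ p else 0))"
  have R: "R P \<in> carrier_mat d d" for P by (simp add: R_def)
  have "\<xi> (hat (R P)) = (\<Sum>p\<in>P. coord \<xi> $$ p * S $$ p)"
    if "finite P" "P \<subseteq> {..<d} \<times> {..<d}" for P
    using that
  proof (induction P rule: finite_induct)
    case empty
    have "R {} = 0\<^sub>m d d" by (intro eq_matI) (auto simp: R_def)
    then show ?case using hat_zero centraliser_dual_zero[OF e \<xi>] by simp
  next
    case (insert p P)
    have "R (insert p P) = R P + S $$ p \<cdot>\<^sub>m elem_mat d p"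
      using insert.hyps by (intro eq_matI) (auto simp: R_def elem_mat_def)
    then have "hat (R (insert p P)) = hat (R P) + S $$ p \<cdot>\<^sub>m hat (elem_mat d p)"
      using R by (simp add: hat_add hat_smult)
    then have "\<xi> (hat (R (insert p P))) = \<xi> (hat (R P)) + S $$ p * \<xi> (hat (elem_mat d p))"
      using centraliser_dualD(2,3)[OF \<xi>] hat_centraliser R lie_centraliser_smult[OF e] by simp
    moreover have "\<xi> (hat (elem_mat d p)) = coord \<xi> $$ p"
      using insert.prems by (cases p) (auto simp: coord_def)
    ultimately show ?case using insert by simp
  qed
  from this[of "{..<d} \<times> {..<d}"] have "\<xi> (hat (R ({..<d} \<times> {..<d}))) = pairing d (coord \<xi>) S"
    by (simp add: pairing_def)
  moreover have "R ({..<d} \<times> {..<d}) = S" using S by (intro eq_matI) (auto simp: R_def)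
  ultimately show ?thesis by simp
qed

lemma form_dual: "form M \<in> centraliser_dual e"
  unfolding centraliser_dual_def
proof (intro CollectI conjI ballI allI)
  show "form M \<in> extensional (lie_centraliser e)" by (simp add: form_def)
  fix x y assume "x \<in> lie_centraliser e" "y \<in> lie_centraliser e"
  then show "form M (x + y) = form M x + form M y"
    using centraliser_carrier lie_centraliser_add[OF e]
    by (simp add: form_def T_add pairing_add_right T_carrier)
next
  fix c x assume "x \<in> lie_centraliser e"
  then show "form M (c \<cdot>\<^sub>m x) = c * form M x"
    using centraliser_carrier lie_centraliser_smult[OF e]
    by (simp add: form_def T_smult pairing_smult_right T_carrier)
qed

lemma coord_form:
  assumes "M \<in> carrier_mat d d" shows "coord (form M) = M"
  using assms hat_centraliser
  by (intro eq_matI) (auto simp: coord_def form_def T_hat pairing_elem_mat)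

lemma form_pow: "l < n - 1 \<Longrightarrow> form M (e ^\<^sub>m l) = 0"
  using lie_centraliser_pow[OF e] by (simp add: form_def T_pow pairing_zero_right)

lemma form_coord:
  assumes \<xi>: "\<xi> \<in> centraliser_dual e" and zero: "\<And>l. l < n - 1 \<Longrightarrow> \<xi> (e ^\<^sub>m l) = 0"
  shows "form (coord \<xi>) = \<xi>"
proof
  fix x
  show "form (coord \<xi>) x = \<xi> x"
  proof (cases "x \<in> lie_centraliser e")
    case True
    obtain a where x: "x = pow_comb e a (n - 1) + hat (T x)"
      using decomp[OF True] unfolding hat_def by blast
    have Tx: "T x \<in> carrier_mat d d" using T_carrier centraliser_carrier True by blast
    have "\<xi> x = \<xi> (pow_comb e a (n - 1)) + \<xi> (hat (T x))"
      using centraliser_dualD(2)[OF \<xi> lie_centraliser_pow_comb[OF e] hat_centraliser[OF Tx]] x by metis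
    also have "\<dots> = pairing d (coord \<xi>) (T x)"
      using centraliser_dual_pow_comb[OF e \<xi> zero] pairing_coord[OF \<xi> Tx] by simp
    finally show ?thesis using True by (simp add: form_def)
  next
    case False
    then show ?thesis
      using centraliser_dualD(1)[OF \<xi>] by (simp add: form_def extensional_def)
  qed
qed

section \<open>Action of the centraliser on ker e and on V / eV\<close>

lemma pow_comb_K: "0 < k \<Longrightarrow> pow_comb e a k * K = a 0 \<cdot>\<^sub>m K"
proof (induction k)
  case (Suc k)
  have ek: "e ^\<^sub>m k \<in> carrier_mat N N" using e by simp
  have *: "pow_comb e a (Suc k) * K = pow_comb e a k * K + a k \<cdot>\<^sub>m (e ^\<^sub>m k * K)"
    using add_mult_distrib_mat[of "pow_comb e a k" N N "a k \<cdot>\<^sub>m e ^\<^sub>m k" K d]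
      mult_smult_assoc_mat[OF ek K] K e by simp
  show ?case
  proof (cases k)
    case 0
    have "0\<^sub>m N d + a 0 \<cdot>\<^sub>m K = a 0 \<cdot>\<^sub>m K" using K by (intro eq_matI) auto
    then show ?thesis unfolding * using 0 e K by simp
  next
    case (Suc j)
    have "e ^\<^sub>m j \<in> carrier_mat N N" using e by simp
    then have "e ^\<^sub>m k * K = e ^\<^sub>m j * (e * K)"
      unfolding Suc pow_mat.simps using e K by (intro assoc_mult_mat)
    then have "e ^\<^sub>m k * K = 0\<^sub>m N d" unfolding eK using e by simp
    moreover have "a 0 \<cdot>\<^sub>m K + a k \<cdot>\<^sub>m 0\<^sub>m N d = a 0 \<cdot>\<^sub>m K" using K by (intro eq_matI) auto
    ultimately show ?thesis unfolding * using Suc.IH Suc Suc.prems by simp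
  qed
qed simp

lemma L_pow_comb: "0 < k \<Longrightarrow> L * pow_comb e a k = a 0 \<cdot>\<^sub>m L"
proof (induction k)
  case (Suc k)
  have ek: "e ^\<^sub>m k \<in> carrier_mat N N" using e by simp
  have *: "L * pow_comb e a (Suc k) = L * pow_comb e a k + a k \<cdot>\<^sub>m (L * e ^\<^sub>m k)"
    using mult_add_distrib_mat[of L d N "pow_comb e a k" N "a k \<cdot>\<^sub>m e ^\<^sub>m k"]
      mult_smult_distrib[OF L ek] L e by simp
  show ?case
  proof (cases k)
    case 0
    have "0\<^sub>m d N + a 0 \<cdot>\<^sub>m L = a 0 \<cdot>\<^sub>m L" using L by (intro eq_matI) auto
    then show ?thesis unfolding * using 0 e L by simp
  next
    case (Suc j)
    have "e ^\<^sub>m j \<in> carrier_mat N N" using e by simp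
    then have "L * e ^\<^sub>m k = L * e * e ^\<^sub>m j"
      unfolding Suc pow_mat_Suc_left[OF e] using e L by (intro assoc_mult_mat[symmetric])
    then have "L * e ^\<^sub>m k = 0\<^sub>m d N" unfolding Le using e by simp
    moreover have "a 0 \<cdot>\<^sub>m L + a k \<cdot>\<^sub>m 0\<^sub>m d N = a 0 \<cdot>\<^sub>m L" using L by (intro eq_matI) auto
    ultimately show ?thesis unfolding * using Suc.IH Suc Suc.prems by simp
  qed
qed simp

text \<open>Positive powers of e die on both spaces, so only the scalar part and
  \<open>hat S\<close> act, the latter through \<open>L * K\<close>. Both actions are described by
  the same \<open>c\<close> and \<open>S\<close>, which later ties their determinants
  together.\<close>

lemma centraliser_K_L:
  assumes "x \<in> lie_centraliser e"
  obtains c S where "S \<in> carrier_mat d d" "x * K = K * (c \<cdot>\<^sub>m 1\<^sub>m d + S * trace_form d)"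
    "L * x = (c \<cdot>\<^sub>m 1\<^sub>m d + trace_form d * S) * L"
proof -
  obtain a where x: "x = pow_comb e a (n - 1) + hat (T x)"
    using decomp[OF assms] unfolding hat_def by blast
  define S where "S = T x"
  have S: "S \<in> carrier_mat d d" unfolding S_def using T_carrier centraliser_carrier assms by blast
  have P: "pow_comb e a (n - 1) \<in> carrier_mat N N" using e by simp
  have n1: "0 < n - 1" using n by simp
  have KS: "K * S \<in> carrier_mat N d" and SL: "S * L \<in> carrier_mat d N" using K L S by auto
  have J: "trace_form d \<in> (carrier_mat d d :: 'a mat set)" by simp
  have "x * K = pow_comb e a (n - 1) * K + hat S * K"
    unfolding S_def using add_mult_distrib_mat[OF P hat_carrier K] S x unfolding S_def by metis
  also have "pow_comb e a (n - 1) * K = K * (a 0 \<cdot>\<^sub>m 1\<^sub>m d)"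
    unfolding pow_comb_K[OF n1] using mult_smult_distrib[OF K, of "1\<^sub>m d" d "a 0"] K by simp
  also have "hat S * K = K * (S * trace_form d)"
    unfolding hat_def assoc_mult_mat[OF KS L K] LK by (rule assoc_mult_mat[OF K S J])
  also have "K * (a 0 \<cdot>\<^sub>m 1\<^sub>m d) + K * (S * trace_form d) = K * (a 0 \<cdot>\<^sub>m 1\<^sub>m d + S * trace_form d)"
    using S by (intro mult_add_distrib_mat[symmetric, OF K]) auto
  finally have 1: "x * K = K * (a 0 \<cdot>\<^sub>m 1\<^sub>m d + S * trace_form d)" .
  have "L * x = L * pow_comb e a (n - 1) + L * hat S"
    unfolding S_def using mult_add_distrib_mat[OF L P hat_carrier] S x unfolding S_def by metis
  also have "L * pow_comb e a (n - 1) = (a 0 \<cdot>\<^sub>m 1\<^sub>m d) * L"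
    unfolding L_pow_comb[OF n1] using mult_smult_assoc_mat[of "1\<^sub>m d" d d L N "a 0"] L by simp
  also have "L * hat S = trace_form d * S * L"
    unfolding hat_def assoc_mult_mat[OF K S L] assoc_mult_mat[OF L K SL, symmetric] LK
    by (rule assoc_mult_mat[OF J S L, symmetric])
  also have "(a 0 \<cdot>\<^sub>m 1\<^sub>m d) * L + trace_form d * S * L = (a 0 \<cdot>\<^sub>m 1\<^sub>m d + trace_form d * S) * L"
    using S by (intro add_mult_distrib_mat[symmetric, OF _ _ L]) auto
  finally have "L * x = (a 0 \<cdot>\<^sub>m 1\<^sub>m d + trace_form d * S) * L" .
  then show ?thesis using that S 1 by blast
qed

text \<open>Multiplying \<open>hat E\<close> by h on the left and g on the right turns it into hat
  (X E Y); passing to the adjoint for \<open>pairing\<close> gives the formula.\<close>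

lemma coord_coadjoint:
  assumes \<xi>: "\<xi> \<in> centraliser_dual e" and g: "g \<in> lie_centraliser e" and h: "h \<in> lie_centraliser e"
    and X: "X \<in> carrier_mat d d" "h * K = K * X" and Y: "Y \<in> carrier_mat d d" "L * g = Y * L"
  shows "coord (restrict (\<lambda>x. \<xi> (h * x * g)) (lie_centraliser e)) = X\<^sup>T * coord \<xi> * Y\<^sup>T"
proof (rule eq_matI)
  fix i j assume "i < dim_row (X\<^sup>T * coord \<xi> * Y\<^sup>T)" "j < dim_col (X\<^sup>T * coord \<xi> * Y\<^sup>T)"
  then have ij: "i < d" "j < d" using X Y by auto
  let ?E = "elem_mat d (i, j) :: 'a mat"
  have E: "?E \<in> carrier_mat d d" by simp
  note gc = centraliser_carrier[OF g] and hc = centraliser_carrier[OF h]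
  have KE: "K * ?E \<in> carrier_mat N d" using mult_carrier_mat[OF K E] .
  have "h * hat ?E * g = h * (K * ?E) * (L * g)"
    unfolding hat_def using assoc_mult_mat[OF hc KE L] assoc_mult_mat[OF mult_carrier_mat[OF hc KE] L gc]
    by simp
  also have "h * (K * ?E) = K * X * ?E" using assoc_mult_mat[OF hc K E] X by simp
  also have "\<dots> = K * (X * ?E)" by (rule assoc_mult_mat[OF K X(1) E])
  also have "K * (X * ?E) * (L * g) = K * (X * ?E) * Y * L"
    unfolding Y(2)
    by (rule assoc_mult_mat[symmetric, OF mult_carrier_mat[OF K mult_carrier_mat[OF X(1) E]] Y(1) L])
  also have "K * (X * ?E) * Y = K * (X * ?E * Y)"
    by (rule assoc_mult_mat[OF K mult_carrier_mat[OF X(1) E] Y(1)])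
  finally have "h * hat ?E * g = hat (X * ?E * Y)" unfolding hat_def .
  moreover have "coord (restrict (\<lambda>x. \<xi> (h * x * g)) (lie_centraliser e)) $$ (i, j) = \<xi> (h * hat ?E * g)"
    using ij hat_centraliser[OF E] by (simp add: coord_def)
  ultimately show "coord (restrict (\<lambda>x. \<xi> (h * x * g)) (lie_centraliser e)) $$ (i, j) =
      (X\<^sup>T * coord \<xi> * Y\<^sup>T) $$ (i, j)"
    by (simp only: pairing_coord[OF \<xi> mult_carrier_mat[OF mult_carrier_mat[OF X(1) E] Y(1)]]
      pairing_mult_elem_mat[OF coord_carrier X(1) Y(1) ij])
qed (use X Y in auto)

text \<open>Although \<open>K\<close> has no named left inverse, \<open>T\<close> recovers S from
  \<open>K * S * L\<close>.\<close>

lemma K_cancel: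
  assumes "S \<in> carrier_mat d d" "R \<in> carrier_mat d d" "K * S = K * R" shows "S = R"
  using assms T_KSL by metis

text \<open>A stabilising \<open>g\<close> acts on \<open>ker e\<close> by \<open>c + S J\<close> and on \<open>V / eV\<close> by \<open>c + J S\<close>, where \<open>J = L K\<close>.
  Since \<open>J\<close> is a coordinate projection, the two have the same determinant.\<close>

lemma det_one_plus_trace_form:
  fixes S :: "'a mat"
  assumes S: "S \<in> carrier_mat d d"
  shows "det (c \<cdot>\<^sub>m 1\<^sub>m d + trace_form d * S) = det (c \<cdot>\<^sub>m 1\<^sub>m d + S * trace_form d)"
proof -
  let ?A = "c \<cdot>\<^sub>m 1\<^sub>m d + trace_form d * S" and ?B = "c \<cdot>\<^sub>m 1\<^sub>m d + S * trace_form d"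
  have A: "?A \<in> carrier_mat d d" and B: "?B \<in> carrier_mat d d" using S by auto
  have "(trace_form d * S) $$ (i, j) = (if i = 0 then 0 else S $$ (i, j))" if ij: "i < d" "j < d" for i j
  proof -
    have "(trace_form d * S) $$ (i, j) = (\<Sum>k<d. trace_form d $$ (i, k) * S $$ (k, j))"
      by (rule index_mult_mat_sum[OF _ S ij]) simp
    also have "\<dots> = (\<Sum>k<d. if k = i then (if i = 0 then 0 else S $$ (i, j)) else 0)"
      using ij by (intro sum.cong) auto
    finally show ?thesis using ij by simp
  qed
  then have Aij: "?A $$ (i, j) = (if i = j then c else 0) + (if i = 0 then 0 else S $$ (i, j))"
    if "i < d" "j < d" for i j using that S by (auto simp del: index_mult_mat(1))
  have "(S * trace_form d) $$ (i, j) = (if j = 0 then 0 else S $$ (i, j))" if ij: "i < d" "j < d" for i j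
  proof -
    have "(S * trace_form d) $$ (i, j) = (\<Sum>k<d. S $$ (i, k) * trace_form d $$ (k, j))"
      by (rule index_mult_mat_sum[OF S _ ij]) simp
    also have "\<dots> = (\<Sum>k<d. if k = j then (if j = 0 then 0 else S $$ (i, j)) else 0)"
      using ij by (intro sum.cong) auto
    finally show ?thesis using ij by simp
  qed
  then have Bij: "?B $$ (i, j) = (if i = j then c else 0) + (if j = 0 then 0 else S $$ (i, j))"
    if "i < d" "j < d" for i j using that S by (auto simp del: index_mult_mat(1))
  \<comment> \<open>Row 0 of \<open>?A\<close> and column 0 of \<open>?B\<close> are both c times a
    unit vector. Expanding along them leaves the same minor, since J is the identity away from index
    0.\<close>
  have "mat_delete ?A 0 0 = mat_delete ?B 0 0"
  proof (rule eq_matI)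
    fix i j assume "i < dim_row (mat_delete ?B 0 0)" "j < dim_col (mat_delete ?B 0 0)"
    then have ij: "i < d - 1" "j < d - 1" using S by auto
    have "mat_delete ?A 0 0 $$ (i, j) = ?A $$ (Suc i, Suc j)"
      "mat_delete ?B 0 0 $$ (i, j) = ?B $$ (Suc i, Suc j)"
      using ij A B unfolding mat_delete_def by (auto simp del: index_add_mat index_mult_mat)
    then show "mat_delete ?A 0 0 $$ (i, j) = mat_delete ?B 0 0 $$ (i, j)"
      using ij by (simp add: Aij Bij del: index_add_mat index_mult_mat)
  qed (use S in auto)
  then have cof: "cofactor ?A 0 0 = cofactor ?B 0 0" by (simp add: cofactor_def)
  have "det ?A = (\<Sum>j<d. ?A $$ (0, j) * cofactor ?A 0 j)"
    by (rule laplace_expansion_row[OF A d])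
  also have "\<dots> = (\<Sum>j<d. if j = 0 then c * cofactor ?A 0 0 else 0)"
    using d by (intro sum.cong) (auto simp: Aij simp del: index_add_mat index_mult_mat)
  also have "\<dots> = c * cofactor ?B 0 0" using d cof by simp
  also have "\<dots> = (\<Sum>j<d. if j = 0 then c * cofactor ?B 0 0 else 0)"
    using d by simp
  also have "\<dots> = (\<Sum>j<d. ?B $$ (j, 0) * cofactor ?B j 0)"
    using d by (intro sum.cong) (auto simp: Bij simp del: index_add_mat index_mult_mat)
  also have "\<dots> = det ?B"
    by (rule laplace_expansion_column[OF B d, symmetric])
  finally show ?thesis .
qed

lemma transpose_trace_form: "(trace_form d)\<^sup>T = trace_form d"
  by (intro eq_matI) auto

text \<open>Let Z and X be the actions of g and h on ker e, and Y that of g on V / eV. Then Z X = 1,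
  and Y J = J Z because both express L g K. So Y J X = J, whose transpose says that J is fixed, and
  det Y = det Z is inverse to det X.\<close>

lemma det_pencil_coadjoint:
  assumes \<xi>: "\<xi> \<in> centraliser_dual e" and g: "g \<in> group_stabiliser e"
  shows "det (s \<cdot>\<^sub>m coord (coadjoint e g \<xi>) - trace_form d) = det (s \<cdot>\<^sub>m coord \<xi> - trace_form d)"
proof -
  obtain h where gh: "g \<in> lie_centraliser e" "h \<in> lie_centraliser e" "g * h = 1\<^sub>m N"
    and co: "coadjoint e g \<xi> = restrict (\<lambda>x. \<xi> (h * x * g)) (lie_centraliser e)"
    using group_stabiliserE[OF e g] by metis
  note gc = centraliser_carrier[OF gh(1)] and hc = centraliser_carrier[OF gh(2)]
  obtain a S where S: "S \<in> carrier_mat d d" and gK: "g * K = K * (a \<cdot>\<^sub>m 1\<^sub>m d + S * trace_form d)"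
    and Lg: "L * g = (a \<cdot>\<^sub>m 1\<^sub>m d + trace_form d * S) * L"
    using centraliser_K_L[OF gh(1)] by metis
  obtain b R where R: "R \<in> carrier_mat d d" and hK: "h * K = K * (b \<cdot>\<^sub>m 1\<^sub>m d + R * trace_form d)"
    using centraliser_K_L[OF gh(2)] by metis
  define X where "X = b \<cdot>\<^sub>m 1\<^sub>m d + R * trace_form d"
  define Z where "Z = a \<cdot>\<^sub>m 1\<^sub>m d + S * trace_form d"
  define Y where "Y = a \<cdot>\<^sub>m 1\<^sub>m d + trace_form d * S"
  define J :: "'a mat" where "J = trace_form d"
  have c: "X \<in> carrier_mat d d" "Y \<in> carrier_mat d d" "Z \<in> carrier_mat d d" "J \<in> carrier_mat d d"
    using R S by (auto simp: X_def Y_def Z_def J_def)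
  have KZX: "K * (Z * X) = K * 1\<^sub>m d"
  proof -
    have "K * (Z * X) = g * K * X"
      using assoc_mult_mat[OF K c(3,1)] gK by (simp add: Z_def)
    also have "\<dots> = g * (h * K)"
      using assoc_mult_mat[OF gc K c(1)] hK by (simp add: X_def)
    also have "\<dots> = K" using assoc_mult_mat[OF gc hc K] gh(3) K by simp
    finally show ?thesis using K by simp
  qed
  have ZX: "Z * X = 1\<^sub>m d"
    by (rule K_cancel[OF mult_carrier_mat[OF c(3,1)] one_carrier_mat KZX])
  have "Y * J = J * Z"
  proof -
    have "Y * J = a \<cdot>\<^sub>m 1\<^sub>m d * J + J * S * J"
      unfolding Y_def J_def using S by (intro add_mult_distrib_mat[of _ d d]) auto
    also have "a \<cdot>\<^sub>m 1\<^sub>m d * J = J * (a \<cdot>\<^sub>m 1\<^sub>m d)"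
      using mult_smult_assoc_mat[of "1\<^sub>m d" d d J d a] mult_smult_distrib[OF c(4), of "1\<^sub>m d" d a] c(4) by simp
    also have "J * S * J = J * (S * J)" by (rule assoc_mult_mat[OF c(4) S c(4)])
    also have "J * (a \<cdot>\<^sub>m 1\<^sub>m d) + J * (S * J) = J * Z"
      unfolding Z_def J_def[symmetric] using S c by (intro mult_add_distrib_mat[symmetric, of _ d d]) auto
    finally show ?thesis .
  qed
  then have YJX: "Y * J * X = J"
    using assoc_mult_mat[OF c(4,3,1)] ZX right_mult_one_mat[OF c(4)] by simp
  have JT: "J\<^sup>T = J" unfolding J_def by (rule transpose_trace_form)
  have XJY: "X\<^sup>T * J * Y\<^sup>T = J"
  proof -
    have "(Y * J * X)\<^sup>T = X\<^sup>T * (Y * J)\<^sup>T"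
      by (rule transpose_mult[OF mult_carrier_mat[OF c(2,4)] c(1)])
    also have "(Y * J)\<^sup>T = J\<^sup>T * Y\<^sup>T" by (rule transpose_mult[OF c(2,4)])
    also have "J\<^sup>T = J" by (rule JT)
    also have "X\<^sup>T * (J * Y\<^sup>T) = X\<^sup>T * J * Y\<^sup>T"
      using c by (intro assoc_mult_mat[symmetric, of _ d d _ d _ d]) auto
    finally show ?thesis unfolding YJX JT by (rule sym)
  qed
  have dets: "det X * det Y = 1"
  proof -
    have "det Y = det Z" unfolding Y_def Z_def by (rule det_one_plus_trace_form[OF S])
    then show ?thesis using det_mult[OF c(3,1)] ZX by (simp add: mult.commute)
  qed
  define M where "M = coord \<xi>"
  have M: "M \<in> carrier_mat d d" "s \<cdot>\<^sub>m M \<in> carrier_mat d d" by (simp_all add: M_def)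
  have XT: "X\<^sup>T \<in> carrier_mat d d" and YT: "Y\<^sup>T \<in> carrier_mat d d" using c by auto
  have "coord (coadjoint e g \<xi>) = X\<^sup>T * M * Y\<^sup>T"
    unfolding co M_def by (rule coord_coadjoint[OF \<xi> gh(1,2)]) (use c hK Lg in \<open>auto simp: X_def Y_def\<close>)
  then have "s \<cdot>\<^sub>m coord (coadjoint e g \<xi>) - J = s \<cdot>\<^sub>m (X\<^sup>T * M * Y\<^sup>T) - X\<^sup>T * J * Y\<^sup>T"
    using XJY by simp
  also have "s \<cdot>\<^sub>m (X\<^sup>T * M * Y\<^sup>T) = X\<^sup>T * (s \<cdot>\<^sub>m M) * Y\<^sup>T"
    using mult_smult_distrib[OF XT M(1)] mult_smult_assoc_mat[OF mult_carrier_mat[OF XT M(1)] YT] by simp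
  also have "X\<^sup>T * (s \<cdot>\<^sub>m M) * Y\<^sup>T - X\<^sup>T * J * Y\<^sup>T = (X\<^sup>T * (s \<cdot>\<^sub>m M) - X\<^sup>T * J) * Y\<^sup>T"
    by (rule minus_mult_distrib_mat[symmetric, OF mult_carrier_mat[OF XT M(2)] mult_carrier_mat[OF XT c(4)] YT])
  also have "X\<^sup>T * (s \<cdot>\<^sub>m M) - X\<^sup>T * J = X\<^sup>T * (s \<cdot>\<^sub>m M - J)"
    by (rule mult_minus_distrib_mat[symmetric, OF XT M(2) c(4)])
  finally have "det (s \<cdot>\<^sub>m coord (coadjoint e g \<xi>) - J) = det (X\<^sup>T * (s \<cdot>\<^sub>m M - J) * Y\<^sup>T)" by simp
  also have "\<dots> = det X * det (s \<cdot>\<^sub>m M - J) * det Y"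
    using c by (simp add: det_mult[of _ d] det_transpose[of _ d] minus_carrier_mat)
  also have "\<dots> = det (s \<cdot>\<^sub>m M - J)" using dets by (simp add: mult.commute mult.left_commute)
  finally show ?thesis by (simp add: J_def M_def)
qed

text \<open>The product of \<open>hat S\<close> and \<open>hat R\<close> is hat (S J R), so the
  condition \<open>SR\<close> says exactly that 1 + hat R is inverse to 1 + hat S. Suitable choices
  of S and R yield all the symmetries used below.\<close>

lemma coadjoint_one_plus_hat:
  assumes S: "S \<in> carrier_mat d d" and R: "R \<in> carrier_mat d d"
    and SR: "S + R + S * trace_form d * R = 0\<^sub>m d d"
  shows "1\<^sub>m N + hat S \<in> group_stabiliser e"
    and "M \<in> carrier_mat d d \<Longrightarrow> coadjoint e (1\<^sub>m N + hat S) (form M) =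
      form ((1\<^sub>m d + R * trace_form d)\<^sup>T * M * (1\<^sub>m d + trace_form d * S)\<^sup>T)"
proof -
  let ?g = "1\<^sub>m N + hat S" and ?h = "1\<^sub>m N + hat R"
  define J :: "'a mat" where "J = trace_form d"
  have J: "J \<in> carrier_mat d d" by (simp add: J_def)
  have one: "1\<^sub>m N \<in> lie_centraliser e" using e by (simp add: lie_centraliser_iff[OF e])
  have g: "?g \<in> lie_centraliser e" and h: "?h \<in> lie_centraliser e"
    using lie_centraliser_add[OF e one] hat_centraliser S R by auto
  note gc = centraliser_carrier[OF g] and hc = centraliser_carrier[OF h]
  note Sc = hat_carrier[OF S] and Rc = hat_carrier[OF R]
  have KS: "K * S \<in> carrier_mat N d" and RL: "R * L \<in> carrier_mat d N" and KR: "K * R \<in> carrier_mat N d"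
    using K L S R by auto
  have "hat S * hat R = K * S * (L * hat R)"
    unfolding hat_def[of S] by (rule assoc_mult_mat[OF KS L Rc])
  also have "L * hat R = J * (R * L)"
    unfolding hat_def assoc_mult_mat[OF K R L] assoc_mult_mat[OF L K RL, symmetric] LK J_def ..
  also have "K * S * (J * (R * L)) = K * S * J * (R * L)"
    by (rule assoc_mult_mat[OF KS J RL, symmetric])
  also have "\<dots> = K * (S * J) * (R * L)" using assoc_mult_mat[OF K S J] by simp
  also have "\<dots> = K * (S * J) * R * L"
    by (rule assoc_mult_mat[symmetric, OF mult_carrier_mat[OF K mult_carrier_mat[OF S J]] R L])
  also have "K * (S * J) * R = K * (S * J * R)"
    by (rule assoc_mult_mat[OF K mult_carrier_mat[OF S J] R])
  finally have hh: "hat S * hat R = hat (S * J * R)" by (simp add: hat_def)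
  have SJR: "S * J * R \<in> carrier_mat d d" using S J R by simp
  have "?g * ?h = 1\<^sub>m N * ?h + hat S * ?h"
    by (rule add_mult_distrib_mat[OF _ Sc hc]) simp
  also have "1\<^sub>m N * ?h = ?h" by (rule left_mult_one_mat[OF hc])
  also have "hat S * ?h = hat S * 1\<^sub>m N + hat S * hat R"
    by (rule mult_add_distrib_mat[OF Sc _ Rc]) simp
  also have "hat S * 1\<^sub>m N = hat S" by (rule right_mult_one_mat[OF Sc])
  also have "?h + (hat S + hat S * hat R) = 1\<^sub>m N + (hat S + hat R + hat (S * J * R))"
    unfolding hh using Sc Rc hat_carrier[OF SJR] by (intro eq_matI) auto
  also have "hat S + hat R + hat (S * J * R) = hat (S + R + S * J * R)"
    using hat_add[OF S R] hat_add[OF add_carrier_mat[OF R] SJR, of S] by simp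
  also have "S + R + S * J * R = 0\<^sub>m d d" using SR by (simp add: J_def)
  finally have gh: "?g * ?h = 1\<^sub>m N" by (simp add: hat_zero)
  have hg: "?h * ?g = 1\<^sub>m N" by (rule mat_mult_left_right_inverse[OF gc hc gh])
  note stab = group_stabiliserI[OF e g hc gh hg]
  show "?g \<in> group_stabiliser e" by (rule stab(1))
  assume M: "M \<in> carrier_mat d d"
  let ?X = "1\<^sub>m d + R * trace_form d" and ?Y = "1\<^sub>m d + trace_form d * S"
  have "?h * K = 1\<^sub>m N * K + hat R * K" by (rule add_mult_distrib_mat[OF _ Rc K]) simp
  also have "hat R * K = K * (R * J)"
    unfolding hat_def assoc_mult_mat[OF KR L K] LK J_def[symmetric] by (rule assoc_mult_mat[OF K R J])
  also have "1\<^sub>m N * K = K * 1\<^sub>m d" using K by simp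
  also have "K * 1\<^sub>m d + K * (R * J) = K * (1\<^sub>m d + R * J)"
    using R J by (intro mult_add_distrib_mat[symmetric, OF K]) auto
  finally have X: "?h * K = K * ?X" by (simp add: J_def)
  have SL: "S * L \<in> carrier_mat d N" using S L by simp
  have "L * ?g = L * 1\<^sub>m N + L * hat S" by (rule mult_add_distrib_mat[OF L _ Sc]) simp
  also have "L * hat S = J * S * L"
    unfolding hat_def assoc_mult_mat[OF K S L] assoc_mult_mat[OF L K SL, symmetric] LK J_def[symmetric]
    by (rule assoc_mult_mat[OF J S L, symmetric])
  also have "L * 1\<^sub>m N = 1\<^sub>m d * L" using L by simp
  also have "1\<^sub>m d * L + J * S * L = (1\<^sub>m d + J * S) * L"
    using S J by (intro add_mult_distrib_mat[symmetric, OF _ _ L]) auto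
  finally have Y: "L * ?g = ?Y * L" by (simp add: J_def)
  have "coord (coadjoint e ?g (form M)) = ?X\<^sup>T * coord (form M) * ?Y\<^sup>T"
    unfolding stab(2) by (rule coord_coadjoint[OF form_dual g h _ X _ Y]) (use S R in auto)
  \<comment> \<open>The action does not change values on powers of e, so the image still vanishes on
    the low powers and is determined by its matrix.\<close>
  moreover have "form (coord (coadjoint e ?g (form M))) = coadjoint e ?g (form M)"
    by (rule form_coord[OF coadjoint_dual[OF e stab(1) form_dual]])
      (simp add: coadjoint_pow[OF e stab(1)] form_pow)
  ultimately show "coadjoint e ?g (form M) = form (?X\<^sup>T * M * ?Y\<^sup>T)"
    by (simp add: coord_form[OF M])
qed

end

subsection \<open>Polynomial functions on the dual\<close>

lemma sym_algebra_sum: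
  "(\<And>i. i \<in> S \<Longrightarrow> f i \<in> sym_algebra e) \<Longrightarrow> (\<lambda>\<xi>. \<Sum>i\<in>S. f i \<xi>) \<in> sym_algebra e"
  by (induction S rule: infinite_finite_induct) (auto intro: sym_algebra.intros)

lemma sym_algebra_prod:
  "(\<And>i. i \<in> S \<Longrightarrow> f i \<in> sym_algebra e) \<Longrightarrow> (\<lambda>\<xi>. \<Prod>i\<in>S. f i \<xi>) \<in> sym_algebra e"
  by (induction S rule: infinite_finite_induct) (auto intro: sym_algebra.intros)

lemma sym_algebra_det:
  assumes "\<And>i j. i < k \<Longrightarrow> j < k \<Longrightarrow> f i j \<in> sym_algebra e"
  shows "(\<lambda>\<xi>. det (mat k k (\<lambda>(i, j). f i j \<xi>))) \<in> sym_algebra e"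
proof -
  have "(\<lambda>\<xi>. \<Sum>p\<in>{p. p permutes {0..<k}}. signof p * (\<Prod>i = 0..<k. f i (p i) \<xi>)) \<in> sym_algebra e"
    using assms by (intro sym_algebra_sum sym_algebra.mult sym_algebra.const sym_algebra_prod) auto
  moreover have "det (mat k k (\<lambda>(i, j). f i j \<xi>)) =
      (\<Sum>p\<in>{p. p permutes {0..<k}}. signof p * (\<Prod>i = 0..<k. f i (p i) \<xi>))" for \<xi>
    by (subst det_def'[of _ k]) (auto intro!: sum.cong prod.cong)
  ultimately show ?thesis by simp
qed

lemma sym_algebra_pow_mat:
  assumes A: "\<And>\<xi>. A \<xi> \<in> carrier_mat d d"
    and "\<And>i j. i < d \<Longrightarrow> j < d \<Longrightarrow> (\<lambda>\<xi>. A \<xi> $$ (i, j)) \<in> sym_algebra e"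
    and ij: "i < d" "j < d"
  shows "(\<lambda>\<xi>. (A \<xi> ^\<^sub>m k) $$ (i, j)) \<in> sym_algebra e"
  using ij
proof (induction k arbitrary: i j)
  case 0
  have "(A \<xi> ^\<^sub>m 0) $$ (i, j) = (if i = j then 1 else 0)" for \<xi>
    using 0 A[of \<xi>] by simp
  moreover have "(\<lambda>_. if i = j then 1 else 0) \<in> sym_algebra e" by (rule sym_algebra.const)
  ultimately show ?case by simp
next
  case (Suc k)
  have "(A \<xi> ^\<^sub>m Suc k) $$ (i, j) = (\<Sum>l<d. (A \<xi> ^\<^sub>m k) $$ (i, l) * A \<xi> $$ (l, j))" for \<xi>
    unfolding pow_mat.simps
    by (rule index_mult_mat_sum[OF pow_carrier_mat[OF A] A Suc.prems])
  moreover have "(\<lambda>\<xi>. \<Sum>l<d. (A \<xi> ^\<^sub>m k) $$ (i, l) * A \<xi> $$ (l, j)) \<in> sym_algebra e"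
    using Suc assms(2) by (intro sym_algebra_sum sym_algebra.mult) auto
  ultimately show ?case by simp
qed

lemma sym_invariantsD:
  "f \<in> sym_invariants e \<Longrightarrow> f \<in> sym_algebra e"
  "f \<in> sym_invariants e \<Longrightarrow> g \<in> group_stabiliser e \<Longrightarrow> \<xi> \<in> centraliser_dual e \<Longrightarrow>
   f (coadjoint e g \<xi>) = f \<xi>"
  by (auto simp: sym_invariants_def)

lemma homogeneous_scale: "homogeneous e k f \<Longrightarrow> homogeneous e k (\<lambda>\<xi>. c * f \<xi>)"
proof (induction rule: homogeneous.induct)
  case (const a)
  show ?case by (rule homogeneous.const)
next
  case (mult x k f)
  from homogeneous.mult[OF mult(1,3)] show ?case by (simp add: mult.left_commute)
next
  case (add k f h)
  from homogeneous.add[OF add(3,4)] show ?case by (simp add: distrib_left)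
qed

text \<open>The zero function is homogeneous of every degree: multiply by the evaluation at the zero
  matrix.\<close>

lemma homogeneous_zero:
  assumes e: "e \<in> carrier_mat N N" shows "homogeneous e k (\<lambda>_. 0)"
proof (induction k)
  case 0
  show ?case by (rule homogeneous.const)
next
  case (Suc k)
  from homogeneous.mult[OF lie_centraliser_zero[OF e] Suc] show ?case by simp
qed

lemma homogeneous_sum:
  assumes e: "e \<in> carrier_mat N N" and "\<And>i. i \<in> S \<Longrightarrow> homogeneous e k (f i)"
  shows "homogeneous e k (\<lambda>\<xi>. \<Sum>i\<in>S. f i \<xi>)"
  using assms(2)
  by (induction S rule: infinite_finite_induct) (auto intro: homogeneous_zero[OF e] homogeneous.add)

text \<open>In each factor the variable is attached to the evaluation of \<xi> and the constant term
  is free of \<xi>, so the degree in the variable counts the degree in \<xi>.\<close>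

lemma homogeneous_coeff_linear_prod:
  fixes e :: "'a::field mat" and x :: "nat \<Rightarrow> 'a mat"
  assumes e: "e \<in> carrier_mat N N" and x: "\<And>i. i < l \<Longrightarrow> x i \<in> lie_centraliser e"
  shows "homogeneous e k (\<lambda>\<xi>. coeff (\<Prod>i = 0..<l. [:b i, \<xi> (x i):]) k)"
  using x
proof (induction l arbitrary: k)
  case 0
  show ?case using homogeneous_zero[OF e, of k] homogeneous.const[of e 1] by (cases k) auto
next
  case (Suc l)
  have hom: "homogeneous e j (\<lambda>\<xi>. coeff (\<Prod>i = 0..<l. [:b i, \<xi> (x i):]) j)" for j
    by (rule Suc.IH) (use Suc.prems in auto)
  have step: "coeff (\<Prod>i = 0..<Suc l. [:b i, \<xi> (x i):]) k =
      b l * coeff (\<Prod>i = 0..<l. [:b i, \<xi> (x i):]) k +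
      (case k of 0 \<Rightarrow> 0 | Suc j \<Rightarrow> \<xi> (x l) * coeff (\<Prod>i = 0..<l. [:b i, \<xi> (x i):]) j)" for \<xi>
    by (simp add: coeff_pCons mult.commute split: nat.split)
  show ?case
  proof (cases k)
    case 0
    then show ?thesis unfolding step using homogeneous_scale[OF hom[of 0], where c = "b l"] by simp
  next
    case (Suc j)
    have "x l \<in> lie_centraliser e" using Suc.prems by simp
    from homogeneous.add[OF homogeneous_scale[OF hom[of "Suc j"], where c = "b l"] homogeneous.mult[OF this hom[of j]]]
    show ?thesis unfolding step using Suc by simp
  qed
qed

lemma homogeneous_coeff_pencil:
  assumes e: "e \<in> carrier_mat N N" and x: "\<And>i j. i < d \<Longrightarrow> j < d \<Longrightarrow> x i j \<in> lie_centraliser e"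
  shows "homogeneous e k (\<lambda>\<xi>. coeff (det (mat d d (\<lambda>(i, j). [:b i j, \<xi> (x i j):]))) k)"
proof -
  have sg: "coeff (signof p * q) k = signof p * coeff q k" for p :: "nat \<Rightarrow> nat" and q :: "'a poly"
    by (simp add: sign_def)
  have "coeff (det (mat d d (\<lambda>(i, j). [:b i j, \<xi> (x i j):]))) k =
      (\<Sum>p\<in>{p. p permutes {0..<d}}. signof p * coeff (\<Prod>i = 0..<d. [:b i (p i), \<xi> (x i (p i)):]) k)" for \<xi>
  proof -
    have "det (mat d d (\<lambda>(i, j). [:b i j, \<xi> (x i j):])) =
        (\<Sum>p\<in>{p. p permutes {0..<d}}. signof p * (\<Prod>i = 0..<d. [:b i (p i), \<xi> (x i (p i)):]))"
      by (subst det_def'[of _ d]) (auto intro!: sum.cong prod.cong)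
    then show ?thesis by (simp add: coeff_sum sg)
  qed
  moreover have "homogeneous e k (\<lambda>\<xi>. \<Sum>p\<in>{p. p permutes {0..<d}}.
      signof p * coeff (\<Prod>i = 0..<d. [:b i (p i), \<xi> (x i (p i)):]) k)"
    by (intro homogeneous_sum[OF e] homogeneous_scale homogeneous_coeff_linear_prod[OF e] x) auto
  ultimately show ?thesis by simp
qed

lemma poly_det:
  fixes A :: "'a::comm_ring_1 poly mat"
  assumes "A \<in> carrier_mat d d"
  shows "poly (det A) s = det (map_mat (\<lambda>p. poly p s) A)"
proof -
  have sg: "poly (signof p) s = signof p" for p :: "nat \<Rightarrow> nat"
    by (simp add: sign_def)
  have "poly (det A) s = (\<Sum>p\<in>{p. p permutes {0..<d}}. signof p * (\<Prod>i = 0..<d. poly (A $$ (i, p i)) s))"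
    by (simp add: det_def'[OF assms] poly_sum poly_prod sg)
  also have "\<dots> = det (map_mat (\<lambda>p. poly p s) A)"
    by (subst det_def'[of _ d]) (use assms in \<open>auto intro!: sum.cong prod.cong\<close>)
  finally show ?thesis .
qed

lemma homogeneous_at_zero:
  assumes "homogeneous e k f" "0 < k" "\<And>x. x \<in> lie_centraliser e \<Longrightarrow> \<xi> x = 0"
  shows "f \<xi> = 0"
  using assms by (induction rule: homogeneous.induct) auto

subsection \<open>The null-cone\<close>

context hook_coords
begin

definition flag_orbit :: "nat \<Rightarrow> ('a mat \<Rightarrow> 'a) set" where
  "flag_orbit r = {form (g * F * h) | g F h. g \<in> bordered d \<and> h \<in> bordered d \<and>
     g * h = 1\<^sub>m d \<and> h * g = 1\<^sub>m d \<and> F \<in> flag_mats d r}"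

lemma flag_orbitI:
  "g \<in> bordered d \<Longrightarrow> h \<in> bordered d \<Longrightarrow> g * h = 1\<^sub>m d \<Longrightarrow> h * g = 1\<^sub>m d \<Longrightarrow> F \<in> flag_mats d r \<Longrightarrow>
   form (g * F * h) \<in> flag_orbit r"
  unfolding flag_orbit_def by blast

lemma flag_mats_carrier: "F \<in> flag_mats d r \<Longrightarrow> F \<in> carrier_mat d d"
  by (simp add: flag_mats_def)

section \<open>Symmetries of an invariant along \<open>form\<close>\<close>

lemma polyfun_form:
  assumes f: "f \<in> sym_algebra e" and M: "polymat d d M"
  shows "polyfun (\<lambda>t. f (form (M t)))"
  using f
proof (induction rule: sym_algebra.induct)
  case (eval x)
  have "form (M t) x = (\<Sum>p\<in>{..<d} \<times> {..<d}. M t $$ p * T x $$ p)" for t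
    using eval by (simp add: form_def pairing_def)
  moreover have "polyfun (\<lambda>t. \<Sum>p\<in>{..<d} \<times> {..<d}. M t $$ p * T x $$ p)"
    using polymatD(2)[OF M] by (intro polyfun_sum polyfun_mult polyfun_const) auto
  ultimately show ?case by simp
qed auto

text \<open>Take S = h^T - 1 and R = g^T - 1. Both have zero row and column 0, so J acts on them as
  the identity; the condition for inverses becomes h^T g^T = 1, and the two factors of the action
  become g and h.\<close>

lemma invariant_conj:
  assumes f: "f \<in> sym_invariants e" and M: "M \<in> carrier_mat d d"
    and g: "g \<in> bordered d" and h: "h \<in> bordered d" and gh: "g * h = 1\<^sub>m d" and hg: "h * g = 1\<^sub>m d"
  shows "f (form (g * M * h)) = f (form M)"
proof -
  note gc = borderedD(1)[OF g] and hc = borderedD(1)[OF h]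
  define S where "S = h\<^sup>T - 1\<^sub>m d"
  define R where "R = g\<^sup>T - 1\<^sub>m d"
  have c: "S \<in> carrier_mat d d" "R \<in> carrier_mat d d" unfolding S_def R_def by (auto simp: minus_carrier_mat)
  have SJ: "S * trace_form d = S" and JS: "trace_form d * S = S" and RJ: "R * trace_form d = R"
  proof -
    have 0: "S $$ (i, 0) = 0" "S $$ (0, i) = 0" "R $$ (i, 0) = 0" if "i < d" for i
      using that d gc hc borderedD(2,3)[OF g that] borderedD(2,3)[OF h that]
      by (auto simp: S_def R_def split: if_splits)
    have right: "A * trace_form d = A" if A: "A \<in> carrier_mat d d" "\<And>i. i < d \<Longrightarrow> A $$ (i, 0) = 0"
      for A :: "'a mat"
    proof (rule eq_matI)
      fix i j assume "i < dim_row A" "j < dim_col A"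
      then have ij: "i < d" "j < d" using A by auto
      have "(A * trace_form d) $$ (i, j) = (\<Sum>k<d. A $$ (i, k) * trace_form d $$ (k, j))"
        by (rule index_mult_mat_sum[OF A(1) trace_form_carrier ij])
      also have "\<dots> = (\<Sum>k<d. if k = j then A $$ (i, j) else 0)"
        using ij A by (intro sum.cong) auto
      finally show "(A * trace_form d) $$ (i, j) = A $$ (i, j)" using ij by simp
    qed (use A in auto)
    show "S * trace_form d = S" "R * trace_form d = R" using right c 0 by auto
    have ST: "S\<^sup>T * trace_form d = S\<^sup>T" by (rule right) (use c 0 d in auto)
    have "trace_form d * S = (S\<^sup>T * trace_form d)\<^sup>T"
      using transpose_mult[of "S\<^sup>T" d d "trace_form d" d] c by (simp add: transpose_trace_form)
    then show "trace_form d * S = S" unfolding ST by simp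
  qed
  have id: "1\<^sub>m d + S = h\<^sup>T" "1\<^sub>m d + R = g\<^sup>T"
    using gc hc unfolding S_def R_def by (auto intro!: eq_matI)
  have "h\<^sup>T * g\<^sup>T = 1\<^sub>m d" using transpose_mult[OF gc hc] gh by simp
  then have "(1\<^sub>m d + S) * (1\<^sub>m d + R) = 1\<^sub>m d" unfolding id .
  moreover have "(1\<^sub>m d + S) * (1\<^sub>m d + R) = 1\<^sub>m d * (1\<^sub>m d + R) + S * (1\<^sub>m d + R)"
    using c by (intro add_mult_distrib_mat[of _ d d]) auto
  moreover have "S * (1\<^sub>m d + R) = S * 1\<^sub>m d + S * R"
    using c by (intro mult_add_distrib_mat[of _ d d]) auto
  ultimately have one: "1\<^sub>m d + R + (S + S * R) = 1\<^sub>m d" using c by simp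
  have "S + R + S * R = 0\<^sub>m d d"
  proof (rule eq_matI)
    fix i j assume "i < dim_row (0\<^sub>m d d)" "j < dim_col (0\<^sub>m d d)"
    then have ij: "i < d" "j < d" by auto
    have "(1\<^sub>m d + R + (S + S * R)) $$ (i, j) = 1\<^sub>m d $$ (i, j)" unfolding one ..
    then show "(S + R + S * R) $$ (i, j) = 0\<^sub>m d d $$ (i, j)"
      using ij c by (simp add: algebra_simps del: index_mult_mat(1))
  qed (use c in auto)
  then have SR: "S + R + S * trace_form d * R = 0\<^sub>m d d" unfolding SJ .
  note act = coadjoint_one_plus_hat[OF c SR]
  have "coadjoint e (1\<^sub>m N + hat S) (form M) = form (g * M * h)"
    unfolding act(2)[OF M] RJ JS id by simp
  then show ?thesis using sym_invariantsD(2)[OF f act(1) form_dual, of M] by simp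
qed

text \<open>S is supported in column 0, which J kills from the right: S J = 0, so
  \<open>hat S\<close> squares to zero and R = - S. The left factor of the action is trivial, and
  only the right factor (1 + S)^T remains.\<close>

lemma invariant_addcol:
  assumes f: "f \<in> sym_invariants e" and M: "M \<in> carrier_mat d d" and k: "0 < k" "k < d"
  shows "f (form (addcol c k 0 M)) = f (form M)"
proof -
  define S where "S = mat d d (\<lambda>p. if p = (k, 0) then c else 0)"
  have S: "S \<in> carrier_mat d d" by (simp add: S_def)
  have JS: "trace_form d * S = S"
  proof (rule eq_matI)
    fix i j assume "i < dim_row S" "j < dim_col S"
    then have ij: "i < d" "j < d" by (auto simp: S_def)
    have "(trace_form d * S) $$ (i, j) = (\<Sum>l<d. trace_form d $$ (i, l) * S $$ (l, j))"
      by (rule index_mult_mat_sum[OF trace_form_carrier S ij])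
    also have "\<dots> = (\<Sum>l<d. if l = i then S $$ (i, j) else 0)"
      using ij k by (intro sum.cong) (auto simp: S_def)
    finally show "(trace_form d * S) $$ (i, j) = S $$ (i, j)" using ij by simp
  qed (use S in auto)
  have SJ: "S * trace_form d = 0\<^sub>m d d"
  proof (rule eq_matI)
    fix i j assume "i < dim_row (0\<^sub>m d d)" "j < dim_col (0\<^sub>m d d)"
    then have ij: "i < d" "j < d" by auto
    have "(S * trace_form d) $$ (i, j) = (\<Sum>l<d. S $$ (i, l) * trace_form d $$ (l, j))"
      by (rule index_mult_mat_sum[OF S trace_form_carrier ij])
    also have "\<dots> = 0"
      using ij k by (intro sum.neutral) (auto simp: S_def)
    finally show "(S * trace_form d) $$ (i, j) = 0\<^sub>m d d $$ (i, j)" using ij by simp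
  qed (use S in auto)
  have R: "- S \<in> carrier_mat d d" using S by simp
  have RJ: "- S * trace_form d = 0\<^sub>m d d"
    using S uminus_mult_left_mat[of S "trace_form d"] unfolding SJ by (auto intro!: eq_matI)
  have "S + - S + S * trace_form d * - S = 0\<^sub>m d d"
    unfolding SJ using S by (intro eq_matI) auto
  note act = coadjoint_one_plus_hat[OF S R this]
  have X: "(1\<^sub>m d + - S * trace_form d)\<^sup>T = 1\<^sub>m d" unfolding RJ by simp
  have "(1\<^sub>m d + S)\<^sup>T = addrow_mat d c 0 k"
    using k by (intro eq_matI) (auto simp: S_def)
  then have "coadjoint e (1\<^sub>m N + hat S) (form M) = form (M * addrow_mat d c 0 k)"
    unfolding act(2)[OF M] X JS using M by simp
  also have "M * addrow_mat d c 0 k = addcol c k 0 M"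
    using addcol_mat[OF M d] by simp
  finally show ?thesis using sym_invariantsD(2)[OF f act(1) form_dual, of M] by simp
qed

text \<open>The mirror image: R is supported in row 0, so J R = 0 and S = - R. Now the right factor
  is trivial and the left one is (1 + R)^T.\<close>

lemma invariant_addrow:
  assumes f: "f \<in> sym_invariants e" and M: "M \<in> carrier_mat d d" and k: "0 < k" "k < d"
  shows "f (form (addrow c k 0 M)) = f (form M)"
proof -
  define R where "R = mat d d (\<lambda>p. if p = (0, k) then c else 0)"
  have R: "R \<in> carrier_mat d d" by (simp add: R_def)
  have RJ: "R * trace_form d = R"
  proof (rule eq_matI)
    fix i j assume "i < dim_row R" "j < dim_col R"
    then have ij: "i < d" "j < d" by (auto simp: R_def)
    have "(R * trace_form d) $$ (i, j) = (\<Sum>l<d. R $$ (i, l) * trace_form d $$ (l, j))"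
      by (rule index_mult_mat_sum[OF R trace_form_carrier ij])
    also have "\<dots> = (\<Sum>l<d. if l = j then R $$ (i, j) else 0)"
      using ij k by (intro sum.cong) (auto simp: R_def)
    finally show "(R * trace_form d) $$ (i, j) = R $$ (i, j)" using ij by simp
  qed (use R in auto)
  have JR: "trace_form d * R = 0\<^sub>m d d"
  proof (rule eq_matI)
    fix i j assume "i < dim_row (0\<^sub>m d d)" "j < dim_col (0\<^sub>m d d)"
    then have ij: "i < d" "j < d" by auto
    have "(trace_form d * R) $$ (i, j) = (\<Sum>l<d. trace_form d $$ (i, l) * R $$ (l, j))"
      by (rule index_mult_mat_sum[OF trace_form_carrier R ij])
    also have "\<dots> = 0"
      using ij k by (intro sum.neutral) (auto simp: R_def)
    finally show "(trace_form d * R) $$ (i, j) = 0\<^sub>m d d $$ (i, j)" using ij by simp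
  qed (use R in auto)
  have S: "- R \<in> carrier_mat d d" using R by simp
  have JS: "trace_form d * - R = 0\<^sub>m d d"
    using R uminus_mult_right_mat[of "trace_form d" R] unfolding JR by (auto intro!: eq_matI)
  have "- R * trace_form d * R = 0\<^sub>m d d"
    using assoc_mult_mat[OF S trace_form_carrier R] JR R by simp
  then have "- R + R + - R * trace_form d * R = 0\<^sub>m d d"
    using R by (intro eq_matI) (auto simp del: index_mult_mat(1))
  note act = coadjoint_one_plus_hat[OF S R this]
  have Y: "(1\<^sub>m d + trace_form d * - R)\<^sup>T = 1\<^sub>m d" unfolding JS by simp
  have "(1\<^sub>m d + R)\<^sup>T = addrow_mat d c k 0"
    using k by (intro eq_matI) (auto simp: R_def)
  then have "coadjoint e (1\<^sub>m N + hat (- R)) (form M) = form (addrow_mat d c k 0 * M)"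
    unfolding act(2)[OF M] Y RJ using M right_mult_one_mat[of "addrow_mat d c k 0 * M" d d] by simp
  also have "addrow_mat d c k 0 * M = addrow c k 0 M"
    using addrow_mat[OF M d] by simp
  finally show ?thesis using sym_invariantsD(2)[OF f act(1) form_dual, of M] by simp
qed

lemma flag_orbit_null_cone: "flag_orbit r \<subseteq> null_cone e"
proof
  fix \<xi> assume "\<xi> \<in> flag_orbit r"
  then obtain g F h where \<xi>: "\<xi> = form (g * F * h)" and gFh: "g \<in> bordered d" "h \<in> bordered d"
    "g * h = 1\<^sub>m d" "h * g = 1\<^sub>m d" and F: "F \<in> flag_mats d r"
    unfolding flag_orbit_def by blast
  show "\<xi> \<in> null_cone e"
    unfolding null_cone_def
  proof (intro CollectI conjI allI impI ballI)
    show "\<xi> \<in> centraliser_dual e" unfolding \<xi> by (rule form_dual)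
    fix k f assume k: "0 < k" and f: "f \<in> sym_invariants e" and hom: "homogeneous e k f"
    note fs = sym_invariantsD(1)[OF f]
    have "form (0\<^sub>m d d) x = 0" if "x \<in> lie_centraliser e" for x
      using that by (simp add: form_def pairing_zero_left)
    then have "f (form (0\<^sub>m d d)) = 0" by (rule homogeneous_at_zero[OF hom k])
    then have "f (form F) = 0"
      by (intro invariant_vanishes_on_flag_mats[OF _ _ _ _ _ F, of "\<lambda>M. f (form M)"]
          polyfun_form[OF fs] invariant_conj[OF f] invariant_addcol[OF f] invariant_addrow[OF f])
    then show "f \<xi> = 0"
      unfolding \<xi> using invariant_conj[OF f flag_mats_carrier[OF F] gFh] by simp
  qed
qed

lemma null_cone_pow:
  assumes \<xi>: "\<xi> \<in> null_cone e" shows "\<xi> (e ^\<^sub>m l) = 0"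
proof -
  \<comment> \<open>The factor 1 is the degree zero function from which \<open>homogeneous\<close>
    builds products.\<close>
  let ?f = "\<lambda>\<xi>. \<xi> (e ^\<^sub>m l) * 1"
  have hom: "homogeneous e (Suc 0) ?f"
    by (intro homogeneous.mult homogeneous.const lie_centraliser_pow[OF e])
  moreover have "?f \<in> sym_invariants e"
    unfolding sym_invariants_def using homogeneous_imp_sym_algebra[OF hom] coadjoint_pow[OF e] by simp
  ultimately show ?thesis using \<xi> unfolding null_cone_def by force
qed

text \<open>The coefficient of s^k is homogeneous of degree k and invariant, so for k > 0 it
  vanishes on the null-cone. What is left is the value at s = 0, namely det (- J), which is 0
  because row 0 of J is zero.\<close>

lemma null_cone_pencil:
  assumes \<xi>: "\<xi> \<in> null_cone e"
  shows "det (s \<cdot>\<^sub>m coord \<xi> - trace_form d) = 0"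
proof -
  define D where "D = (\<lambda>\<xi> :: 'a mat \<Rightarrow> 'a. det (mat d d (\<lambda>(i, j). [:- (trace_form d $$ (i, j)), \<xi> (hat (elem_mat d (i, j))):])))"
  have poly_D: "poly (D \<xi>) s = det (s \<cdot>\<^sub>m coord \<xi> - trace_form d)" for \<xi> s
  proof -
    have "poly (D \<xi>) s = det (map_mat (\<lambda>p. poly p s)
        (mat d d (\<lambda>(i, j). [:- (trace_form d $$ (i, j)), \<xi> (hat (elem_mat d (i, j))):])))"
      unfolding D_def by (rule poly_det[of _ d]) simp
    also have "map_mat (\<lambda>p. poly p s)
        (mat d d (\<lambda>(i, j). [:- (trace_form d $$ (i, j)), \<xi> (hat (elem_mat d (i, j))):])) =
        s \<cdot>\<^sub>m coord \<xi> - trace_form d"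
      by (intro eq_matI) (auto simp: coord_def)
    finally show ?thesis .
  qed
  have \<xi>d: "\<xi> \<in> centraliser_dual e" using \<xi> by (simp add: null_cone_def)
  have "coeff (D \<xi>) (Suc k) = 0" for k
  proof -
    let ?f = "\<lambda>\<xi>. coeff (D \<xi>) (Suc k)"
    have hom: "homogeneous e (Suc k) ?f"
      unfolding D_def by (rule homogeneous_coeff_pencil[OF e]) (rule hat_centraliser[OF elem_mat_carrier])
    \<comment> \<open>Invariance is known for the values at all s; over an infinite field it passes
      to the coefficients.\<close>
    have "D (coadjoint e g \<eta>) = D \<eta>" if "g \<in> group_stabiliser e" "\<eta> \<in> centraliser_dual e" for g \<eta>
      using det_pencil_coadjoint[OF that(2,1)]
      by (intro poly_eq_poly_eq_iff[THEN iffD1] ext) (simp add: poly_D)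
    then have "?f \<in> sym_invariants e"
      unfolding sym_invariants_def using homogeneous_imp_sym_algebra[OF hom] by simp
    then show ?thesis using \<xi> hom unfolding null_cone_def by blast
  qed
  then have const: "D \<xi> = [:coeff (D \<xi>) 0:]"
    by (intro poly_eqI) (auto simp: coeff_pCons split: nat.split)
  have "poly (D \<xi>) s = poly (D \<xi>) 0" by (subst (1 2) const) simp
  also have "\<dots> = det (- trace_form d)"
  proof -
    have "0 \<cdot>\<^sub>m coord \<xi> - trace_form d = - trace_form d" by (intro eq_matI) auto
    then show ?thesis by (simp add: poly_D)
  qed
  also have "\<dots> = (\<Sum>j<d. (- trace_form d) $$ (0, j) * cofactor (- trace_form d) 0 j)"
    by (rule laplace_expansion_row[OF _ d]) simp
  also have "\<dots> = 0" using d by (intro sum.neutral) auto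
  finally show ?thesis by (simp add: poly_D)
qed

lemma null_cone_eq: "null_cone e = (\<Union>r<d. flag_orbit r)"
proof (intro equalityI subsetI)
  fix \<xi> assume \<xi>: "\<xi> \<in> null_cone e"
  then have \<xi>d: "\<xi> \<in> centraliser_dual e" by (simp add: null_cone_def)
  define M where "M = coord \<xi>"
  have M: "M \<in> carrier_mat d d" by (simp add: M_def)
  have "(M ^\<^sub>m Suc k) $$ (0, 0) = 0" for k
    by (rule singular_pencil_pow_zero[OF M d]) (simp add: M_def null_cone_pencil[OF \<xi>])
  then obtain r g h where r: "r < d" and gh: "g \<in> bordered d" "h \<in> bordered d" "g * h = 1\<^sub>m d" "h * g = 1\<^sub>m d"
    and F: "h * M * g \<in> flag_mats d r"
    using ex_flag_form[OF M d] by blast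
  note gc = borderedD(1)[OF gh(1)] and hc = borderedD(1)[OF gh(2)]
  have Mg: "M * g \<in> carrier_mat d d" using M gc by simp
  have "g * (h * M * g) * h = g * (h * (M * g)) * h" using assoc_mult_mat[OF hc M gc] by simp
  also have "g * (h * (M * g)) = M * g"
    using assoc_mult_mat[OF gc hc Mg] gh(3) left_mult_one_mat[OF Mg] by simp
  also have "M * g * h = M"
    using assoc_mult_mat[OF M gc hc] gh(3) right_mult_one_mat[OF M] by simp
  finally have "g * (h * M * g) * h = M" .
  moreover have "form M = \<xi>"
    unfolding M_def using form_coord[OF \<xi>d null_cone_pow[OF \<xi>]] .
  ultimately have "\<xi> \<in> flag_orbit r" using flag_orbitI[OF gh F] by simp
  then show "\<xi> \<in> (\<Union>r<d. flag_orbit r)" using r by blast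
qed (use flag_orbit_null_cone in blast)

section \<open>Irreducibility and separation of the pieces\<close>

lemma one_bordered: "1\<^sub>m d \<in> bordered d"
  using d by (auto simp: bordered_def)

lemma form_flag_orbit:
  assumes F: "F \<in> flag_mats d r" shows "form F \<in> flag_orbit r"
proof -
  have "1\<^sub>m d * F * 1\<^sub>m d = F" using flag_mats_carrier[OF F] by simp
  then show ?thesis using flag_orbitI[OF one_bordered one_bordered _ _ F] by simp
qed

lemma flag_mats_smult: "F \<in> flag_mats d r \<Longrightarrow> (c::'a) \<cdot>\<^sub>m F \<in> flag_mats d r"
  by (auto simp: flag_mats_def)

text \<open>The adjugate makes the orbit map polynomial; since \<open>flag_mats\<close> is closed under scaling, it
  may replace the inverse.\<close>

lemma flag_orbit_adj:
  assumes g: "g \<in> bordered d" "det g \<noteq> 0" and F: "F \<in> flag_mats d r"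
  shows "form (g * F * adj_mat g) \<in> flag_orbit r"
proof -
  obtain h where h: "h \<in> carrier_mat d d" "g * h = 1\<^sub>m d" "h * g = 1\<^sub>m d" "adj_mat g = det g \<cdot>\<^sub>m h"
    using det_nonzero_inverse[OF borderedD(1)[OF g(1)] g(2)] by metis
  have gc: "g \<in> carrier_mat d d" using borderedD(1)[OF g(1)] .
  have gF: "g * F \<in> carrier_mat d d" using gc flag_mats_carrier[OF F] by simp
  have "g * F * adj_mat g = g * (det g \<cdot>\<^sub>m F) * h"
    unfolding h(4) mult_smult_distrib[OF gF h(1)] mult_smult_distrib[OF gc flag_mats_carrier[OF F]]
    by (rule mult_smult_assoc_mat[OF gF h(1), symmetric])
  also have "form \<dots> \<in> flag_orbit r"
    by (rule flag_orbitI[OF g(1) bordered_inverse[OF g(1) h(1) d h(2,3)] h(2,3) flag_mats_smult[OF F]])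
  finally show ?thesis .
qed

text \<open>The converse parametrisation: the factor 1 / det g is absorbed into F.\<close>

lemma flag_orbitE:
  assumes "\<xi> \<in> flag_orbit r"
  obtains g F where "g \<in> bordered d" "det g \<noteq> 0" "F \<in> flag_mats d r" "\<xi> = form (g * F * adj_mat g)"
proof -
  obtain g F h where \<xi>: "\<xi> = form (g * F * h)" and gh: "g \<in> bordered d" "h \<in> bordered d"
    "g * h = 1\<^sub>m d" "h * g = 1\<^sub>m d" and F: "F \<in> flag_mats d r"
    using assms unfolding flag_orbit_def by blast
  note gc = borderedD(1)[OF gh(1)] and hc = borderedD(1)[OF gh(2)] and Fc = flag_mats_carrier[OF F]
  note adj = adj_mat[OF gc]
  have "det g * det h = 1" using det_mult[OF gc hc] gh by simp
  then have dg: "det g \<noteq> 0" by auto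
  have "adj_mat g = adj_mat g * (g * h)" using adj(1) gh by simp
  also have "\<dots> = adj_mat g * g * h" by (rule assoc_mult_mat[OF adj(1) gc hc, symmetric])
  also have "\<dots> = det g \<cdot>\<^sub>m h" unfolding adj(3) using hc by (simp add: mult_smult_assoc_mat[of _ d d])
  finally have adjg: "adj_mat g = det g \<cdot>\<^sub>m h" .
  let ?F = "inverse (det g) \<cdot>\<^sub>m F"
  have gF: "g * F \<in> carrier_mat d d" using gc Fc by simp
  have gFh: "g * F * h \<in> carrier_mat d d" using gF hc by simp
  have "g * ?F * adj_mat g = det g \<cdot>\<^sub>m (inverse (det g) \<cdot>\<^sub>m (g * F * h))"
    unfolding adjg mult_smult_distrib[OF gc Fc] using gF hc
    by (simp add: mult_smult_assoc_mat[OF gF hc] mult_smult_distrib[of _ d d])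
  also have "\<dots> = g * F * h" using dg gFh by (intro eq_matI) (auto simp del: index_mult_mat(1))
  finally have "\<xi> = form (g * ?F * adj_mat g)" unfolding \<xi> by simp
  then show ?thesis by (rule that[OF gh(1) dg flag_mats_smult[OF F]])
qed

text \<open>Two points of the piece outside \<open>A\<close> and \<open>B\<close> are joined by a
  polynomial curve, and the functions that witness this cannot both vanish along the whole
  curve.\<close>

lemma irreducible_flag_orbit:
  "irreducible_in (subtopology (zariski_topology e) (null_cone e)) (flag_orbit r)"
  unfolding irreducible_in_def
proof (intro conjI allI impI)
  have "null_cone e \<subseteq> centraliser_dual e" by (auto simp: null_cone_def)
  then show "flag_orbit r \<subseteq> topspace (subtopology (zariski_topology e) (null_cone e))"
    using flag_orbit_null_cone by auto
  have "0\<^sub>m d d \<in> flag_mats d r" by (auto simp: flag_mats_def)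
  then show "flag_orbit r \<noteq> {}" using form_flag_orbit by blast
  fix A B assume AB: "closedin (subtopology (zariski_topology e) (null_cone e)) A"
    "closedin (subtopology (zariski_topology e) (null_cone e)) B" "flag_orbit r \<subseteq> A \<union> B"
  have point: "\<exists>\<xi>\<in>flag_orbit r. \<exists>f\<in>sym_algebra e. f \<xi> \<noteq> 0 \<and> (\<forall>\<eta>\<in>C. f \<eta> = 0)"
    if C: "closedin (subtopology (zariski_topology e) (null_cone e)) C" and nC: "\<not> flag_orbit r \<subseteq> C" for C
  proof -
    obtain P where P: "P \<subseteq> sym_algebra e" "C = zero_locus e P \<inter> null_cone e"
      using C unfolding closedin_subtopology closedin_zariski by blast
    obtain \<xi> where \<xi>: "\<xi> \<in> flag_orbit r" "\<xi> \<notin> C" using nC by blast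
    then have "\<xi> \<in> centraliser_dual e" "\<xi> \<notin> zero_locus e P"
      using flag_orbit_null_cone P by (auto simp: null_cone_def)
    then obtain f where "f \<in> P" "f \<xi> \<noteq> 0" by (auto simp: zero_locus_def)
    then show ?thesis using P \<xi> by (auto simp: zero_locus_def)
  qed
  show "flag_orbit r \<subseteq> A \<or> flag_orbit r \<subseteq> B"
  proof (rule ccontr)
    assume "\<not> (flag_orbit r \<subseteq> A \<or> flag_orbit r \<subseteq> B)"
    then obtain \<xi>1 f1 \<xi>2 f2 where
      1: "\<xi>1 \<in> flag_orbit r" "f1 \<in> sym_algebra e" "f1 \<xi>1 \<noteq> 0" "\<forall>\<eta>\<in>A. f1 \<eta> = 0" and
      2: "\<xi>2 \<in> flag_orbit r" "f2 \<in> sym_algebra e" "f2 \<xi>2 \<noteq> 0" "\<forall>\<eta>\<in>B. f2 \<eta> = 0"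
      using point[OF AB(1)] point[OF AB(2)] by metis
    obtain g1 F1 where g1: "g1 \<in> bordered d" "det g1 \<noteq> 0" and F1: "F1 \<in> flag_mats d r"
      and \<xi>1: "\<xi>1 = form (g1 * F1 * adj_mat g1)" using flag_orbitE[OF 1(1)] by metis
    obtain g2 F2 where g2: "g2 \<in> bordered d" "det g2 \<noteq> 0" and F2: "F2 \<in> flag_mats d r"
      and \<xi>2: "\<xi>2 = form (g2 * F2 * adj_mat g2)" using flag_orbitE[OF 2(1)] by metis
    note c = borderedD(1)[OF g1(1)] borderedD(1)[OF g2(1)] flag_mats_carrier[OF F1] flag_mats_carrier[OF F2]
    \<comment> \<open>Straight lines are possible because \<open>bordered\<close> is affine and
      \<open>flag_mats\<close> is linear; \<open>g t\<close> may become singular, and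
      \<open>adj_mat\<close> is still defined there.\<close>
    define g where "g = (\<lambda>t::'a. (1 - t) \<cdot>\<^sub>m g1 + t \<cdot>\<^sub>m g2)"
    define F where "F = (\<lambda>t::'a. (1 - t) \<cdot>\<^sub>m F1 + t \<cdot>\<^sub>m F2)"
    define M where "M = (\<lambda>t. g t * F t * adj_mat (g t))"
    have ends: "g 0 = g1" "g 1 = g2" "F 0 = F1" "F 1 = F2"
      using c unfolding g_def F_def by (auto intro!: eq_matI)
    have gb: "g t \<in> bordered d" for t
      using g1(1) g2(1) d by (auto simp: g_def bordered_def)
    have Ff: "F t \<in> flag_mats d r" for t
      using F1 F2 by (auto simp: F_def flag_mats_def)
    have pg: "polymat d d g" and pF: "polymat d d F"
      unfolding g_def F_def using c
      by (auto intro!: polymat_add polymat_smult polymat_const polyfun_diff)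
    have pM: "polymat d d M"
      unfolding M_def by (intro polymat_mult[of d d] polymat_adj pg pF)
    \<comment> \<open>The factor det (g t) excludes the parameters with singular \<open>g t\<close>,
      where the curve need not lie in \<open>flag_orbit r\<close>.\<close>
    have p1: "polyfun (\<lambda>t. f1 (form (M t)) * det (g t))"
      by (intro polyfun_mult polyfun_form[OF 1(2) pM] polyfun_det[OF pg])
    have p2: "polyfun (\<lambda>t. f2 (form (M t)))"
      by (rule polyfun_form[OF 2(2) pM])
    have "f1 (form (M 0)) * det (g 0) \<noteq> 0" using 1(3) g1(2) by (simp add: M_def ends \<xi>1)
    moreover have "f2 (form (M 1)) \<noteq> 0" using 2(3) by (simp add: M_def ends \<xi>2)
    ultimately obtain t where t: "f1 (form (M t)) * det (g t) * f2 (form (M t)) \<noteq> 0"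
      using polyfun_mult_nonzero[OF p1 p2] by blast
    then have "form (M t) \<in> flag_orbit r"
      unfolding M_def using flag_orbit_adj[OF gb _ Ff] by auto
    then have "form (M t) \<in> A \<union> B" using AB(3) by blast
    then show False using t 1(4) 2(4) by auto
  qed
qed

text \<open>Larger r allows more independent vectors M^k e_0 but fewer independent functionals e_0^T
  M^k. Column minors therefore rule out one inclusion of closures and row minors the other.\<close>

lemma separate_flag_orbits:
  assumes r: "r < d" and s: "s < d" and "r \<noteq> s"
  shows "\<exists>A. closedin (subtopology (zariski_topology e) (null_cone e)) A \<and>
    flag_orbit s \<subseteq> A \<and> \<not> flag_orbit r \<subseteq> A"
proof -
  have coord_sym: "(\<lambda>\<xi>. coord \<xi> $$ (i, j)) \<in> sym_algebra e" if "i < d" "j < d" for i j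
    using that sym_algebra.eval[OF hat_centraliser[OF elem_mat_carrier]] by (simp add: coord_def)
  have pow_sym: "(\<lambda>\<xi>. (coord \<xi> ^\<^sub>m k) $$ (i, j)) \<in> sym_algebra e" if "i < d" "j < d" for i j k
    by (rule sym_algebra_pow_mat[OF coord_carrier coord_sym that])
  have main: ?thesis
    if m: "(\<lambda>\<xi>. m (coord \<xi>)) \<in> sym_algebra e"
      and zero: "\<And>F g h. F \<in> flag_mats d s \<Longrightarrow> g \<in> bordered d \<Longrightarrow> h \<in> bordered d \<Longrightarrow>
        g * h = 1\<^sub>m d \<Longrightarrow> h * g = 1\<^sub>m d \<Longrightarrow> m (g * F * h) = 0"
      and ex: "\<exists>F\<in>flag_mats d r. m F \<noteq> 0"
    for m :: "'a mat \<Rightarrow> 'a"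
  proof (intro exI conjI)
    let ?Z = "zero_locus e {\<lambda>\<xi>. m (coord \<xi>)}"
    have "closedin (zariski_topology e) ?Z" unfolding closedin_zariski using m by blast
    then show "closedin (subtopology (zariski_topology e) (null_cone e)) (?Z \<inter> null_cone e)"
      unfolding closedin_subtopology by blast
    have "m (coord \<xi>) = 0" if \<xi>: "\<xi> \<in> flag_orbit s" for \<xi>
    proof -
      obtain g F h where "\<xi> = form (g * F * h)" "g \<in> bordered d" "h \<in> bordered d"
        "g * h = 1\<^sub>m d" "h * g = 1\<^sub>m d" "F \<in> flag_mats d s"
        using \<xi> unfolding flag_orbit_def by blast
      moreover from this have "g * F * h \<in> carrier_mat d d"
        using borderedD(1) flag_mats_carrier by (meson mult_carrier_mat)
      ultimately show ?thesis using coord_form zero by simp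
    qed
    then show "flag_orbit s \<subseteq> ?Z \<inter> null_cone e"
      using flag_orbit_null_cone unfolding zero_locus_def null_cone_def by blast
    obtain F where F: "F \<in> flag_mats d r" "m F \<noteq> 0" using ex by blast
    then have "form F \<in> flag_orbit r" "form F \<notin> ?Z"
      using form_flag_orbit coord_form[OF flag_mats_carrier[OF F(1)]] by (auto simp: zero_locus_def)
    then show "\<not> flag_orbit r \<subseteq> ?Z \<inter> null_cone e" by blast
  qed
  show ?thesis
  proof (cases "s < r")
    case True
    have "(\<lambda>\<xi>. col_minor s (coord \<xi>)) \<in> sym_algebra e"
      unfolding col_minor_def by (intro sym_algebra_det pow_sym) (use True r in auto)
    then show ?thesis
      by (rule main) (use True r in \<open>auto intro!: col_minor_zero ex_col_minor_nonzero\<close>)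
  next
    case False
    then have rs: "r < s" using assms by simp
    have "(\<lambda>\<xi>. row_minor d s (coord \<xi>)) \<in> sym_algebra e"
      unfolding row_minor_def by (intro sym_algebra_det pow_sym) (use d in auto)
    then show ?thesis
      by (rule main) (use rs s in \<open>auto intro!: row_minor_zero ex_row_minor_nonzero\<close>)
  qed
qed

lemma card_components_null_cone:
  "card (irreducible_components (subtopology (zariski_topology e) (null_cone e))) = d"
proof -
  have "topspace (subtopology (zariski_topology e) (null_cone e)) = (\<Union>r\<in>{..<d}. flag_orbit r)"
  proof -
    have "null_cone e \<subseteq> centraliser_dual e" by (auto simp: null_cone_def)
    then have "topspace (subtopology (zariski_topology e) (null_cone e)) = null_cone e" by auto
    then show ?thesis by (simp only: null_cone_eq)
  qed
  then have "card (irreducible_components (subtopology (zariski_topology e) (null_cone e))) = card {..<d}"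
    by (rule card_irreducible_components[OF finite_lessThan, where Y = flag_orbit])
      (rule irreducible_flag_orbit, rule separate_flag_orbits, simp_all)
  then show ?thesis by simp
qed

end

subsection \<open>Jordan form\<close>

lemma jordan_matrix_Cons:
  "jordan_matrix ((k, a) # xs) = four_block_mat (jordan_block k a)
     (0\<^sub>m k (sum_list (map fst xs))) (0\<^sub>m (sum_list (map fst xs)) k) (jordan_matrix xs)"
  by (simp add: jordan_matrix_def Let_def jordan_matrix_dim[unfolded jordan_matrix_def])

lemma jordan_matrix_replicate: "jordan_matrix (replicate m (1, 0)) = (0\<^sub>m m m :: 'a::comm_ring_1 mat)"
proof (induction m)
  case (Suc m)
  have "jordan_matrix (replicate (Suc m) (1, 0)) =
      four_block_mat (jordan_block 1 (0::'a)) (0\<^sub>m 1 m) (0\<^sub>m m 1) (jordan_matrix (replicate m (1, 0)))"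
    by (simp add: jordan_matrix_Cons sum_list_replicate)
  then show ?case unfolding Suc by (intro eq_matI) auto
qed (simp add: jordan_matrix_def)

lemma jordan_matrix_hook:
  fixes m n :: nat
  defines "J \<equiv> jordan_matrix ((n, 0) # replicate m (1, 0)) :: 'a::comm_ring_1 mat"
  shows "J \<in> carrier_mat (m + n) (m + n)"
    and "p < m + n \<Longrightarrow> q < m + n \<Longrightarrow> J $$ (p, q) = (if q = Suc p \<and> q < n then 1 else 0)"
proof -
  have "J = four_block_mat (jordan_block n 0) (0\<^sub>m n m) (0\<^sub>m m n) (jordan_matrix (replicate m (1, 0)))"
    by (simp add: J_def jordan_matrix_Cons sum_list_replicate)
  then have J: "J = four_block_mat (jordan_block n 0) (0\<^sub>m n m) (0\<^sub>m m n) (0\<^sub>m m m)"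
    unfolding jordan_matrix_replicate .
  show "J \<in> carrier_mat (m + n) (m + n)" unfolding J by auto
  assume "p < m + n" "q < m + n"
  then show "J $$ (p, q) = (if q = Suc p \<and> q < n then 1 else 0)" unfolding J by auto
qed

text \<open>Conjugation carries ker f to ker e by P and V / fV to V / eV by P, with Q translating
  coordinates back. Hence adapted coordinates need only be found for the Jordan matrix.\<close>

lemma hook_coords_similar:
  fixes e f P Q :: "'a::field_char_0 mat"
  assumes H: "hook_coords f N d n K L T" and e_eq: "e = P * f * Q"
    and P: "P \<in> carrier_mat N N" and Q: "Q \<in> carrier_mat N N" and PQ: "P * Q = 1\<^sub>m N" and QP: "Q * P = 1\<^sub>m N"
  shows "hook_coords e N d n (P * K) (L * Q) (\<lambda>x. T (Q * x * P))"
proof -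
  interpret hook_coords f N d n K L T by (rule H)
  have ec: "e \<in> carrier_mat N N" using hook_coords.e[OF H] P Q unfolding e_eq by simp
  note f = hook_coords.e[OF H]
  have Pf: "P * f \<in> carrier_mat N N" using P f by simp
  have cancel1: "P * (Q * A) = A" if "A \<in> carrier_mat N k" for A k
    using assoc_mult_mat[OF P Q that] PQ left_mult_one_mat[OF that] by simp
  have cancel2: "Q * (P * A) = A" if "A \<in> carrier_mat N k" for A k
    using assoc_mult_mat[OF Q P that] QP left_mult_one_mat[OF that] by simp
  have cancel3: "A * Q * P = A" if "A \<in> carrier_mat k N" for A k
    using assoc_mult_mat[OF that Q P] QP right_mult_one_mat[OF that] by simp
  have cancel4: "A * P * Q = A" if "A \<in> carrier_mat k N" for A k
    using assoc_mult_mat[OF that P Q] PQ right_mult_one_mat[OF that] by simp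
  have eP: "e * P = P * f"
    unfolding e_eq using cancel3[OF Pf] by simp
  have Qe: "Q * e = f * Q"
    unfolding e_eq using assoc_mult_mat[OF P f Q] cancel2[of "f * Q" N] f Q by simp
  have PK: "P * K \<in> carrier_mat N d" and LQ: "L * Q \<in> carrier_mat d N" using P Q K L by auto
  have pow: "e ^\<^sub>m l = P * f ^\<^sub>m l * Q" for l
    by (rule similar_mat_wit_pow_id[of e f], rule similar_mat_witI[OF PQ QP e_eq ec f P Q])
  have comb: "pow_comb e a k = P * pow_comb f a k * Q" for a k
  proof (induction k)
    case 0
    show ?case using ec f P Q by simp
  next
    case (Suc k)
    have c: "pow_comb f a k \<in> carrier_mat N N" "f ^\<^sub>m k \<in> carrier_mat N N" using f by auto
    have "P * (pow_comb f a k + a k \<cdot>\<^sub>m f ^\<^sub>m k) * Q = (P * pow_comb f a k + a k \<cdot>\<^sub>m (P * f ^\<^sub>m k)) * Q"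
      using mult_add_distrib_mat[OF P c(1), of "a k \<cdot>\<^sub>m f ^\<^sub>m k"] mult_smult_distrib[OF P c(2)] c by simp
    also have "\<dots> = P * pow_comb f a k * Q + a k \<cdot>\<^sub>m (P * f ^\<^sub>m k) * Q"
      using P c Q by (intro add_mult_distrib_mat[of _ N N]) auto
    also have "a k \<cdot>\<^sub>m (P * f ^\<^sub>m k) * Q = a k \<cdot>\<^sub>m (P * f ^\<^sub>m k * Q)"
      by (rule mult_smult_assoc_mat[OF mult_carrier_mat[OF P c(2)] Q])
    finally show ?case using Suc pow by simp
  qed
  have hats: "P * K * S * (L * Q) = P * (K * S * L) * Q" if S: "S \<in> carrier_mat d d" for S
  proof -
    have KS: "K * S \<in> carrier_mat N d" and KSL: "K * S * L \<in> carrier_mat N N" using K S L by auto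
    have "P * K * S = P * (K * S)" by (rule assoc_mult_mat[OF P K S])
    then have "P * K * S * (L * Q) = P * (K * S) * L * Q"
      using assoc_mult_mat[OF mult_carrier_mat[OF P KS] L Q] by simp
    also have "P * (K * S) * L = P * (K * S * L)" by (rule assoc_mult_mat[OF P KS L])
    finally show ?thesis .
  qed
  have unconj: "Q * (P * A * Q) * P = A" if A: "A \<in> carrier_mat N N" for A
    using assoc_mult_mat[OF P A Q] cancel2[OF mult_carrier_mat[OF A Q]] cancel3[OF A] by simp
  show ?thesis
  proof (unfold_locales)
    show "e \<in> carrier_mat N N" "P * K \<in> carrier_mat N d" "L * Q \<in> carrier_mat d N" by fact+
    show "0 < d" "2 \<le> n" by (fact d, fact n)
    show "e * (P * K) = 0\<^sub>m N d"
      using assoc_mult_mat[OF ec P K] eP assoc_mult_mat[OF P f K] eK P by simp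
    show "L * Q * e = 0\<^sub>m d N"
      using assoc_mult_mat[OF L Q ec] Qe assoc_mult_mat[OF L f Q] Le Q by simp
    show "L * Q * (P * K) = trace_form d"
      using assoc_mult_mat[OF L Q PK] cancel2[OF K] LK by simp
    fix x :: "'a mat" assume x: "x \<in> carrier_mat N N"
    have Qx: "Q * x \<in> carrier_mat N N" using Q x by simp
    show "T (Q * x * P) \<in> carrier_mat d d" using Qx P by (intro T_carrier) simp
    show "T (Q * (c \<cdot>\<^sub>m x) * P) = c \<cdot>\<^sub>m T (Q * x * P)" for c
      using mult_smult_distrib[OF Q x] mult_smult_assoc_mat[OF Qx P] T_smult Qx P by simp
    fix y :: "'a mat" assume y: "y \<in> carrier_mat N N"
    have Qy: "Q * y \<in> carrier_mat N N" using Q y by simp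
    show "T (Q * (x + y) * P) = T (Q * x * P) + T (Q * y * P)"
      using mult_add_distrib_mat[OF Q x y] add_mult_distrib_mat[OF Qx Qy P] T_add Qx Qy P by simp
  next
    fix S :: "'a mat" assume S: "S \<in> carrier_mat d d"
    have "K * S * L \<in> carrier_mat N N" using K S L by simp
    then show "T (Q * (P * K * S * (L * Q)) * P) = S"
      unfolding hats[OF S] using unconj T_KSL[OF S] by simp
  next
    fix l assume "l < n - 1"
    then show "T (Q * e ^\<^sub>m l * P) = 0\<^sub>m d d"
      unfolding pow using unconj[of "f ^\<^sub>m l"] f T_pow by simp
  next
    fix x assume "x \<in> lie_centraliser e"
    then have x: "x \<in> carrier_mat N N" "e * x = x * e" by (auto simp: lie_centraliser_iff[OF ec])
    let ?y = "Q * x * P"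
    have xP: "x * P \<in> carrier_mat N N" and Qx: "Q * x \<in> carrier_mat N N" and y: "?y \<in> carrier_mat N N"
      using x P Q by auto
    have "f * ?y = f * (Q * (x * P))" using assoc_mult_mat[OF Q x(1) P] by simp
    also have "\<dots> = Q * e * (x * P)" using assoc_mult_mat[OF f Q xP] Qe by simp
    also have "\<dots> = Q * (e * x * P)"
      using assoc_mult_mat[OF Q ec xP] assoc_mult_mat[OF ec x(1) P] by simp
    also have "e * x * P = x * (P * f)" using x(2) assoc_mult_mat[OF x(1) ec P] eP by simp
    also have "\<dots> = x * P * f" using assoc_mult_mat[OF x(1) P f] by simp
    also have "Q * (x * P * f) = Q * (x * P) * f" using assoc_mult_mat[OF Q xP f] by simp
    also have "Q * (x * P) = ?y" using assoc_mult_mat[OF Q x(1) P] by simp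
    finally have "?y \<in> lie_centraliser f" using y by (simp add: lie_centraliser_iff[OF f])
    then obtain a where a: "?y = pow_comb f a (n - 1) + K * T ?y * L" using decomp by blast
    have Ty: "T ?y \<in> carrier_mat d d" by (rule T_carrier[OF y])
    have KTL: "K * T ?y * L \<in> carrier_mat N N" and comb_c: "pow_comb f a (n - 1) \<in> carrier_mat N N"
      using K L Ty f by auto
    have "x = P * ?y * Q"
      using assoc_mult_mat[OF Q x(1) P] cancel1[OF xP] cancel4[OF x(1)] by simp
    also have "P * ?y * Q = P * (pow_comb f a (n - 1) + K * T ?y * L) * Q" using a by simp
    also have "\<dots> = (P * pow_comb f a (n - 1) + P * (K * T ?y * L)) * Q"
      using mult_add_distrib_mat[OF P comb_c KTL] by simp
    also have "\<dots> = P * pow_comb f a (n - 1) * Q + P * (K * T ?y * L) * Q"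
      by (rule add_mult_distrib_mat[OF mult_carrier_mat[OF P comb_c] mult_carrier_mat[OF P KTL] Q])
    finally have "x = pow_comb e a (n - 1) + P * K * T ?y * (L * Q)"
      unfolding comb hats[OF Ty] .
    then show "\<exists>a. x = pow_comb e a (n - 1) + P * K * T ?y * (L * Q)" by (intro exI[of _ a])
  qed
qed

lemma hook_coords_jordan:
  fixes m n :: nat and J :: "'a::field_char_0 mat"
  assumes n: "2 \<le> n" and J: "J = jordan_matrix ((n, 0) # replicate m (1, 0))"
  shows "\<exists>K L T. hook_coords J (m + n) (m + 1) n K L T"
proof -
  let ?N = "m + n" and ?d = "m + 1"
  \<comment> \<open>The Jordan matrix sends unit vector q to q - 1 for 0 < q < n and the others to
    0. So its kernel has the unit vectors 0 and n, ..., n + m - 1 as a basis, indexed by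
    \<open>ka\<close>, and the cokernel is represented by n - 1, ..., n + m - 1. As n \<ge> 2, they
    agree in all indices but the first.\<close>
  define ka where "ka = (\<lambda>i. if i = 0 then 0 else n - 1 + i)"
  define K :: "'a mat" where "K = mat ?N ?d (\<lambda>(p, i). if p = ka i then 1 else 0)"
  define L :: "'a mat" where "L = mat ?d ?N (\<lambda>(j, q). if q = n - 1 + j then 1 else 0)"
  \<comment> \<open>Reads off the entries that \<open>K * S * L\<close> can occupy. The identity
    contributes J there, so its coefficient, visible at (0, 0), has to be subtracted; the powers l
    with 0 < l < n - 1 contribute nothing.\<close>
  define T :: "'a mat \<Rightarrow> 'a mat" where
    "T = (\<lambda>x. mat ?d ?d (\<lambda>(i, j). x $$ (ka i, n - 1 + j) - x $$ (0, 0) * trace_form ?d $$ (i, j)))"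
  have Jc: "J \<in> carrier_mat ?N ?N" unfolding J by (rule jordan_matrix_hook)
  have Jpq: "J $$ (p, q) = (if q = Suc p \<and> q < n then 1 else 0)" if "p < ?N" "q < ?N" for p q
    unfolding J using jordan_matrix_hook(2)[OF that] .
  have Kc: "K \<in> carrier_mat ?N ?d" and Lc: "L \<in> carrier_mat ?d ?N" by (simp_all add: K_def L_def)
  have ka: "ka i < ?N" if "i < ?d" for i using that n by (auto simp: ka_def)
  have la: "n - 1 + j < ?N" if "j < ?d" for j using that n by auto
  have JA: "(J * A) $$ (p, j) = (if Suc p < n then A $$ (Suc p, j) else 0)"
    if A: "A \<in> carrier_mat ?N c" and p: "p < ?N" "j < c" for A p j c
  proof -
    have "(J * A) $$ (p, j) = (\<Sum>q<?N. J $$ (p, q) * A $$ (q, j))"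
      by (rule index_mult_mat_sum[OF Jc A p])
    also have "\<dots> = (\<Sum>q<?N. if q = Suc p then (if Suc p < n then A $$ (Suc p, j) else 0) else 0)"
      using p by (intro sum.cong) (auto simp: Jpq)
    finally show ?thesis by simp
  qed
  have AJ: "(A * J) $$ (i, q) = (if 0 < q \<and> q < n then A $$ (i, q - 1) else 0)"
    if A: "A \<in> carrier_mat c ?N" and i: "i < c" "q < ?N" for A i q c
  proof -
    have "(A * J) $$ (i, q) = (\<Sum>p<?N. A $$ (i, p) * J $$ (p, q))"
      by (rule index_mult_mat_sum[OF A Jc i])
    also have "\<dots> = (\<Sum>p<?N. if p = q - 1 then (if 0 < q \<and> q < n then A $$ (i, q - 1) else 0) else 0)"
      using i by (intro sum.cong) (auto simp: Jpq)
    finally show ?thesis using i by auto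
  qed
  have KS: "(K * S) $$ (p, j) = (if p = 0 then S $$ (0, j) else if n \<le> p then S $$ (p - (n - 1), j) else 0)"
    if S: "S \<in> carrier_mat ?d c" and p: "p < ?N" "j < c" for S p j c
  proof -
    have "(K * S) $$ (p, j) = (\<Sum>i<?d. K $$ (p, i) * S $$ (i, j))"
      by (rule index_mult_mat_sum[OF Kc S p])
    also have "\<dots> = (\<Sum>i<?d. if i = (if p = 0 then 0 else p - (n - 1))
        then (if p = 0 then S $$ (0, j) else if n \<le> p then S $$ (p - (n - 1), j) else 0) else 0)"
      using p n by (intro sum.cong) (auto simp: K_def ka_def)
    finally show ?thesis using p by auto
  qed
  have AL: "(A * L) $$ (p, q) = (if n - 1 \<le> q then A $$ (p, q - (n - 1)) else 0)"
    if A: "A \<in> carrier_mat c ?d" and p: "p < c" "q < ?N" for A p q c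
  proof -
    have "(A * L) $$ (p, q) = (\<Sum>j<?d. A $$ (p, j) * L $$ (j, q))"
      by (rule index_mult_mat_sum[OF A Lc p])
    also have "\<dots> = (\<Sum>j<?d. if j = q - (n - 1) then (if n - 1 \<le> q then A $$ (p, q - (n - 1)) else 0) else 0)"
      using p n by (intro sum.cong) (auto simp: L_def)
    finally show ?thesis using p n by auto
  qed
  have KSL: "(K * S * L) $$ (p, q) = (if n - 1 \<le> q then
      (if p = 0 then S $$ (0, q - (n - 1)) else if n \<le> p then S $$ (p - (n - 1), q - (n - 1)) else 0) else 0)"
    if S: "S \<in> carrier_mat ?d ?d" and p: "p < ?N" "q < ?N" for S p q
    using AL[OF mult_carrier_mat[OF Kc S] p] KS[OF S p(1), of "q - (n - 1)"] p n by auto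
  have pow: "(J ^\<^sub>m l) $$ (p, q) = (if l = 0 then (if p = q then 1 else 0)
      else if q = p + l \<and> q < n then 1 else 0)" if "p < ?N" "q < ?N" for p q l
    using that
  proof (induction l arbitrary: q)
    case 0
    then show ?case using Jc by simp
  next
    case (Suc l)
    have "J ^\<^sub>m l \<in> carrier_mat ?N ?N" using Jc by simp
    from AJ[OF this Suc.prems]
    have "(J ^\<^sub>m Suc l) $$ (p, q) = (if 0 < q \<and> q < n then (J ^\<^sub>m l) $$ (p, q - 1) else 0)" by simp
    then show ?case using Suc.IH[of "q - 1"] Suc.prems by (cases l) auto
  qed
  have comb: "pow_comb J a k $$ (p, q) = (\<Sum>l<k. a l * (J ^\<^sub>m l) $$ (p, q))"
    if pq: "p < ?N" "q < ?N" for a k p q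
  proof (induction k)
    case 0
    show ?case using Jc pq by simp
  next
    case (Suc k)
    have "pow_comb J a k \<in> carrier_mat ?N ?N" "J ^\<^sub>m k \<in> carrier_mat ?N ?N" using Jc by auto
    then have "pow_comb J a (Suc k) $$ (p, q) = pow_comb J a k $$ (p, q) + a k * (J ^\<^sub>m k) $$ (p, q)"
      using pq Jc by simp
    then show ?case using Suc by simp
  qed
  have "hook_coords J ?N ?d n K L T"
  proof (unfold_locales)
    show "J \<in> carrier_mat ?N ?N" "K \<in> carrier_mat ?N ?d" "L \<in> carrier_mat ?d ?N" "2 \<le> n" by fact+
    show "0 < ?d" by simp
    show "J * K = 0\<^sub>m ?N ?d"
    proof (rule eq_matI)
      fix p i assume "p < dim_row (0\<^sub>m ?N ?d)" "i < dim_col (0\<^sub>m ?N ?d)"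
      then show "(J * K) $$ (p, i) = 0\<^sub>m ?N ?d $$ (p, i)"
        using JA[OF Kc, of p i] by (auto simp: K_def ka_def simp del: index_mult_mat(1))
    qed (use Jc Kc in auto)
    show "L * J = 0\<^sub>m ?d ?N"
    proof (rule eq_matI)
      fix j q assume "j < dim_row (0\<^sub>m ?d ?N)" "q < dim_col (0\<^sub>m ?d ?N)"
      then show "(L * J) $$ (j, q) = 0\<^sub>m ?d ?N $$ (j, q)"
        using AJ[OF Lc, of j q] by (auto simp: L_def simp del: index_mult_mat(1))
    qed (use Jc Lc in auto)
    show "L * K = trace_form ?d"
    proof (rule eq_matI)
      fix j i assume "j < dim_row (trace_form ?d)" "i < dim_col (trace_form ?d)"
      then have ji: "j < ?d" "i < ?d" by auto
      have "(L * K) $$ (j, i) = (\<Sum>p<?N. L $$ (j, p) * K $$ (p, i))"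
        by (rule index_mult_mat_sum[OF Lc Kc ji])
      also have "\<dots> = (\<Sum>p<?N. if p = n - 1 + j then trace_form ?d $$ (j, i) else 0)"
        using ji n by (intro sum.cong) (auto simp: L_def K_def ka_def)
      finally show "(L * K) $$ (j, i) = trace_form ?d $$ (j, i)" using la[OF ji(1)] by simp
    qed (use Kc Lc in auto)
    show "T x \<in> carrier_mat ?d ?d" for x by (simp add: T_def)
    show "T (x + y) = T x + T y" if "x \<in> carrier_mat ?N ?N" "y \<in> carrier_mat ?N ?N" for x y
      using that ka la n by (intro eq_matI) (auto simp: T_def algebra_simps)
    show "T (c \<cdot>\<^sub>m x) = c \<cdot>\<^sub>m T x" if "x \<in> carrier_mat ?N ?N" for c x
      using that ka la n by (intro eq_matI) (auto simp: T_def algebra_simps)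
    show "T (K * S * L) = S" if S: "S \<in> carrier_mat ?d ?d" for S
    proof (rule eq_matI)
      fix i j assume "i < dim_row S" "j < dim_col S"
      then have ij: "i < ?d" "j < ?d" using S by auto
      have "(K * S * L) $$ (0, 0) = 0" using KSL[OF S, of 0 0] n by simp
      moreover have "(K * S * L) $$ (ka i, n - 1 + j) = S $$ (i, j)"
        using KSL[OF S ka[OF ij(1)] la[OF ij(2)]] n by (auto simp: ka_def)
      ultimately show "T (K * S * L) $$ (i, j) = S $$ (i, j)" using ij by (simp add: T_def)
    qed (use S in \<open>auto simp: T_def\<close>)
    show "T (J ^\<^sub>m l) = 0\<^sub>m ?d ?d" if l: "l < n - 1" for l
    proof (rule eq_matI)
      fix i j assume "i < dim_row (0\<^sub>m ?d ?d)" "j < dim_col (0\<^sub>m ?d ?d)"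
      then have ij: "i < ?d" "j < ?d" by auto
      have 1: "(J ^\<^sub>m l) $$ (0, 0) = (if l = 0 then 1 else 0)" using pow[of 0 0 l] n by simp
      have 2: "(J ^\<^sub>m l) $$ (ka i, n - 1 + j) = (if l = 0 then trace_form ?d $$ (i, j) else 0)"
        using pow[OF ka[OF ij(1)] la[OF ij(2)], of l] l n ij by (auto simp: ka_def)
      show "T (J ^\<^sub>m l) $$ (i, j) = 0\<^sub>m ?d ?d $$ (i, j)"
        using ij 1 2 by (simp add: T_def)
    qed (auto simp: T_def)
    fix x assume "x \<in> lie_centraliser J"
    then have x: "x \<in> carrier_mat ?N ?N" and Jx: "J * x = x * J"
      by (auto simp: lie_centraliser_iff[OF Jc])
    have comm: "(if Suc p < n then x $$ (Suc p, q) else 0) = (if 0 < q \<and> q < n then x $$ (p, q - 1) else 0)"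
      if "p < ?N" "q < ?N" for p q
      using JA[OF x that] AJ[OF x that] Jx by simp
    \<comment> \<open>Commuting with the Jordan matrix makes the n x n corner upper triangular
      Toeplitz and, outside it, leaves only row 0 on the right and column n - 1 below, besides the
      free m x m corner.\<close>
    have toeplitz: "x $$ (p, q) = (if q < p then 0 else x $$ (0, q - p))" if "p < n" "q < n" for p q
      using that
    proof (induction p arbitrary: q)
      case (Suc p)
      have "x $$ (Suc p, q) = (if 0 < q then x $$ (p, q - 1) else 0)"
        using comm[of p q] Suc.prems by simp
      then show ?case using Suc.IH[of "q - 1"] Suc.prems by auto
    qed simp
    have right: "x $$ (p, q) = 0" if "0 < p" "p < n" "n \<le> q" "q < ?N" for p q
      using comm[of "p - 1" q] that by simp
    have bottom: "x $$ (p, q) = 0" if "n \<le> p" "p < ?N" "q < n - 1" for p q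
    proof -
      have "Suc q < ?N" "Suc q < n" using that by auto
      then show ?thesis using comm[of p "Suc q"] that by simp
    qed
    \<comment> \<open>The coefficients are the first row of the Toeplitz block. They stop before l =
      n - 1: that power is the matrix unit at (0, n - 1), which already lies in the image of S
      \<mapsto> K S L.\<close>
    have "x = pow_comb J (\<lambda>l. x $$ (0, l)) (n - 1) + K * T x * L"
    proof (rule eq_matI)
      have Tx: "T x \<in> carrier_mat ?d ?d" by (simp add: T_def)
      have c: "pow_comb J (\<lambda>l. x $$ (0, l)) (n - 1) \<in> carrier_mat ?N ?N" "K * T x * L \<in> carrier_mat ?N ?N"
        using Jc Kc Lc Tx by auto
      fix p q assume "p < dim_row (pow_comb J (\<lambda>l. x $$ (0, l)) (n - 1) + K * T x * L)"
        "q < dim_col (pow_comb J (\<lambda>l. x $$ (0, l)) (n - 1) + K * T x * L)"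
      then have pq: "p < ?N" "q < ?N" using c by auto
      have "pow_comb J (\<lambda>l. x $$ (0, l)) (n - 1) $$ (p, q) =
          (\<Sum>l<n - 1. x $$ (0, l) * (J ^\<^sub>m l) $$ (p, q))"
        by (rule comb[OF pq])
      also have "\<dots> = (\<Sum>l<n - 1. if l = q - p
          then (if p = q then x $$ (0, 0) else if p < q \<and> q < n then x $$ (0, q - p) else 0) else 0)"
        using pq by (intro sum.cong) (auto simp: pow)
      also have "\<dots> = (if p = q then x $$ (0, 0)
          else if p < q \<and> q < n \<and> q - p < n - 1 then x $$ (0, q - p) else 0)"
        using n by auto
      finally have 1: "pow_comb J (\<lambda>l. x $$ (0, l)) (n - 1) $$ (p, q) = (if p = q then x $$ (0, 0)
          else if p < q \<and> q < n \<and> q - p < n - 1 then x $$ (0, q - p) else 0)" .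
      have 2: "(K * T x * L) $$ (p, q) = (if n - 1 \<le> q \<and> (p = 0 \<or> n \<le> p)
          then x $$ (p, q) - (if p = q then x $$ (0, 0) else 0) else 0)"
        unfolding KSL[OF Tx pq] using pq n by (auto simp: T_def ka_def)
      have "(pow_comb J (\<lambda>l. x $$ (0, l)) (n - 1) + K * T x * L) $$ (p, q) =
          pow_comb J (\<lambda>l. x $$ (0, l)) (n - 1) $$ (p, q) + (K * T x * L) $$ (p, q)"
        using pq c by (intro index_add_mat) auto
      also have "\<dots> = x $$ (p, q)"
      proof (cases "p < n")
        case True
        show ?thesis
        proof (cases "q < n")
          case q: True
          show ?thesis unfolding 1 2 using toeplitz[OF True q] True q n by auto
        next
          case False
          then show ?thesis unfolding 1 2 using right[of p q] True pq n by auto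
        qed
      next
        case False
        then show ?thesis unfolding 1 2 using bottom[of p q] pq n by auto
      qed
      finally show "x $$ (p, q) = (pow_comb J (\<lambda>l. x $$ (0, l)) (n - 1) + K * T x * L) $$ (p, q)"
        by simp
    qed (use Jc Kc Lc x in auto)
    then show "\<exists>a. x = pow_comb J a (n - 1) + K * T x * L" by blast
  qed
  then show ?thesis by blast
qed

theorem proposition20:
  fixes e :: "'a::{alg_closed_field, field_char_0} mat"
    and m n :: nat
  assumes "n \<ge> 2"
    and "e \<in> carrier_mat (m + n) (m + n)"
    and "jordan_nf e ((n, 0) # replicate m (1, 0))"
  shows "card (irreducible_components (subtopology (zariski_topology e) (null_cone e))) = m + 1"
proof -
  define J :: "'a mat" where "J = jordan_matrix ((n, 0) # replicate m (1, 0))"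
  obtain P Q where "similar_mat_wit e J P Q"
    using assms(3) unfolding jordan_nf_def similar_mat_def J_def by blast
  from similar_mat_witD2[OF assms(2) this]
  have PQ: "P * Q = 1\<^sub>m (m + n)" "Q * P = 1\<^sub>m (m + n)" "e = P * J * Q"
    "P \<in> carrier_mat (m + n) (m + n)" "Q \<in> carrier_mat (m + n) (m + n)" by blast+
  obtain K L T where "hook_coords J (m + n) (m + 1) n K L T"
    using hook_coords_jordan[OF assms(1) J_def] by blast
  from hook_coords_similar[OF this PQ(3,4,5,1,2)]
  interpret hook_coords e "m + n" "m + 1" n "P * K" "L * Q" "\<lambda>x. T (Q * x * P)" .
  show ?thesis by (rule card_components_null_cone)
qed

end
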